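(* Let $K,L\in\mathcal{K}_+^2$. Then $$\frac{V(K[n-1],L[1])^2}{V(K)}-V(K[n-2],L[2])\geq\frac1n\big(\lambda_2(-L_K)-1\big)\Big(\delta_2^{S_2K}(L,\widetilde{K}[L])\Big)^2.$$
   Context: $\mathcal{K}_+^2$ is the class of convex bodies in $\mathbb{R}^n$ containing the origin in their interior with $C^2$ boundary and strictly positive Gauss curvature, and $h_K$ is the support function on $\mathbb{S}^{n-1}$. $V(\cdot,\ldots,\cdot)$ is the Minkowski mixed volume. $V(K[n-m],L[m])$ means $K$ repeated $n-m$ times and $L$ repeated $m$ times, and $V(K)$ is the volume. Notation on the sphere: - $\mu$ is the spherical Lebesgue measure and $D^2h=\nabla^2h+hI$, with $\nabla$ the round connection. - $dV_K=\frac1n h_K\det(D^2h_K)d\mu$ and $dS_2K=h_K^{-1}\det(D^2h_K)d\mu$. - For a measure $\mathbf m$ and convex bodies $L_1,L_2$, $\delta_2^{\mathbf m}(L_1,L_2)=\big(\int_{\mathbb{S}^{n-1}}(h_{L_1}-h_{L_2})^2d\mathbf m\big)^{1/2}$. - $X_L(x)=h_L(x)x+\nabla h_L(x)$ is the inverse Gauss map of $L$. The extended homothetic transform of $K$ relative to $L$ is $\widetilde K[L]=cK+v$. Here $c=V(K[n-1],L[1])/V(K)$, and $v\in\mathbb{R}^n$ is the unique vector with $\int_{\mathbb{S}^{n-1}}\frac{\langle x,X_L(x)-v\rangle}{h_K(x)^2}x\,dV_K(x)=0$. The operator is $L_Kz=\frac1{n-1}\mathrm{tr}((D^2h_K)^{-1}D^2(zh_K))-z$,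 and $\ell_v^K(x)=\langle x,v\rangle/h_K(x)$. $\lambda_2(-L_K)$ is the infimum of $\int z(-L_Kz)dV_K/\int z^2dV_K$ over nonzero $z\in C^2(\mathbb{S}^{n-1})$ with $\int z\,dV_K=0$ and $\int z\ell_v^KdV_K=0$ for all $v$; this is the second nonzero eigenvalue of $-L_K$. *)

theory Defs
  imports "HOL-Analysis.Analysis"
begin

definition K2plus :: "(real^'n::finite) set \<Rightarrow> bool" where
  "K2plus K \<longleftrightarrow> compact K \<and> convex K \<and> 0 \<in> interior K \<and>
    (\<forall>p\<in>frontier K. \<exists>U (g::real^'n \<Rightarrow> real) (G::real^'n \<Rightarrow> real^'n) (H::real^'n \<Rightarrow> real^'n^'n).
        open U \<and> p \<in> U \<and>
        (\<forall>q\<in>U. (g has_derivative (\<lambda>v. G q \<bullet> v)) (at q) \<and>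
                (G has_derivative (\<lambda>v. H q *v v)) (at q) \<and> G q \<noteq> 0) \<and>
        continuous_on U H \<and>
        K \<inter> U = {q\<in>U. g q \<le> 0} \<and>
        (\<forall>q\<in>U \<inter> frontier K. \<forall>v. v \<noteq> 0 \<and> v \<bullet> G q = 0 \<longrightarrow> v \<bullet> (H q *v v) > 0))"

text \<open>Support function (on all of R^n; it is the 1-homogeneous extension of h_K).\<close>
definition supp :: "(real^'n::finite) set \<Rightarrow> real^'n \<Rightarrow> real" where
  "supp K x = Sup ((\<lambda>y. x \<bullet> y) ` K)"

text \<open>Mixed volumes V(K[n-m],L[m]) via Minkowski's polynomial
  V(K+tL) = sum_m (n choose m) t^m V(K[n-m],L[m]) for t >= 0.\<close>
definition mixvol :: "(real^'n::finite) set \<Rightarrow> (real^'n) set \<Rightarrow> nat \<Rightarrow> real" where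
  "mixvol K L m = (THE c :: nat \<Rightarrow> real. (\<forall>k>CARD('n). c k = 0) \<and>
      (\<forall>t\<ge>0. measure lebesgue {x + t *\<^sub>R y |x y. x \<in> K \<and> y \<in> L} =
              (\<Sum>k\<le>CARD('n). real (CARD('n) choose k) * c k * t ^ k))) m"

definition vol :: "(real^'n::finite) set \<Rightarrow> real" where
  "vol K = measure lebesgue K"

text \<open>Integral over S^{n-1} w.r.t. spherical Lebesgue measure mu, via the identity
  int_S f dmu = n * int_{B} f(y/|y|) dy.\<close>
definition sph_int :: "((real^'n::finite) \<Rightarrow> 'b::euclidean_space) \<Rightarrow> 'b" where
  "sph_int f = real CARD('n) *\<^sub>R integral (ball 0 1) (\<lambda>y. f (y /\<^sub>R norm y))"

definition grad :: "((real^'n::finite) \<Rightarrow> real) \<Rightarrow> real^'n \<Rightarrow> real^'n" where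
  "grad f x = (\<chi> i. frechet_derivative f (at x) (axis i 1))"

definition hess :: "((real^'n::finite) \<Rightarrow> real) \<Rightarrow> real^'n \<Rightarrow> real^'n^'n" where
  "hess f x = (\<chi> i j. frechet_derivative (\<lambda>y. grad f y $ j) (at x) (axis i 1))"

definition outer :: "real^'n::finite \<Rightarrow> real^'n^'n" where
  "outer x = (\<chi> i j. x $ i * x $ j)"

text \<open>For a 1-homogeneous f and unit x, D^2 f(x) = nabla^2 f + f I (on x^perp) is the
  restriction of the Euclidean Hessian of f to x^perp; det(D^2 f)(x) = det(Hess f(x) + x x^T).\<close>
definition detD2 :: "((real^'n::finite) \<Rightarrow> real) \<Rightarrow> real^'n \<Rightarrow> real" where
  "detD2 f x = det (hess f x + outer x)"

definition hom0 :: "((real^'n::finite) \<Rightarrow> real) \<Rightarrow> real^'n \<Rightarrow> real" where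
  "hom0 z y = z (y /\<^sub>R norm y)"

definition int_dV :: "(real^'n::finite) set \<Rightarrow> (real^'n \<Rightarrow> 'b::euclidean_space) \<Rightarrow> 'b" where
  "int_dV K f = sph_int (\<lambda>x. ((1 / real CARD('n)) * supp K x * detD2 (supp K) x) *\<^sub>R f x)"

definition int_dS2 :: "(real^'n::finite) set \<Rightarrow> (real^'n \<Rightarrow> real) \<Rightarrow> real" where
  "int_dS2 K f = sph_int (\<lambda>x. (detD2 (supp K) x / supp K x) * f x)"

definition delta2_S2 :: "(real^'n::finite) set \<Rightarrow> (real^'n) set \<Rightarrow> (real^'n) set \<Rightarrow> real" where
  "delta2_S2 K L1 L2 = sqrt (int_dS2 K (\<lambda>x. (supp L1 x - supp L2 x)^2))"

text \<open>Inverse Gauss map X_L(x) = h_L(x) x + nabla h_L(x) = Euclidean gradient of h_L at x.\<close>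
definition Xmap :: "(real^'n::finite) set \<Rightarrow> real^'n \<Rightarrow> real^'n" where
  "Xmap L x = grad (supp L) x"

definition ext_homothetic :: "(real^'n::finite) set \<Rightarrow> (real^'n) set \<Rightarrow> (real^'n) set" where
  "ext_homothetic K L =
     (let c = mixvol K L 1 / vol K;
          v = (THE v. int_dV K (\<lambda>x. ((x \<bullet> (Xmap L x - v)) / (supp K x)^2) *\<^sub>R x) = 0)
      in {c *\<^sub>R y + v |y. y \<in> K})"

text \<open>The operator L_K z = (1/(n-1)) tr((D^2 h_K)^{-1} D^2(z h_K)) - z, on the sphere;
  the trace over x^perp is computed as trace(inverse(Hess h_K + x x^T) * Hess(z h_K)).\<close>
definition LK :: "(real^'n::finite) set \<Rightarrow> (real^'n \<Rightarrow> real) \<Rightarrow> real^'n \<Rightarrow> real" where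
  "LK K z x = (1 / (real CARD('n) - 1)) *
      trace (matrix_inv (hess (supp K) x + outer x) ** hess (\<lambda>y. hom0 z y * supp K y) x) - z x"

definition ellv :: "(real^'n::finite) set \<Rightarrow> real^'n \<Rightarrow> real^'n \<Rightarrow> real" where
  "ellv K v x = (x \<bullet> v) / supp K x"

definition C2_sphere :: "((real^'n::finite) \<Rightarrow> real) \<Rightarrow> bool" where
  "C2_sphere z \<longleftrightarrow> (\<exists>(G::real^'n \<Rightarrow> real^'n) (H::real^'n \<Rightarrow> real^'n^'n).
      (\<forall>q. q \<noteq> 0 \<longrightarrow> (hom0 z has_derivative (\<lambda>v. G q \<bullet> v)) (at q) \<and>
                      (G has_derivative (\<lambda>v. H q *v v)) (at q)) \<and>
      continuous_on (- {0}) H)"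

definition lambda2 :: "(real^'n::finite) set \<Rightarrow> real" where
  "lambda2 K = Inf {int_dV K (\<lambda>x. z x * (- LK K z x)) / int_dV K (\<lambda>x. (z x)^2) | z.
      C2_sphere z \<and> (\<exists>x\<in>sphere 0 1. z x \<noteq> 0) \<and>
      int_dV K z = 0 \<and> (\<forall>v. int_dV K (\<lambda>x. z x * ellv K v x) = 0)}"

end

theory Submission
  imports Defs
begin

text \<open>
  Write \<open>h\<close>, \<open>g\<close> for the support functions of \<open>K\<close>, \<open>L\<close>, and for 1-homogeneous \<open>u\<close>, \<open>w\<close> let \<open>A(u, w)\<close> be
  the integral over the sphere of \<open>u\<close> times the derivative of \<open>det D\<^sup>2h\<close> in direction \<open>D\<^sup>2w\<close>. The
  map \<open>y \<mapsto> |y| \<nabla>h(y)\<close> sends the unit ball onto \<open>K\<close>, which gives \<open>V(K) = 1/n \<integral> h det D\<^sup>2h\<close>. Since the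
  Jacobian determinant is a null Lagrangian, the first variation of this functional in direction
  \<open>u\<close> is \<open>\<integral> u det D\<^sup>2h\<close>; this uses only two derivatives of \<open>h\<close>. Hence \<open>A\<close> is symmetric, \<open>V(K[n-1],L[1])\<close>
  and \<open>V(K[n-2],L[2])\<close> are the expected integrals, and \<open>L\<^sub>K\<close> is self-adjoint with
  \<open>-L\<^sub>K \<ge> 0\<close>. The function \<open>\<omega> = (h\<^sub>L - h\<^sub>M)/h\<^sub>K\<close>, where \<open>M\<close> is the extended homothetic transform, is
  orthogonal to the constants and to all \<open>\<ell>\<^sub>v\<close>, and expanding \<open>A\<close> gives
  \<open>\<integral> \<omega>(-L\<^sub>K\<omega>) dV\<^sub>K - \<integral> \<omega>\<^sup>2 dV\<^sub>K = V(K[n-1],L[1])\<^sup>2/V(K) - V(K[n-2],L[2])\<close>. The definition of \<open>\<lambda>\<^sub>2\<close> bounds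
  the left-hand side from below.
\<close>

section \<open>Change of variables over an arbitrary finite index type\<close>

text \<open>The usual proof that A is symmetric integrates by parts and uses that the cofactor
  matrix of D^2 h is divergence free, which costs a third derivative of h. Here the null Lagrangian
  property is read off from volumes: for small t the image of the ball under y + t Phi(y) is fixed
  by the values of Phi outside the ball. Lipschitz fields suffice for bijectivity, so the origin and
  the unit sphere, where the fields may fail to be differentiable, do no harm.

  Comparing two extensions of the same boundary values then gives information: both Jacobian
  integrals are polynomials in s built from integrals X_k (of h) and Y_k (of u) against coefficients
  of det D^2(h + s u), once as X_k + Y_k and once as (X_k + (n+1) Y_k) / (k+1).

  All calculus stays Euclidean, on homogeneous extensions of functions on the sphere. Since
  \<open>K2plus\<close> describes the boundary by local defining functions, the regularity of h and
  the positivity of its Hessian are derived, through the map sending a boundary point to its polar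
  dual point.\<close>

text \<open>The library's change of variables formula needs a well-ordered index type. A copy of the
  index type, ordered through an arbitrary enumeration, removes this restriction.\<close>

typedef 'a ordered_copy = "UNIV :: 'a set" by simp

instance ordered_copy :: (finite) finite
proof
  have "range (Abs_ordered_copy :: 'a \<Rightarrow> _) = UNIV"
    by (metis Abs_ordered_copy_cases surj_def)
  then show "finite (UNIV :: 'a ordered_copy set)"
    by (metis finite finite_imageI)
qed

definition enum_index :: "'a::finite \<Rightarrow> nat" where
  "enum_index = (SOME f. inj f)"

lemma inj_enum_index: "inj (enum_index :: 'a::finite \<Rightarrow> nat)"
  unfolding enum_index_def
  by (rule someI_ex[where P = inj]) (use finite_imp_inj_to_nat_seg[of "UNIV :: 'a set"] in auto)

instantiation ordered_copy :: (finite) wellorder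
begin

definition "x \<le> y \<longleftrightarrow> enum_index (Rep_ordered_copy x) \<le> enum_index (Rep_ordered_copy y)"
definition "x < y \<longleftrightarrow> enum_index (Rep_ordered_copy x) < enum_index (Rep_ordered_copy y)"

instance
proof
  fix x y z :: "'a ordered_copy"
  show "x < y \<longleftrightarrow> x \<le> y \<and> \<not> y \<le> x" "x \<le> x" "x \<le> y \<or> y \<le> x"
    by (auto simp: less_eq_ordered_copy_def less_ordered_copy_def)
  show "x \<le> z" if "x \<le> y" "y \<le> z"
    using that by (auto simp: less_eq_ordered_copy_def)
  show "x = y" if "x \<le> y" "y \<le> x"
    using that by (metis less_eq_ordered_copy_def inj_enum_index injD order_antisym Rep_ordered_copy_inject)
next
  fix P :: "'a ordered_copy \<Rightarrow> bool" and a :: "'a ordered_copy"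
  assume *: "\<And>x. (\<And>y. y < x \<Longrightarrow> P y) \<Longrightarrow> P x"
  show "P a"
    by (induction a rule: measure_induct_rule[of "\<lambda>x. enum_index (Rep_ordered_copy x)"])
      (use * in \<open>auto simp: less_ordered_copy_def\<close>)
qed

end

definition to_copy :: "'b^'n \<Rightarrow> 'b^('n::finite ordered_copy)" where
  "to_copy x = (\<chi> i. x $ Rep_ordered_copy i)"

definition of_copy :: "'b^('n::finite ordered_copy) \<Rightarrow> 'b^'n" where
  "of_copy x = (\<chi> i. x $ Abs_ordered_copy i)"

lemma to_of_copy [simp]: "to_copy (of_copy x) = x" "of_copy (to_copy y) = y"
  by (auto simp: to_copy_def of_copy_def vec_eq_iff Rep_ordered_copy_inverse Abs_ordered_copy_inverse)

lemma bij_Rep_copy: "bij (Rep_ordered_copy :: 'n::finite ordered_copy \<Rightarrow> 'n)"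
  by (metis Abs_ordered_copy_inverse UNIV_I Rep_ordered_copy_inverse bijI')

lemma linear_to_copy: "linear (to_copy :: real^'n::finite \<Rightarrow> _)"
  by (auto simp: linear_iff to_copy_def vec_eq_iff)

lemma linear_of_copy: "linear (of_copy :: _ \<Rightarrow> real^'n::finite)"
  by (auto simp: linear_iff of_copy_def vec_eq_iff)

lemma norm_to_copy [simp]: "norm (to_copy (x :: real^'n::finite)) = norm x"
proof -
  have "(\<Sum>i\<in>UNIV. (x $ Rep_ordered_copy i)\<^sup>2) = (\<Sum>i\<in>UNIV. (x $ i)\<^sup>2)"
    by (rule sum.reindex_bij_betw[OF bij_Rep_copy])
  then show ?thesis
    by (simp add: norm_vec_def L2_set_def to_copy_def)
qed

lemma norm_of_copy [simp]: "norm (of_copy x :: real^'n::finite) = norm x"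
  by (metis norm_to_copy to_of_copy(1))

lemma copy_images:
  fixes S :: "(real^'n::finite) set"
  shows "to_copy ` S = of_copy -` S" "of_copy ` T = to_copy -` (T :: (real^('n ordered_copy)) set)"
  by (auto simp: image_iff) (metis to_of_copy)+

lemma to_copy_cbox: "to_copy ` cbox a b = cbox (to_copy a) (to_copy (b :: real^'n::finite))"
proof -
  have "(\<forall>i. a $ i \<le> y $ Abs_ordered_copy i \<and> y $ Abs_ordered_copy i \<le> b $ i) \<longleftrightarrow>
     (\<forall>i. a $ Rep_ordered_copy i \<le> y $ i \<and> y $ i \<le> b $ Rep_ordered_copy i)" for y :: "real^('n ordered_copy)"
    by (intro iffI allI) (metis Rep_ordered_copy_inverse, metis Abs_ordered_copy_inverse UNIV_I)
  then show ?thesis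
    unfolding copy_images by (auto simp: mem_box_cart to_copy_def of_copy_def)
qed

lemma of_copy_cbox: "of_copy ` cbox a b = cbox (of_copy a) (of_copy b :: real^'n::finite)"
proof -
  have "cbox (of_copy a) (of_copy b :: real^'n) = of_copy ` to_copy ` cbox (of_copy a) (of_copy b)"
    by (simp add: image_image)
  then show ?thesis
    by (simp only: to_copy_cbox to_of_copy)
qed

lemma content_to_copy: "measure lborel (to_copy ` cbox a b) = measure lborel (cbox a (b :: real^'n::finite))"
proof (cases "cbox a b = {}")
  case False
  have "measure lborel (to_copy ` cbox a b) = (\<Prod>i\<in>UNIV. b $ Rep_ordered_copy i - a $ Rep_ordered_copy i)"
    using False unfolding to_copy_cbox
    by (subst content_cbox_cart) (simp_all flip: to_copy_cbox, simp add: to_copy_def)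
  also have "\<dots> = (\<Prod>i\<in>UNIV. b $ i - a $ i)"
    by (rule prod.reindex_bij_betw[OF bij_Rep_copy])
  finally show ?thesis
    using False by (simp add: content_cbox_cart)
qed simp

lemma copy_continuous [simp]: "continuous (at x) (to_copy :: real^'n::finite \<Rightarrow> _)"
   "continuous (at y) (of_copy :: _ \<Rightarrow> real^'n::finite)"
  by (simp_all add: linear_to_copy linear_of_copy linear_continuous_at linear_linear)

lemma content_of_copy: "measure lborel (of_copy ` cbox a b :: (real^'n::finite) set) = measure lborel (cbox a b)"
proof -
  have "measure lborel (cbox (of_copy a) (of_copy b :: real^'n)) = measure lborel (cbox a b)"
    by (metis content_to_copy of_copy_cbox to_copy_cbox to_of_copy(1))
  then show ?thesis
    by (simp add: of_copy_cbox)
qed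

lemma has_integral_UNIV:
  fixes f :: "'a::euclidean_space \<Rightarrow> 'b::euclidean_space"
  shows "(f has_integral y) UNIV \<longleftrightarrow> (\<forall>e>0. \<exists>B>0. \<forall>a b. ball 0 B \<subseteq> cbox a b \<longrightarrow>
      (\<exists>z. (f has_integral z) (cbox a b) \<and> norm (z - y) < e))"
proof -
  have "UNIV \<noteq> cbox a (b::'a)" for a b
    by (metis bounded_cbox not_bounded_UNIV)
  then show ?thesis
    by (subst has_integral_alt) auto
qed

text \<open>\<open>has_integral_twiddle\<close> moves integrals between boxes. A norm-preserving T
  pulls a box around \<open>ball 0 B\<close> back to a box around a ball of the same radius, so one
  B serves both limits over growing boxes.\<close>

lemma has_integral_UNIV_transport:
  fixes f :: "'a::euclidean_space \<Rightarrow> 'b::euclidean_space" and T :: "'a \<Rightarrow> 'c::euclidean_space"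
  assumes inv: "\<And>x. T' (T x) = x" "\<And>y. T (T' y) = y" and cont: "\<And>y. continuous (at y) T'"
    and norm: "\<And>x. norm (T x) = norm x"
    and box: "\<And>a b. T ` cbox a b = cbox (T a) (T b)" "\<And>a b. T' ` cbox a b = cbox (T' a) (T' b)"
    and vol: "\<And>a b. measure lborel (T' ` cbox a b) = measure lborel (cbox a b)"
    and f: "(f has_integral i) UNIV"
  shows "(f \<circ> T' has_integral i) UNIV"
  unfolding has_integral_UNIV
proof (intro allI impI)
  fix e :: real assume "e > 0"
  then obtain B where B: "B > 0" "\<And>a b. ball 0 B \<subseteq> cbox a b \<Longrightarrow>
    (\<exists>z. (f has_integral z) (cbox a b) \<and> norm (z - i) < e)"
    using f unfolding has_integral_UNIV by blast
  show "\<exists>B>0. \<forall>a b. ball 0 B \<subseteq> cbox a b \<longrightarrow>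
    (\<exists>z. (f \<circ> T' has_integral z) (cbox a b) \<and> norm (z - i) < e)"
  proof (intro exI[of _ B] conjI allI impI)
    fix a b :: 'c assume sub: "ball 0 B \<subseteq> cbox a b"
    have "ball 0 B \<subseteq> cbox (T' a) (T' b)"
    proof
      fix x :: 'a assume "x \<in> ball 0 B"
      then have "T x \<in> cbox a b" using sub by (auto simp: norm)
      then show "x \<in> cbox (T' a) (T' b)"
        by (metis image_eqI box(2) inv(1))
    qed
    then obtain z where z: "(f has_integral z) (cbox (T' a) (T' b))" "norm (z - i) < e"
      using B(2) by blast
    have "((\<lambda>x. f (T' x)) has_integral (1/1) *\<^sub>R z) (T ` cbox (T' a) (T' b))"
      by (rule has_integral_twiddle[where h = T]) (use z inv cont vol in \<open>auto simp: box\<close>)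
    then show "\<exists>z. (f \<circ> T' has_integral z) (cbox a b) \<and> norm (z - i) < e"
      using z(2) by (auto simp: box inv o_def)
  qed (use B in auto)
qed

lemma has_integral_copy_UNIV:
  fixes f :: "real^'n::finite \<Rightarrow> 'b::euclidean_space"
  shows "(f has_integral i) UNIV \<longleftrightarrow> (f \<circ> of_copy has_integral i) UNIV"
proof
  assume "(f has_integral i) UNIV"
  then show "(f \<circ> of_copy has_integral i) UNIV"
    by (rule has_integral_UNIV_transport[where T = to_copy, rotated 7])
      (simp_all add: to_copy_cbox of_copy_cbox content_of_copy[unfolded of_copy_cbox])
next
  assume "(f \<circ> of_copy has_integral i) UNIV"
  then have "(f \<circ> of_copy \<circ> to_copy has_integral i) UNIV"
    by (rule has_integral_UNIV_transport[where T = of_copy, rotated 7])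
      (simp_all add: to_copy_cbox of_copy_cbox content_to_copy[unfolded to_copy_cbox])
  then show "(f has_integral i) UNIV"
    by (simp add: o_def)
qed

lemma has_integral_copy:
  fixes f :: "real^'n::finite \<Rightarrow> 'b::euclidean_space"
  shows "(f has_integral i) S \<longleftrightarrow> ((\<lambda>x. f (of_copy x)) has_integral i) (to_copy ` S)"
proof -
  have "(\<lambda>x. if x \<in> S then f x else 0) \<circ> of_copy = (\<lambda>x. if x \<in> to_copy ` S then f (of_copy x) else 0)"
    by (auto simp: copy_images)
  then show ?thesis
    using has_integral_copy_UNIV[of "\<lambda>x. if x \<in> S then f x else 0" i]
      has_integral_restrict_UNIV[of S f i] has_integral_restrict_UNIV[of "to_copy ` S" "\<lambda>x. f (of_copy x)" i]
    by simp
qed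

text \<open>Relabelling rows and columns by one bijection conjugates the permutations of the Leibniz
  sum, and conjugation preserves the sign. The sign is followed by induction over transpositions,
  because the two permutations live on different types.\<close>

lemma matrix_copy:
  fixes f :: "real^'n::finite \<Rightarrow> real^'n"
  shows "det (matrix (\<lambda>v. to_copy (f (of_copy v)))) = det (matrix f)"
proof -
  let ?R = "Rep_ordered_copy :: 'n ordered_copy \<Rightarrow> 'n"
  let ?A = "matrix f"
  have ax: "of_copy (axis j 1) = axis (?R j) (1::real)" for j
    by (auto simp: of_copy_def axis_def vec_eq_iff Rep_ordered_copy_inverse Abs_ordered_copy_inverse)
  have m: "matrix (\<lambda>v. to_copy (f (of_copy v))) = (\<chi> i j. ?A $ ?R i $ ?R j)"
    by (simp add: matrix_def ax to_copy_def vec_eq_iff)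
  have inv: "?R (inv ?R i) = i" "inv ?R (?R j) = j" for i j
    by (simp_all add: bij_is_surj[OF bij_Rep_copy] bij_is_inj[OF bij_Rep_copy] surj_f_inv_f)
  define cnj where "cnj p = ?R \<circ> p \<circ> inv ?R" for p
  have bij: "bij_betw cnj {p. p permutes UNIV} {p. p permutes (UNIV :: 'n set)}"
  proof (rule bij_betwI[where g = "\<lambda>q. inv ?R \<circ> q \<circ> ?R"])
    have "bij (cnj p)" if "bij p" for p
      unfolding cnj_def using that bij_Rep_copy by (intro bij_comp) (auto intro: bij_imp_bij_inv)
    then show "cnj \<in> {p. p permutes UNIV} \<rightarrow> {p. p permutes UNIV}"
      by (auto simp: permutes_bij intro!: bij_imp_permutes)
    have "bij (inv ?R \<circ> q \<circ> ?R)" if "bij q" for q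
      using that bij_Rep_copy by (intro bij_comp) (auto intro: bij_imp_bij_inv)
    then show "(\<lambda>q. inv ?R \<circ> q \<circ> ?R) \<in> {p. p permutes UNIV} \<rightarrow> {p. p permutes UNIV}"
      by (auto simp: permutes_bij intro!: bij_imp_permutes)
  qed (auto simp: cnj_def fun_eq_iff inv)
  have sgn: "sign (cnj p) = sign p" if "p permutes UNIV" for p :: "'n ordered_copy \<Rightarrow> 'n ordered_copy"
    using that finite
  proof (induction p rule: permutes_induct)
    case id
    then show ?case by (simp add: cnj_def o_def inv id_def[symmetric])
  next
    case (swap a b p)
    have 1: "cnj (Transposition.transpose a b \<circ> p) = Transposition.transpose (?R a) (?R b) \<circ> cnj p"
      by (auto simp: cnj_def fun_eq_iff Transposition.transpose_def inv Rep_ordered_copy_inject)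
    have "cnj p permutes UNIV"
      using swap bij_betwE[OF bij] by blast
    then have "permutation (cnj p)" "permutation p"
      using swap unfolding permutation_permutes by (meson finite)+
    then show ?case
      using swap.IH swap.hyps unfolding 1
      by (subst (1 2) sign_compose) (simp_all add: permutation_swap_id sign_swap_id Rep_ordered_copy_inject)
  qed
  have pr: "(\<Prod>i\<in>UNIV. ?A $ ?R i $ ?R (p i)) = (\<Prod>i\<in>UNIV. ?A $ i $ cnj p i)" for p
    using prod.reindex_bij_betw[OF bij_Rep_copy, of "\<lambda>i. ?A $ i $ cnj p i"] by (simp add: cnj_def inv)
  show ?thesis
    unfolding m det_def
    by (subst sum.reindex_bij_betw[OF bij, symmetric]) (simp add: pr sgn)
qed

theorem change_of_variables:
  fixes f :: "real^'n::finite \<Rightarrow> real" and g :: "real^'n \<Rightarrow> real^'n"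
  assumes "open S"
    and der: "\<And>x. x \<in> S \<Longrightarrow> (g has_derivative g' x) (at x)"
    and inj: "inj_on g S"
    and int: "(\<lambda>x. \<bar>det (matrix (g' x))\<bar> * f (g x)) absolutely_integrable_on S"
  shows "(f has_integral (integral S (\<lambda>x. \<bar>det (matrix (g' x))\<bar> * f (g x)))) (g ` S)"
proof -
  define G where "G = (\<lambda>x. to_copy (g (of_copy x)))"
  define G' where "G' x = (\<lambda>v. to_copy (g' (of_copy x) (of_copy v)))" for x
  \<comment> \<open>The change of variables theorem for ordered indices takes vector-valued
    integrands, so the scalar one is wrapped into \<open>real^1\<close>.\<close>
  define F where "F x = (vec (f (of_copy x)) :: real^1)" for x
  define D where "D = (\<lambda>x. \<bar>det (matrix (g' x))\<bar> * f (g x))"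
  let ?S = "to_copy ` S"
  have bl: "bounded_linear (to_copy :: real^'n \<Rightarrow> _)" "bounded_linear (of_copy :: _ \<Rightarrow> real^'n)"
    by (simp_all add: linear_to_copy linear_of_copy linear_linear)
  have "open ?S"
    unfolding copy_images by (rule open_vimage[OF \<open>open S\<close>]) (simp add: continuous_at_imp_continuous_on)
  then have S: "?S \<in> sets lebesgue" by simp
  have der': "(G has_derivative G' x) (at x within ?S)" if "x \<in> ?S" for x
  proof -
    have "(g has_derivative g' (of_copy x)) (at (of_copy x))"
      using that by (auto intro: der)
    then have "(g \<circ> of_copy has_derivative g' (of_copy x) \<circ> of_copy) (at x)"
      using diff_chain_at[OF bounded_linear_imp_has_derivative[OF bl(2)]] by blast
    then have "(to_copy \<circ> (g \<circ> of_copy) has_derivative to_copy \<circ> (g' (of_copy x) \<circ> of_copy)) (at x)"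
      using diff_chain_at[OF _ bounded_linear_imp_has_derivative[OF bl(1)]] by blast
    then show ?thesis
      by (simp add: G_def G'_def o_def has_derivative_at_withinI)
  qed
  have inj': "inj_on G ?S"
    using inj unfolding G_def inj_on_def by (metis (no_types, lifting) image_iff to_of_copy(2))
  have img: "G ` ?S = to_copy ` (g ` S)"
    by (auto simp: G_def image_image)
  have Deq: "\<bar>det (matrix (G' x))\<bar> *\<^sub>R F (G x) = vec (D (of_copy x))" for x
    unfolding G'_def matrix_copy by (simp add: F_def D_def G_def vec_eq_iff)
  have "D absolutely_integrable_on S" using int by (simp add: D_def)
  then have "(D has_integral integral S D) S" and "((\<lambda>x. norm (D x)) has_integral integral S (\<lambda>x. norm (D x))) S"
    by (auto simp: absolutely_integrable_on_def)
  then have a: "((\<lambda>x. D (of_copy x)) has_integral integral S D) ?S" and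
     "((\<lambda>x. norm (D (of_copy x))) has_integral integral S (\<lambda>x. norm (D x))) ?S"
    using has_integral_copy[of D] has_integral_copy[of "\<lambda>x. norm (D x)"] by blast+
  then have b: "(\<lambda>x. D (of_copy x)) absolutely_integrable_on ?S"
    by (auto simp: absolutely_integrable_on_def)
  have "(\<lambda>x. \<bar>det (matrix (G' x))\<bar> *\<^sub>R F (G x)) absolutely_integrable_on ?S \<and>
       integral ?S (\<lambda>x. \<bar>det (matrix (G' x))\<bar> *\<^sub>R F (G x)) = vec (integral S D)"
    unfolding Deq absolutely_integrable_on_1_iff integral_on_1_eq using a b by (auto simp: has_integral_iff)
  then have "F absolutely_integrable_on (G ` ?S) \<and> integral (G ` ?S) F = vec (integral S D)"
    using has_absolute_integral_change_of_variables[OF S der' inj', of F "vec (integral S D)"] by blast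
  then have "((\<lambda>x. f (of_copy x)) has_integral integral S D) (to_copy ` (g ` S))"
    unfolding absolutely_integrable_on_1_iff integral_on_1_eq img F_def has_integral_iff
    by (auto simp: absolutely_integrable_on_def vec_eq_iff)
  then show ?thesis
    by (simp add: has_integral_copy[symmetric] D_def)
qed

section \<open>Expansions of determinants\<close>

definition rowmix :: "'n set \<Rightarrow> real^'n^'n \<Rightarrow> real^'n^'n \<Rightarrow> real^'n::finite^'n" where
  "rowmix S A B = (\<chi> i. if i \<in> S then B $ i else A $ i)"

text \<open>This is \<open>CARD('n) choose k\<close> times the mixed discriminant with n - k entries
  A and k entries B. As an explicit sum over sets of rows it is visibly continuous, and additive in
  B when k is 1.\<close>

definition detcoef :: "nat \<Rightarrow> real^'n^'n \<Rightarrow> real^'n::finite^'n \<Rightarrow> real" where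
  "detcoef k A B = (\<Sum>S | card S = k. det (rowmix S A B))"

lemma det_add_scaleR:
  fixes A B :: "real^'n::finite^'n"
  shows "det (A + t *\<^sub>R B) = (\<Sum>k\<le>CARD('n). detcoef k A B * t ^ k)"
proof -
  have pr: "(\<Prod>i\<in>UNIV. (A + t *\<^sub>R B) $ i $ p i) =
      (\<Sum>X\<in>UNIV. t ^ card X * (\<Prod>i\<in>UNIV. rowmix X A B $ i $ p i))" for p :: "'n \<Rightarrow> 'n"
  proof -
    have "(\<Prod>i\<in>UNIV. (A + t *\<^sub>R B) $ i $ p i) = (\<Prod>i\<in>UNIV. t * B $ i $ p i + A $ i $ p i)"
      by (simp add: add.commute)
    also have "\<dots> = (\<Sum>X\<in>Pow UNIV. (\<Prod>i\<in>X. t * B $ i $ p i) * (\<Prod>i\<in>UNIV - X. A $ i $ p i))"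
      by (rule prod_add) simp
    also have "\<dots> = (\<Sum>X\<in>UNIV. t ^ card X * (\<Prod>i\<in>UNIV. rowmix X A B $ i $ p i))"
    proof (rule sum.cong)
      fix X :: "'n set"
      have "(\<Prod>i\<in>UNIV. rowmix X A B $ i $ p i)
          = (\<Prod>i\<in>X. rowmix X A B $ i $ p i) * (\<Prod>i\<in>UNIV - X. rowmix X A B $ i $ p i)"
        by (simp add: mult.commute prod.subset_diff[of X UNIV])
      also have "\<dots> = (\<Prod>i\<in>X. B $ i $ p i) * (\<Prod>i\<in>UNIV - X. A $ i $ p i)"
        by (intro arg_cong2[where f = "(*)"] prod.cong) (auto simp: rowmix_def)
      finally show "(\<Prod>i\<in>X. t * B $ i $ p i) * (\<Prod>i\<in>UNIV - X. A $ i $ p i) =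
          t ^ card X * (\<Prod>i\<in>UNIV. rowmix X A B $ i $ p i)"
        by (simp add: prod.distrib)
    qed simp
    finally show ?thesis .
  qed
  have "det (A + t *\<^sub>R B) = (\<Sum>p | p permutes UNIV. \<Sum>X\<in>UNIV.
      of_int (sign p) * (t ^ card X * (\<Prod>i\<in>UNIV. rowmix X A B $ i $ p i)))"
    unfolding det_def pr by (simp add: sum_distrib_left)
  also have "\<dots> = (\<Sum>X\<in>UNIV. det (rowmix X A B) * t ^ card X)"
    unfolding det_def by (subst sum.swap) (simp add: sum_distrib_left sum_distrib_right mult_ac)
  also have "\<dots> = (\<Sum>k\<le>CARD('n). \<Sum>X | X \<in> UNIV \<and> card X = k. det (rowmix X A B) * t ^ card X)"
    by (rule sum.group[symmetric]) (auto simp: card_mono)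
  also have "\<dots> = (\<Sum>k\<le>CARD('n). detcoef k A B * t ^ k)"
    by (auto simp: detcoef_def sum_distrib_right intro!: sum.cong)
  finally show ?thesis .
qed

lemma detcoef_0 [simp]: "detcoef 0 A B = det (A :: real^'n::finite^'n)"
proof -
  have "{S :: 'n set. card S = 0} = {{}}" by auto
  then show ?thesis by (simp add: detcoef_def rowmix_def)
qed

lemma detcoef_top [simp]: "detcoef CARD('n) A B = det (B :: real^'n::finite^'n)"
proof -
  have "{S :: 'n set. card S = CARD('n)} = {UNIV}" by (auto dest: card_eq_UNIV_imp_eq_UNIV[OF finite])
  then show ?thesis by (simp add: detcoef_def rowmix_def)
qed

lemma detcoef_1: "detcoef (Suc 0) A B = (\<Sum>i\<in>UNIV. det (rowmix {i} A (B :: real^'n::finite^'n)))"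
proof -
  have "{S :: 'n set. card S = Suc 0} = range (\<lambda>i. {i})" by (auto simp: card_Suc_eq)
  then show ?thesis
    unfolding detcoef_def by (simp add: sum.reindex)
qed

lemma continuous_on_matrix_entries:
  fixes A :: "'a::topological_space \<Rightarrow> real^'n::finite^'m::finite"
  shows "continuous_on S A \<longleftrightarrow> (\<forall>i j. continuous_on S (\<lambda>x. A x $ i $ j))"
proof
  assume "\<forall>i j. continuous_on S (\<lambda>x. A x $ i $ j)"
  then have "continuous_on S (\<lambda>x. \<chi> i j. A x $ i $ j)"
    by (intro continuous_on_vec_lambda) auto
  then show "continuous_on S A" by (simp add: vec_nth_inverse)
qed (auto intro: continuous_intros)

lemma continuous_on_det [continuous_intros]:
  fixes A :: "'a::topological_space \<Rightarrow> real^'n::finite^'n"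
  assumes "continuous_on S A"
  shows "continuous_on S (\<lambda>x. det (A x))"
  using assms unfolding det_def by (intro continuous_intros) auto

lemma continuous_on_rowmix [continuous_intros]:
  fixes A :: "'a::topological_space \<Rightarrow> real^'n::finite^'n"
  assumes "continuous_on S A" "continuous_on S B"
  shows "continuous_on S (\<lambda>x. rowmix X (A x) (B x))"
  unfolding continuous_on_matrix_entries
proof (intro allI)
  fix i j show "continuous_on S (\<lambda>x. rowmix X (A x) (B x) $ i $ j)"
    using assms by (cases "i \<in> X") (auto simp: rowmix_def intro!: continuous_intros)
qed

lemma continuous_on_detcoef [continuous_intros]:
  fixes A :: "'a::topological_space \<Rightarrow> real^'n::finite^'n"
  assumes "continuous_on S A" "continuous_on S B"
  shows "continuous_on S (\<lambda>x. detcoef k (A x) (B x))"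
  using assms unfolding detcoef_def by (intro continuous_intros) auto

lemma matrix_inv_mult_left:
  fixes A :: "real^'n::finite^'n"
  assumes "det A \<noteq> 0"
  shows "matrix_inv A ** A = mat 1"
proof -
  have "\<exists>A'. A ** A' = mat 1 \<and> A' ** A = mat 1"
    using assms by (simp add: invertible_det_nz[symmetric] invertible_def)
  then show ?thesis
    unfolding matrix_inv_def by (rule someI2_ex) blast
qed

text \<open>Jacobi's formula. Writing B = M A, row i of B is a combination of the rows of A, so
  putting it in place of row i of A multiplies the determinant by the diagonal entry M_ii.\<close>

lemma detcoef_1_trace:
  fixes A B :: "real^'n::finite^'n"
  assumes "det A \<noteq> 0"
  shows "detcoef (Suc 0) A B = det A * trace (matrix_inv A ** B)"
proof -
  have inv: "matrix_inv A ** A = mat 1"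
    by (rule matrix_inv_mult_left[OF assms])
  define M where "M = B ** matrix_inv A"
  have B: "B = M ** A"
    by (simp add: M_def matrix_mul_assoc[symmetric] inv)
  have row: "B $ i = (\<Sum>j\<in>UNIV. M $ i $ j *s row j A)" for i
    by (subst B) (simp add: matrix_matrix_mult_def row_def vec_eq_iff)
  have "det (rowmix {i} A B) = M $ i $ i * det A" for i
  proof -
    have "rowmix {i} A B = (\<chi> k. if k = i then (\<Sum>j\<in>UNIV. M $ i $ j *s row j A) else row k A)"
      by (simp add: rowmix_def vec_eq_iff row[symmetric], simp add: row_def)
    then show ?thesis
      by (simp add: cramer_lemma_transpose)
  qed
  then have "detcoef (Suc 0) A B = trace M * det A"
    by (simp add: detcoef_1 trace_def sum_distrib_right)
  then show ?thesis
    by (metis M_def mult.commute trace_mul_sym)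
qed

lemma detcoef_1_add: "detcoef (Suc 0) A (B + C) = detcoef (Suc 0) A B + detcoef (Suc 0) A C"
  for A :: "real^'n::finite^'n"
proof -
  have "det (rowmix {i} A (B + C)) = det (rowmix {i} A B) + det (rowmix {i} A C)" for i
    using det_row_add[of i "\<lambda>i. B $ i" "\<lambda>i. C $ i" "\<lambda>i. A $ i"] by (simp add: rowmix_def if_distrib cong: if_cong)
  then show ?thesis by (simp add: detcoef_1 sum.distrib)
qed

lemma detcoef_1_scaleR: "detcoef (Suc 0) A (c *\<^sub>R B) = c * detcoef (Suc 0) A B"
  for A :: "real^'n::finite^'n"
proof -
  have "det (rowmix {i} A (c *\<^sub>R B)) = c * det (rowmix {i} A B)" for i
    using det_row_mul[of i c "\<lambda>i. B $ i" "\<lambda>i. A $ i"] by (simp add: rowmix_def scalar_mult_eq_scaleR cong: if_cong)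
  then show ?thesis by (simp add: detcoef_1 sum_distrib_left)
qed

text \<open>The coefficient of s^k in \<open>detcoef (Suc 0) (A + s *\<^sub>R C) B\<close>. The row
  already taken from B does not move with s, hence the zero row in the direction matrix
  \<open>rowmix {i} C 0\<close>.\<close>

definition detcoef2 :: "nat \<Rightarrow> real^'n^'n \<Rightarrow> real^'n^'n \<Rightarrow> real^'n::finite^'n \<Rightarrow> real" where
  "detcoef2 k A B C = (\<Sum>i\<in>UNIV. detcoef k (rowmix {i} A B) (rowmix {i} C 0))"

lemma detcoef_1_expand:
  fixes A B C :: "real^'n::finite^'n"
  shows "detcoef (Suc 0) (A + s *\<^sub>R C) B = (\<Sum>k\<le>CARD('n). detcoef2 k A B C * s ^ k)"
proof -
  have "rowmix {i} (A + s *\<^sub>R C) B = rowmix {i} A B + s *\<^sub>R rowmix {i} C 0" for i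
    by (simp add: rowmix_def vec_eq_iff)
  then show ?thesis
    by (simp add: detcoef_1 det_add_scaleR detcoef2_def sum_distrib_right sum.swap[of _ UNIV])
qed

lemma detcoef2_0 [simp]: "detcoef2 0 A B C = detcoef (Suc 0) A B"
  by (simp add: detcoef2_def detcoef_1)

lemma continuous_on_detcoef2 [continuous_intros]:
  fixes A :: "'a::topological_space \<Rightarrow> real^'n::finite^'n"
  assumes "continuous_on S A" "continuous_on S B" "continuous_on S C"
  shows "continuous_on S (\<lambda>x. detcoef2 k (A x) (B x) (C x))"
  using assms unfolding detcoef2_def by (intro continuous_intros) auto

text \<open>Equality of the mixed second derivatives of det. Both sides sum over ordered pairs of
  distinct rows, one taken from B and the other from C; a pair of equal rows contributes a
  determinant with a zero row.\<close>

lemma detcoef2_sym: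
  fixes A B C :: "real^'n::finite^'n"
  shows "detcoef2 (Suc 0) A B C = detcoef2 (Suc 0) A C B"
proof -
  have *: "det (rowmix {j} (rowmix {i} A B) (rowmix {i} C 0)) =
      (if i = j then 0 else det (\<chi> l. if l = i then B $ l else if l = j then C $ l else A $ l))" for i j and B C :: "real^'n^'n"
  proof (cases "i = j")
    case True
    have "row j (rowmix {j} (rowmix {i} A B) (rowmix {i} C 0)) = 0"
      using True by (simp add: rowmix_def row_def vec_eq_iff)
    then show ?thesis using True det_zero_row(2) by auto
  next
    case False
    then have "rowmix {j} (rowmix {i} A B) (rowmix {i} C 0) = (\<chi> l. if l = i then B $ l else if l = j then C $ l else A $ l)"
      by (auto simp: rowmix_def vec_eq_iff)
    then show ?thesis using False by simp
  qed
  have sw: "(\<chi> l. if l = i then B $ l else if l = j then C $ l else A $ l) =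
      (\<chi> l. if l = j then C $ l else if l = i then B $ l else A $ l)" if "i \<noteq> j" for i j
    using that by (auto simp: vec_eq_iff)
  show ?thesis
    unfolding detcoef2_def detcoef_1 * by (subst sum.swap) (auto intro!: sum.cong simp: sw)
qed

section \<open>Rank-one perturbations of the determinant\<close>

definition dyad :: "real^'n \<Rightarrow> real^'n \<Rightarrow> real^'n::finite^'n" where
  "dyad a b = (\<chi> i j. a $ i * b $ j)"

lemma dyad_mult_vec: "dyad a b *v v = (b \<bullet> v) *\<^sub>R a"
  by (simp add: dyad_def matrix_vector_mult_def vec_eq_iff inner_vec_def sum_distrib_left mult_ac)

lemma outer_eq_dyad: "outer x = dyad x x"
  by (simp add: outer_def dyad_def)

lemma transpose_dyad: "transpose (dyad a b) = dyad b a"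
  by (simp add: dyad_def transpose_def vec_eq_iff)

lemma matrix_mult_dyad: "M ** dyad a b = dyad (M *v a) b"
  by (simp add: matrix_matrix_mult_def matrix_vector_mult_def dyad_def vec_eq_iff sum_distrib_left sum_distrib_right mult_ac)

lemma dyad_matrix_mult: "dyad a b ** M = dyad a (transpose M *v b)"
  by (simp add: matrix_matrix_mult_def matrix_vector_mult_def dyad_def transpose_def vec_eq_iff sum_distrib_left mult_ac)

lemma matrix_add_rdistrib: "(A + B) ** C = A ** C + (B ** C :: real^'n::finite^'n)"
  by (simp add: matrix_matrix_mult_def vec_eq_iff sum.distrib distrib_right)

lemma trace_dyad: "trace (dyad a b) = a \<bullet> b"
  by (simp add: trace_def dyad_def inner_vec_def)

text \<open>Conjugating by an orthogonal matrix that takes a coordinate axis to b leaves a matrix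
  that differs from the identity in one column, where Cramer's rule reads off the
  determinant.\<close>

lemma det_mat1_plus_dyad:
  fixes a b :: "real^'n::finite"
  assumes "norm b = 1"
  shows "det (mat 1 + dyad a b) = 1 + a \<bullet> b"
proof -
  obtain k :: 'n and A where A: "orthogonal_matrix A" "A *v axis k 1 = b"
    using orthogonal_matrix_exists_basis[OF assms] by metis
  have inv: "transpose A ** A = mat 1" "A ** transpose A = mat 1"
    using A(1) by (auto simp: orthogonal_matrix_def)
  have tb: "transpose A *v b = axis k 1"
    using inv by (simp add: A(2)[symmetric] matrix_vector_mul_assoc)
  define c where "c = transpose A *v a"
  have "transpose A ** (mat 1 + dyad a b) ** A = mat 1 + dyad c (axis k 1)"
    by (simp add: matrix_add_ldistrib matrix_mul_assoc[symmetric] matrix_add_rdistrib inv c_def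
        dyad_matrix_mult tb[unfolded transpose_matrix_vector] matrix_mult_dyad)
  moreover have "det A * det A = 1"
    by (metis inv(1) det_I det_mul det_transpose)
  ultimately have "det (mat 1 + dyad a b) = det (mat 1 + dyad c (axis k 1))"
    by (metis det_mul det_transpose mult.assoc mult.commute mult_1)
  also have "mat 1 + dyad c (axis k 1) =
      (\<chi> i j. if j = k then (mat 1 *v (axis k 1 + c)) $ i else mat 1 $ i $ j)"
    unfolding matrix_vector_mul_lid by (auto simp: vec_eq_iff dyad_def mat_def axis_def)
  also have "det \<dots> = 1 + c $ k"
    by (subst cramer_lemma) (simp add: axis_def)
  also have "c $ k = a \<bullet> b"
  proof -
    have "c $ k = c \<bullet> axis k 1" by (simp add: inner_axis)
    also have "\<dots> = a \<bullet> (A *v axis k 1)"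
      unfolding c_def by (simp add: dot_lmul_matrix[symmetric] inner_commute transpose_matrix_vector)
    finally show ?thesis by (simp add: A)
  qed
  finally show ?thesis .
qed

text \<open>Since M^T x = 0, the vector x is fixed by the transpose of M + x x^T, so multiplying M +
  x x^T on the left by 1 + (g - x) x^T only replaces x x^T by g x^T. Applied to the Jacobian of r
  grad h, with g = grad h, it splits off the radial factor g . x = h from det D^2 h.\<close>

lemma det_plus_dyad_null:
  fixes M :: "real^'n::finite^'n"
  assumes "norm x = 1" "transpose M *v x = 0"
  shows "det (M + dyad g x) = (g \<bullet> x) * det (M + dyad x x)"
proof -
  have "transpose (M + dyad x x) *v x = x"
    using assms by (simp add: transpose_def matrix_vector_mult_def vec_eq_iff dyad_def
        sum.distrib distrib_left distrib_right inner_vec_def norm_eq_1 sum_distrib_left[symmetric] mult_ac)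
  then have "(mat 1 + dyad (g - x) x) ** (M + dyad x x) = M + dyad x x + dyad (g - x) x"
    by (simp add: matrix_add_rdistrib dyad_matrix_mult)
  also have "\<dots> = M + dyad g x"
    by (simp add: dyad_def vec_eq_iff algebra_simps)
  finally have "det (M + dyad g x) = (1 + (g - x) \<bullet> x) * det (M + dyad x x)"
    by (metis det_mul det_mat1_plus_dyad assms(1))
  then show ?thesis
    using assms(1) by (simp add: inner_diff_left norm_eq_1)
qed

text \<open>P may fail to be symmetric, so a homotopy takes the place of the spectrum: the segment
  from the identity to P consists of matrices with positive quadratic form, hence invertible, and
  det cannot change sign along it.\<close>

lemma det_pos_of_quadratic_form:
  fixes P :: "real^'n::finite^'n"
  assumes "\<And>v. v \<noteq> 0 \<Longrightarrow> v \<bullet> (P *v v) > 0"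
  shows "det P > 0"
proof (rule ccontr)
  assume neg: "\<not> det P > 0"
  define f where "f s = det ((1 - s) *\<^sub>R mat 1 + s *\<^sub>R P)" for s
  have nz: "f s \<noteq> 0" if "0 \<le> s" "s \<le> 1" for s
  proof -
    let ?N = "(1 - s) *\<^sub>R mat 1 + s *\<^sub>R P"
    have "?N *v v \<noteq> 0" if "v \<noteq> 0" for v
    proof -
      have "v \<bullet> (?N *v v) = (1 - s) * (v \<bullet> v) + s * (v \<bullet> (P *v v))"
        by (simp add: matrix_vector_mult_add_rdistrib scaleR_matrix_vector_assoc[symmetric] inner_right_distrib)
      also have "\<dots> > 0"
        using assms[OF that] that \<open>0 \<le> s\<close> \<open>s \<le> 1\<close>
        by (cases "s = 0") (auto intro!: add_nonneg_pos)
      finally show ?thesis by auto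
    qed
    then show ?thesis
      unfolding f_def using invertible_det_nz matrix_left_invertible_ker invertible_left_inverse by blast
  qed
  have "continuous_on {0..1} f"
    unfolding f_def by (intro continuous_intros)
  moreover have "f 0 = 1" "f 1 \<le> 0"
    using neg by (auto simp: f_def)
  ultimately obtain s where "0 \<le> s" "s \<le> 1" "f s = 0"
    using IVT2'[of f 1 0 0] by auto
  then show False using nz by blast
qed

section \<open>Null Lagrangians and integrals over the sphere\<close>

text \<open>Homogeneous functions may fail to be differentiable at the origin; the removed point has
  measure zero.\<close>

abbreviation punctured_ball :: "(real^'n::finite) set" where
  "punctured_ball \<equiv> ball 0 1 - {0}"

lemma poly_coeffs_eqI:
  fixes a b :: "nat \<Rightarrow> real"
  assumes "\<And>t. 0 < t \<Longrightarrow> t < e \<Longrightarrow> (\<Sum>k\<le>n. a k * t ^ k) = (\<Sum>k\<le>n. b k * t ^ k)"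
    and "e > 0" "k \<le> n"
  shows "a k = b k"
proof (rule ccontr)
  assume "a k \<noteq> b k"
  then have "finite {z. (\<Sum>i\<le>n. (a i - b i) * z ^ i) = 0}"
    using \<open>k \<le> n\<close> unfolding Transcendental.polyfun_finite_roots by auto
  moreover have "{0<..<e} \<subseteq> {z. (\<Sum>i\<le>n. (a i - b i) * z ^ i) = 0}"
    using assms(1) by (auto simp: left_diff_distrib sum_subtractf)
  ultimately show False
    using infinite_Ioo[OF \<open>e > 0\<close>] finite_subset by blast
qed

lemma negligible_ball_diff: "negligible ({x \<in> ball 0 1 - punctured_ball. P x})"
  "negligible ({x \<in> punctured_ball - ball 0 1. P x})"
  by (rule negligible_subset[of "{0}"], auto)+

lemma has_integral_punctured_iff:
  fixes f :: "real^'n::finite \<Rightarrow> 'b::euclidean_space"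
  shows "(f has_integral i) punctured_ball \<longleftrightarrow> (f has_integral i) (ball 0 1)"
  by (rule has_integral_spike_set_eq) (rule negligible_ball_diff)+

lemma integral_punctured: "integral punctured_ball f = integral (ball 0 1) f"
  for f :: "real^'n::finite \<Rightarrow> 'b::euclidean_space"
  unfolding integral_def integrable_on_def has_integral_punctured_iff ..

lemma bounded_continuous_integrable:
  fixes g :: "real^'n::finite \<Rightarrow> real"
  assumes "continuous_on punctured_ball g" "\<And>y. y \<in> punctured_ball \<Longrightarrow> \<bar>g y\<bar> \<le> C"
  shows "g absolutely_integrable_on punctured_ball"
    "g absolutely_integrable_on ball 0 1" "g integrable_on ball 0 1"
proof -
  have op: "open (punctured_ball :: (real^'n) set)" by auto
  show 1: "g absolutely_integrable_on punctured_ball"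
  proof (rule measurable_bounded_by_integrable_imp_absolutely_integrable)
    show "g \<in> borel_measurable (lebesgue_on punctured_ball)"
      using assms(1) op by (intro continuous_imp_measurable_on_sets_lebesgue) auto
    have "(\<lambda>_. C) integrable_on (ball (0::real^'n) 1)"
      by (rule integrable_on_const) simp
    then show "(\<lambda>_. C) integrable_on (punctured_ball :: (real^'n) set)"
      unfolding integrable_on_def has_integral_punctured_iff .
  qed (use assms op in auto)
  show "g absolutely_integrable_on ball 0 1" "g integrable_on ball 0 1"
    using 1 unfolding absolutely_integrable_on_def integrable_on_def has_integral_punctured_iff by auto
qed

lemma norm_matrix_vector_le: "norm (A *v v) \<le> norm A * norm (v :: real^'n::finite)"
  for A :: "real^'n^'m::finite"
proof -
  have "norm (A *v v) = L2_set (\<lambda>i. \<bar>A $ i \<bullet> v\<bar>) UNIV"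
    by (simp add: norm_vec_def matrix_vector_mult_def inner_vec_def)
  also have "\<dots> \<le> L2_set (\<lambda>i. norm (A $ i) * norm v) UNIV"
    by (intro L2_set_mono) (auto simp: Cauchy_Schwarz_ineq2)
  also have "\<dots> = norm A * norm v"
    by (simp add: L2_set_left_distrib norm_vec_def)
  finally show ?thesis .
qed

section \<open>Volumes of images under small perturbations of the identity\<close>

lemma bij_id_plus_small_lipschitz:
  fixes \<Phi> :: "'a::banach \<Rightarrow> 'a"
  assumes lip: "\<And>x y. norm (\<Phi> x - \<Phi> y) \<le> B * norm (x - y)" and t: "\<bar>t\<bar> * B < 1" and "B \<ge> 0"
  shows "bij (\<lambda>y. y + t *\<^sub>R \<Phi> y)"
proof (rule bijI)
  have c: "norm (t *\<^sub>R \<Phi> x - t *\<^sub>R \<Phi> y) \<le> (\<bar>t\<bar> * B) * norm (x - y)" for x y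
    using mult_left_mono[OF lip[of x y], of "\<bar>t\<bar>"] by (simp add: scaleR_diff_right[symmetric] mult.assoc)
  show "inj (\<lambda>y. y + t *\<^sub>R \<Phi> y)"
  proof (rule injI, rule ccontr)
    fix x y assume eq: "x + t *\<^sub>R \<Phi> x = y + t *\<^sub>R \<Phi> y" and "x \<noteq> y"
    then have "x - y = t *\<^sub>R \<Phi> y - t *\<^sub>R \<Phi> x"
      by (simp add: algebra_simps)
    then have "norm (x - y) = norm (t *\<^sub>R \<Phi> x - t *\<^sub>R \<Phi> y)"
      by (simp add: norm_minus_commute)
    then have "norm (x - y) \<le> (\<bar>t\<bar> * B) * norm (x - y)"
      using c[of x y] by simp
    moreover have "(\<bar>t\<bar> * B) * norm (x - y) < 1 * norm (x - y)"
      using \<open>x \<noteq> y\<close> by (intro mult_strict_right_mono t) auto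
    ultimately show False by simp
  qed
  show "surj (\<lambda>y. y + t *\<^sub>R \<Phi> y)"
    unfolding surj_def
  proof
    fix z
    have "\<exists>!x. z - t *\<^sub>R \<Phi> x = x"
    proof (rule banach_fix_type)
      show "0 \<le> \<bar>t\<bar> * B" using \<open>B \<ge> 0\<close> by simp
      show "\<forall>x y. dist (z - t *\<^sub>R \<Phi> x) (z - t *\<^sub>R \<Phi> y) \<le> \<bar>t\<bar> * B * dist x y"
        using c by (simp add: dist_norm norm_minus_commute)
    qed (rule t)
    then show "\<exists>x. z = x + t *\<^sub>R \<Phi> x"
      by (metis diff_add_cancel)
  qed
qed

lemma detcoef_bounded_continuous:
  fixes D :: "real^'n::finite \<Rightarrow> real^'n^'n"
  assumes "continuous_on punctured_ball D" "\<And>y. y \<in> punctured_ball \<Longrightarrow> norm (D y) \<le> C"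
  shows "(\<lambda>y. detcoef k (mat 1) (D y)) integrable_on ball 0 1"
    "(\<lambda>y. det (mat 1 + t *\<^sub>R D y)) absolutely_integrable_on punctured_ball"
proof -
  have bd: "\<exists>B. \<forall>y\<in>punctured_ball. \<bar>f (D y)\<bar> \<le> B" if "continuous_on (cball 0 C) f" for f :: "_ \<Rightarrow> real"
  proof -
    have "bounded (f ` cball 0 C)"
      by (intro compact_imp_bounded compact_continuous_image that compact_cball)
    then obtain B where "\<And>M. M \<in> cball 0 C \<Longrightarrow> \<bar>f M\<bar> \<le> B"
      unfolding bounded_iff by (metis imageI real_norm_def)
    then show ?thesis using assms(2) by (intro exI[of _ B]) auto
  qed
  obtain B where "\<And>y. y \<in> punctured_ball \<Longrightarrow> \<bar>detcoef k (mat 1) (D y)\<bar> \<le> B"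
    using bd[of "detcoef k (mat 1)"] continuous_on_detcoef[OF continuous_on_const continuous_on_id] by blast
  then show "(\<lambda>y. detcoef k (mat 1) (D y)) integrable_on ball 0 1"
    by (intro bounded_continuous_integrable(3)) (auto intro!: continuous_intros assms)
  obtain B where "\<And>y. y \<in> punctured_ball \<Longrightarrow> \<bar>det (mat 1 + t *\<^sub>R D y)\<bar> \<le> B"
    using bd[OF continuous_on_det[OF continuous_on_add[OF continuous_on_const continuous_on_scaleR[OF continuous_on_const continuous_on_id]]]]
    by blast
  then show "(\<lambda>y. det (mat 1 + t *\<^sub>R D y)) absolutely_integrable_on punctured_ball"
    by (intro bounded_continuous_integrable(1)) (auto intro!: continuous_intros assms)
qed

text \<open>The bound t C < 1 makes the quadratic form of 1 + t D positive, so the Jacobian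
  determinant equals its absolute value and the volume of the image is a polynomial in t. The
  origin, where Phi may lack a derivative, contributes a single image point.\<close>

lemma has_integral_image_near_id:
  fixes \<Phi> :: "real^'n::finite \<Rightarrow> real^'n"
  assumes inj: "inj (\<lambda>y. y + t *\<^sub>R \<Phi> y)"
    and der: "\<And>y. y \<in> punctured_ball \<Longrightarrow> (\<Phi> has_derivative (\<lambda>v. D y *v v)) (at y)"
    and cont: "continuous_on punctured_ball D"
    and bound: "\<And>y. y \<in> punctured_ball \<Longrightarrow> norm (D y) \<le> C"
    and t: "0 < t" "t * C < 1"
  shows "((\<lambda>_. 1::real) has_integral (\<Sum>k\<le>CARD('n). integral (ball 0 1) (\<lambda>y. detcoef k (mat 1) (D y)) * t ^ k))
           ((\<lambda>y. y + t *\<^sub>R \<Phi> y) ` ball 0 1)"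
proof -
  define F where "F = (\<lambda>y. y + t *\<^sub>R \<Phi> y)"
  have derF: "(F has_derivative (\<lambda>v. (mat 1 + t *\<^sub>R D y) *v v)) (at y)" if "y \<in> punctured_ball" for y
    unfolding F_def
    by (rule has_derivative_eq_rhs, rule has_derivative_add[OF has_derivative_ident
        has_derivative_scaleR_right[OF der[OF that]]])
      (auto simp: matrix_vector_mult_add_rdistrib scaleR_matrix_vector_assoc)
  have pos: "det (mat 1 + t *\<^sub>R D y) > 0" if "y \<in> punctured_ball" for y
  proof (rule det_pos_of_quadratic_form)
    fix v :: "real^'n" assume "v \<noteq> 0"
    have "\<bar>v \<bullet> (D y *v v)\<bar> \<le> norm v * (C * norm v)"
      using bound[OF that] norm_matrix_vector_le[of "D y" v] Cauchy_Schwarz_ineq2[of v "D y *v v"]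
      by (meson mult_left_mono mult_right_mono norm_ge_zero order_trans)
    then have "- (t * (v \<bullet> (D y *v v))) \<le> t * (C * (norm v * norm v))"
      using mult_left_mono[of "- (v \<bullet> (D y *v v))" "C * (norm v * norm v)" t] t(1) by (simp add: mult_ac)
    also have "\<dots> = (t * C) * (norm v)\<^sup>2" by (simp add: power2_eq_square)
    also have "\<dots> < 1 * (norm v)\<^sup>2"
      using t(2) \<open>v \<noteq> 0\<close> by (intro mult_strict_right_mono) auto
    finally show "v \<bullet> ((mat 1 + t *\<^sub>R D y) *v v) > 0"
      by (simp add: matrix_vector_mult_add_rdistrib scaleR_matrix_vector_assoc[symmetric]
          inner_right_distrib power2_norm_eq_inner)
  qed
  have injF: "inj_on F punctured_ball"
    using inj unfolding F_def by (rule inj_on_subset) auto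
  have abs: "\<bar>det (matrix (\<lambda>v. (mat 1 + t *\<^sub>R D y) *v v))\<bar> * 1 = det (mat 1 + t *\<^sub>R D y)" if "y \<in> punctured_ball" for y
    using pos[OF that] by simp
  have "(\<lambda>y. \<bar>det (matrix (\<lambda>v. (mat 1 + t *\<^sub>R D y) *v v))\<bar> * 1) absolutely_integrable_on punctured_ball"
    using detcoef_bounded_continuous(2)[OF cont bound] abs
    by (subst set_integrable_cong[OF refl refl abs]) auto
  then have "((\<lambda>_. 1::real) has_integral integral punctured_ball
      (\<lambda>y. \<bar>det (matrix (\<lambda>v. (mat 1 + t *\<^sub>R D y) *v v))\<bar> * 1)) (F ` punctured_ball)"
    by (intro change_of_variables derF injF) auto
  also have "integral punctured_ball (\<lambda>y. \<bar>det (matrix (\<lambda>v. (mat 1 + t *\<^sub>R D y) *v v))\<bar> * 1)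
      = integral punctured_ball (\<lambda>y. det (mat 1 + t *\<^sub>R D y))"
    by (rule integral_cong) (rule abs)
  also have "\<dots> = integral (ball 0 1) (\<lambda>y. det (mat 1 + t *\<^sub>R D y))"
    by (rule integral_punctured)
  also have "\<dots> = (\<Sum>k\<le>CARD('n). integral (ball 0 1) (\<lambda>y. detcoef k (mat 1) (D y)) * t ^ k)"
    unfolding det_add_scaleR
    by (subst integral_sum) (auto intro!: integrable_on_mult_left detcoef_bounded_continuous(1)[OF cont bound])
  finally have I: "((\<lambda>_. 1::real) has_integral (\<Sum>k\<le>CARD('n). integral (ball 0 1) (\<lambda>y. detcoef k (mat 1) (D y)) * t ^ k))
           (F ` punctured_ball)" .
  have neg: "negligible {x \<in> F ` punctured_ball - F ` ball 0 1. (1::real) \<noteq> 0}"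
    "negligible {x \<in> F ` ball 0 1 - F ` punctured_ball. (1::real) \<noteq> 0}"
    by (rule negligible_subset[OF negligible_sing[of "F 0"]], auto)+
  from I show ?thesis
    unfolding F_def[symmetric]
    using has_integral_spike_set_eq[where f = "\<lambda>_. 1::real", OF neg] by blast
qed

text \<open>The determinant of the Jacobian is a null Lagrangian. For small t the maps
  \<open>y + t \<Phi> y\<close> and \<open>y + t \<Psi> y\<close> are bijections of the whole space that agree outside the ball, so they
  map the ball onto the same set; the volume of this set is a polynomial in t, whose top
  coefficient is the claimed integral.\<close>

theorem integral_det_Jacobian_eq:
  fixes \<Phi> \<Psi> :: "real^'n::finite \<Rightarrow> real^'n"
  assumes lip: "\<And>x y. norm (\<Phi> x - \<Phi> y) \<le> B * norm (x - y)" "\<And>x y. norm (\<Psi> x - \<Psi> y) \<le> B * norm (x - y)"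
    and eq: "\<And>y. norm y \<ge> 1 \<Longrightarrow> \<Phi> y = \<Psi> y"
    and der: "\<And>y. y \<in> punctured_ball \<Longrightarrow> (\<Phi> has_derivative (\<lambda>v. D y *v v)) (at y)"
        "\<And>y. y \<in> punctured_ball \<Longrightarrow> (\<Psi> has_derivative (\<lambda>v. E y *v v)) (at y)"
    and cont: "continuous_on punctured_ball D" "continuous_on punctured_ball E"
    and bound: "\<And>y. y \<in> punctured_ball \<Longrightarrow> norm (D y) \<le> C" "\<And>y. y \<in> punctured_ball \<Longrightarrow> norm (E y) \<le> C"
  shows "integral (ball 0 1) (\<lambda>y. det (D y)) = integral (ball 0 1) (\<lambda>y. det (E y))"
proof -
  \<comment> \<open>For t below this value both |t| |B| < 1 (bijectivity) and t C < 1 (positive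
    Jacobian) hold; the summand 1 keeps the denominator positive when B = C = 0.\<close>
  define \<epsilon> where "\<epsilon> = 1 / (1 + \<bar>B\<bar> + \<bar>C\<bar>)"
  let ?a = "\<lambda>k. integral (ball 0 1) (\<lambda>y. detcoef k (mat 1) (D y))"
  let ?b = "\<lambda>k. integral (ball 0 1) (\<lambda>y. detcoef k (mat 1) (E y))"
  have lip': "norm (\<Phi> x - \<Phi> y) \<le> \<bar>B\<bar> * norm (x - y)" "norm (\<Psi> x - \<Psi> y) \<le> \<bar>B\<bar> * norm (x - y)" for x y
    by (rule order_trans[OF lip(1)], simp add: mult_right_mono, rule order_trans[OF lip(2)], simp add: mult_right_mono)
  have "(\<Sum>k\<le>CARD('n). ?a k * t ^ k) = (\<Sum>k\<le>CARD('n). ?b k * t ^ k)" if t: "0 < t" "t < \<epsilon>" for t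
  proof -
    define F where "F = (\<lambda>y. y + t *\<^sub>R \<Phi> y)"
    define G where "G = (\<lambda>y. y + t *\<^sub>R \<Psi> y)"
    have "t * (1 + \<bar>B\<bar> + \<bar>C\<bar>) < 1"
      using t by (simp add: \<epsilon>_def pos_less_divide_eq add_pos_nonneg)
    moreover have "\<bar>t\<bar> * \<bar>B\<bar> \<le> t * (1 + \<bar>B\<bar> + \<bar>C\<bar>)" "t * C \<le> t * (1 + \<bar>B\<bar> + \<bar>C\<bar>)"
      using t by (auto intro!: mult_left_mono)
    ultimately have tB: "\<bar>t\<bar> * \<bar>B\<bar> < 1" and tC: "t * C < 1"
      by linarith+
    have bij: "bij F" "bij G"
      unfolding F_def G_def by (rule bij_id_plus_small_lipschitz[OF _ tB], use lip' in auto)+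
    have "F ` (- ball 0 1) = G ` (- ball 0 1)"
      by (rule image_cong) (auto simp: F_def G_def eq)
    then have img: "F ` ball 0 1 = G ` ball 0 1"
      using bij_image_Compl_eq[OF bij(1), of "ball 0 1"] bij_image_Compl_eq[OF bij(2), of "ball 0 1"]
      by (metis double_compl)
    note inj = bij_is_inj[OF bij(1)] bij_is_inj[OF bij(2)]
    have "((\<lambda>_. 1::real) has_integral (\<Sum>k\<le>CARD('n). ?a k * t ^ k)) (F ` ball 0 1)"
      using has_integral_image_near_id[OF inj(1)[unfolded F_def] der(1) cont(1) bound(1) t(1) tC]
      unfolding F_def .
    moreover have "((\<lambda>_. 1::real) has_integral (\<Sum>k\<le>CARD('n). ?b k * t ^ k)) (G ` ball 0 1)"
      using has_integral_image_near_id[OF inj(2)[unfolded G_def] der(2) cont(2) bound(2) t(1) tC]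
      unfolding G_def .
    ultimately show ?thesis
      unfolding img by (rule has_integral_unique)
  qed
  then have "?a CARD('n) = ?b CARD('n)"
    by (rule poly_coeffs_eqI[where e = \<epsilon>]) (auto simp: \<epsilon>_def add_pos_nonneg)
  then show ?thesis by simp
qed

section \<open>Spherical integrals, taken over the unit ball\<close>

definition sphere_int :: "(real^'n::finite \<Rightarrow> 'b::euclidean_space) \<Rightarrow> 'b" where
  "sphere_int f = integral (ball 0 1) (\<lambda>y. f (y /\<^sub>R norm y))"

text \<open>\<open>sphere_int\<close> is the integral against mu divided by the dimension. In this
  normalisation the volume of K is the integral of h det D^2 h, without the factor 1/n.\<close>

lemma sph_int_eq: "sph_int f = real CARD('n) *\<^sub>R sphere_int (f :: real^'n::finite \<Rightarrow> 'b::euclidean_space)"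
  by (simp add: sph_int_def sphere_int_def)

lemma continuous_on_sphere_proj:
  fixes f :: "real^'n::finite \<Rightarrow> 'b::topological_space"
  assumes "continuous_on (sphere 0 1) f"
  shows "continuous_on (- {0}) (\<lambda>y. f (y /\<^sub>R norm y))"
  by (rule continuous_on_compose2[OF assms])
    (auto intro!: continuous_intros, metis left_inverse norm_eq_zero)

lemma sphere_bounded:
  fixes f :: "real^'n::finite \<Rightarrow> real"
  assumes "continuous_on (sphere 0 1) f"
  obtains C where "\<And>x. norm x = 1 \<Longrightarrow> \<bar>f x\<bar> \<le> C"
proof -
  have "bounded (f ` sphere 0 1)"
    by (intro compact_imp_bounded compact_continuous_image assms compact_sphere)
  then show ?thesis
    using that unfolding bounded_iff by (metis imageI mem_sphere_0 real_norm_def)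
qed

lemma sphere_fun_integrable:
  fixes f :: "real^'n::finite \<Rightarrow> real" and g :: "real \<Rightarrow> real"
  assumes "continuous_on (sphere 0 1) f" "continuous_on {0..1} g"
  shows "(\<lambda>y. g (norm y) * f (y /\<^sub>R norm y)) absolutely_integrable_on punctured_ball"
   "(\<lambda>y. g (norm y) * f (y /\<^sub>R norm y)) integrable_on ball 0 1"
proof -
  obtain C where C: "\<And>x. norm x = 1 \<Longrightarrow> \<bar>f x\<bar> \<le> C" using sphere_bounded[OF assms(1)] by blast
  have "bounded (g ` {0..1})"
    by (intro compact_imp_bounded compact_continuous_image assms) auto
  then obtain B where B: "\<And>x. 0 \<le> x \<Longrightarrow> x \<le> 1 \<Longrightarrow> \<bar>g x\<bar> \<le> B"
    unfolding bounded_iff by (metis atLeastAtMost_iff imageI real_norm_def)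
  have bd: "\<bar>g (norm y) * f (y /\<^sub>R norm y)\<bar> \<le> B * C" if "y \<in> punctured_ball" for y
    unfolding abs_mult using that by (intro mult_mono B C order_trans[OF abs_ge_zero B[of 0]]) auto
  have "continuous_on punctured_ball (\<lambda>y. g (norm y) * f (y /\<^sub>R norm y))"
    by (intro continuous_intros continuous_on_subset[OF continuous_on_sphere_proj[OF assms(1)]]
        continuous_on_compose2[OF assms(2)]) auto
  then show "(\<lambda>y. g (norm y) * f (y /\<^sub>R norm y)) absolutely_integrable_on punctured_ball"
   "(\<lambda>y. g (norm y) * f (y /\<^sub>R norm y)) integrable_on ball 0 1"
    using bounded_continuous_integrable bd by blast+
qed

lemma sphere_int_integrable:
  fixes f :: "real^'n::finite \<Rightarrow> real"
  assumes "continuous_on (sphere 0 1) f"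
  shows "(\<lambda>y. f (y /\<^sub>R norm y)) integrable_on ball 0 1"
  using sphere_fun_integrable(2)[OF assms, of "\<lambda>_. 1"] by simp

lemma sphere_int_cong:
  fixes f g :: "real^'n::finite \<Rightarrow> 'b::euclidean_space"
  assumes "\<And>x. norm x = 1 \<Longrightarrow> f x = g x"
  shows "sphere_int f = sphere_int g"
  unfolding sphere_int_def integral_punctured[symmetric] using assms by (intro integral_cong) auto

lemma sphere_int_add:
  fixes f g :: "real^'n::finite \<Rightarrow> real"
  assumes "continuous_on (sphere 0 1) f" "continuous_on (sphere 0 1) g"
  shows "sphere_int (\<lambda>x. f x + g x) = sphere_int f + sphere_int g"
  unfolding sphere_int_def using assms by (intro integral_add sphere_int_integrable)

lemma sphere_int_diff:
  fixes f g :: "real^'n::finite \<Rightarrow> real"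
  assumes "continuous_on (sphere 0 1) f" "continuous_on (sphere 0 1) g"
  shows "sphere_int (\<lambda>x. f x - g x) = sphere_int f - sphere_int g"
  unfolding sphere_int_def using assms by (intro integral_diff sphere_int_integrable)

lemma sphere_int_mult: "sphere_int (\<lambda>x. c * f x) = c * sphere_int f" for c :: real
  unfolding sphere_int_def by simp

lemma sphere_int_sum:
  fixes f :: "'i \<Rightarrow> real^'n::finite \<Rightarrow> real"
  assumes "finite I" "\<And>i. i \<in> I \<Longrightarrow> continuous_on (sphere 0 1) (f i)"
  shows "sphere_int (\<lambda>x. \<Sum>i\<in>I. f i x) = (\<Sum>i\<in>I. sphere_int (f i))"
  unfolding sphere_int_def using assms by (intro integral_sum sphere_int_integrable)

lemma sphere_int_nonneg:
  fixes f :: "real^'n::finite \<Rightarrow> real"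
  assumes "continuous_on (sphere 0 1) f" "\<And>x. norm x = 1 \<Longrightarrow> f x \<ge> 0"
  shows "sphere_int f \<ge> 0"
  unfolding sphere_int_def integral_punctured[symmetric] using assms
  by (intro integral_nonneg sphere_int_integrable)
    (auto simp: integrable_on_def has_integral_punctured_iff intro: sphere_int_integrable[unfolded integrable_on_def])

lemma sphere_int_pos:
  fixes f :: "real^'n::finite \<Rightarrow> real"
  assumes cont: "continuous_on (sphere 0 1) f" and nn: "\<And>x. norm x = 1 \<Longrightarrow> f x \<ge> 0"
    and x0: "norm x0 = 1" "f x0 > 0"
  shows "sphere_int f > 0"
proof (rule ccontr)
  assume "\<not> sphere_int f > 0"
  then have "sphere_int f = 0" using sphere_int_nonneg[OF cont nn] by force
  let ?g = "\<lambda>y. f (y /\<^sub>R norm y)"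
  have "(?g has_integral 0) (ball 0 1)"
    using sphere_int_integrable[OF cont] \<open>sphere_int f = 0\<close> by (simp add: has_integral_iff sphere_int_def)
  then have g0: "(?g has_integral 0) punctured_ball" by (simp add: has_integral_punctured_iff)
  \<comment> \<open>The 0-homogeneous extension still equals f x0 > 0 at x0 / 2, an interior point
    of the punctured ball. On a box around it that avoids the origin, a continuous nonnegative
    function with zero integral must vanish.\<close>
  have "open punctured_ball" "(1/2) *\<^sub>R x0 \<in> punctured_ball"
    using x0 by auto
  then obtain a b where ab: "cbox a b \<subseteq> punctured_ball" "(1/2) *\<^sub>R x0 \<in> box a b"
    using open_contains_cbox by metis
  have cg: "continuous_on (cbox a b) ?g"
    using ab(1) by (intro continuous_on_subset[OF continuous_on_sphere_proj[OF cont]]) auto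
  have "integral (cbox a b) ?g \<le> integral punctured_ball ?g"
    using g0 ab(1) nn by (intro integral_subset_le integrable_continuous cg) auto
  moreover have "integral (cbox a b) ?g \<ge> 0"
    using ab(1) nn by (intro integral_nonneg integrable_continuous cg) (auto simp: subset_iff)
  ultimately have "integral (cbox a b) ?g = 0"
    using g0 by (simp add: has_integral_iff)
  then have "(?g has_integral 0) (cbox a b)"
    using integrable_continuous[OF cg] by (simp add: has_integral_iff)
  then have "?g ((1/2) *\<^sub>R x0) = 0"
  proof (rule has_integral_0_cbox_imp_0[OF cg, rotated])
    show "0 \<le> ?g y" if "y \<in> box a b" for y
    proof -
      have "y \<noteq> 0" using that ab(1) box_subset_cbox[of a b] by auto
      then show ?thesis by (intro nn) simp
    qed
  qed (use ab(2) box_subset_cbox[of a b] in auto)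
  then show False
    using x0 by simp
qed

lemma det_scaleR: "det (c *\<^sub>R M) = c ^ CARD('n) * det (M :: real^'n::finite^'n)"
  using det_rows_mul[of "\<lambda>_. c" "\<lambda>i. M $ i"] by (simp add: scalar_mult_eq_scaleR scaleR_vec_def vec_lambda_eta)

text \<open>Instead of polar coordinates, substitute g(y) = |y|^k y. It maps the punctured ball onto
  itself, keeps directions, and has Jacobian (1 + k) |y|^(n k), so it turns the weighted integral
  into the unweighted one divided by 1 + k.\<close>

lemma sphere_int_radial_moment:
  fixes f :: "real^'n::finite \<Rightarrow> real"
  assumes cont: "continuous_on (sphere 0 1) f"
  shows "integral (ball 0 1) (\<lambda>y. (norm y ^ CARD('n)) ^ k * f (y /\<^sub>R norm y)) = sphere_int f / (1 + real k)"
proof -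
  define g where "g y = norm y ^ k *\<^sub>R y" for y :: "real^'n"
  define D where "D y = norm y ^ k *\<^sub>R (mat 1 + dyad (real k *\<^sub>R (y /\<^sub>R norm y)) (y /\<^sub>R norm y))" for y :: "real^'n"
  have der: "(g has_derivative (\<lambda>v. D y *v v)) (at y)" if "y \<in> punctured_ball" for y
  proof -
    have *: "((\<lambda>y. norm y ^ k) has_derivative (\<lambda>v. real k * (norm y ^ k * ((y \<bullet> v) / (norm y * norm y))))) (at y)"
      by (rule has_derivative_eq_rhs, rule has_derivative_power[OF has_derivative_norm])
        (use that in \<open>auto simp: fun_eq_iff sgn_div_norm inner_commute field_simps power_eq_if[of _ k]\<close>)
    show ?thesis
      unfolding g_def
      by (rule has_derivative_eq_rhs, rule has_derivative_scaleR[OF * has_derivative_ident])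
        (use that in \<open>auto simp: D_def fun_eq_iff matrix_vector_mult_add_rdistrib scaleR_matrix_vector_assoc[symmetric]
          dyad_mult_vec scaleR_add_right inner_commute field_simps\<close>)
  qed
  have detD: "\<bar>det (matrix (\<lambda>v. D y *v v))\<bar> = (1 + real k) * (norm y ^ CARD('n)) ^ k" if "y \<in> punctured_ball" for y
  proof -
    have 1: "norm (y /\<^sub>R norm y) = 1" using that by simp
    then have "(y /\<^sub>R norm y) \<bullet> (y /\<^sub>R norm y) = 1" by (simp only: norm_eq_1)
    then have "det (D y) = (norm y ^ k) ^ CARD('n) * (1 + real k)"
      unfolding D_def det_scaleR det_mat1_plus_dyad[OF 1] by (simp only: inner_scaleR_left mult_1_right)
    then show ?thesis
      unfolding matrix_of_matrix_vector_mul by (simp add: power_mult[symmetric] mult.commute)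
  qed
  have inj: "inj_on g punctured_ball"
  proof (rule inj_onI)
    fix x y :: "real^'n" assume xy: "x \<in> punctured_ball" "y \<in> punctured_ball" "g x = g y"
    then have "norm (g x) = norm (g y)" by simp
    then have "norm x ^ Suc k = norm y ^ Suc k"
      unfolding g_def by (simp add: mult.commute)
    then have "norm x = norm y"
      by (metis norm_ge_zero power_inject_base)
    then show "x = y" using xy by (auto simp: g_def)
  qed
  have img: "g ` punctured_ball = punctured_ball"
  proof
    show "g ` punctured_ball \<subseteq> punctured_ball"
    proof (rule image_subsetI)
      fix y :: "real^'n" assume y: "y \<in> punctured_ball"
      have "norm (g y) = norm y ^ Suc k" by (simp add: g_def mult.commute)
      also have "\<dots> < 1" using y by (intro power_Suc_less_one) auto
      finally show "g y \<in> punctured_ball" using y by (simp add: g_def)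
    qed
    show "punctured_ball \<subseteq> g ` punctured_ball"
    proof
      fix y :: "real^'n" assume y: "y \<in> punctured_ball"
      \<comment> \<open>The inverse of the radial profile r -> r^(k+1).\<close>
      define r where "r = root (Suc k) (norm y)"
      have r: "r > 0" "r ^ Suc k = norm y" "r < 1"
        using y by (auto simp: r_def simp del: power_Suc)
      show "y \<in> g ` punctured_ball"
      proof (rule image_eqI[of _ _ "(r / norm y) *\<^sub>R y"])
        have "norm ((r / norm y) *\<^sub>R y) = r" using y r by simp
        then show "(r / norm y) *\<^sub>R y \<in> punctured_ball" using y r by auto
        have "g ((r / norm y) *\<^sub>R y) = (r ^ Suc k / norm y) *\<^sub>R y"
          unfolding g_def using y r(1) by simp
        then show "y = g ((r / norm y) *\<^sub>R y)"
          using y r by simp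
      qed
    qed
  qed
  have proj: "g y /\<^sub>R norm (g y) = y /\<^sub>R norm y" if "y \<in> punctured_ball" for y
    using that by (simp add: g_def)
  let ?h = "\<lambda>y. f (y /\<^sub>R norm y)"
  have eq: "\<bar>det (matrix (\<lambda>v. D y *v v))\<bar> * ?h (g y) = (1 + real k) * (norm y ^ CARD('n)) ^ k * ?h y"
    if "y \<in> punctured_ball" for y
    unfolding detD[OF that] proj[OF that] ..
  have "(\<lambda>y. \<bar>det (matrix (\<lambda>v. D y *v v))\<bar> * ?h (g y)) absolutely_integrable_on punctured_ball"
    by (subst set_integrable_cong[OF refl refl eq])
      (auto intro!: sphere_fun_integrable(1)[OF cont, of "\<lambda>r. (1 + real k) * (r ^ CARD('n)) ^ k"] continuous_intros)
  then have "(?h has_integral integral punctured_ball (\<lambda>y. \<bar>det (matrix (\<lambda>v. D y *v v))\<bar> * ?h (g y))) (g ` punctured_ball)"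
    by (intro change_of_variables der inj) auto
  then have "sphere_int f = integral punctured_ball (\<lambda>y. \<bar>det (matrix (\<lambda>v. D y *v v))\<bar> * ?h (g y))"
    unfolding img has_integral_punctured_iff sphere_int_def by (rule integral_unique)
  also have "\<dots> = integral punctured_ball (\<lambda>y. (1 + real k) * ((norm y ^ CARD('n)) ^ k * ?h y))"
    by (rule integral_cong) (simp only: eq mult.assoc)
  finally have "sphere_int f = (1 + real k) * integral (ball 0 1) (\<lambda>y. (norm y ^ CARD('n)) ^ k * ?h y)"
    by (simp add: integral_punctured del: distrib_right_numeral)
  then show ?thesis
    by (simp add: eq_divide_eq mult.commute add_nonneg_eq_0_iff)
qed

section \<open>Homogeneous functions of class \<open>C\<^sup>2\<close>\<close>

declare transpose_matrix_vector [simp del]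

definition C2_off0 :: "(real^'n::finite \<Rightarrow> real) \<Rightarrow> bool" where
  "C2_off0 f \<longleftrightarrow> (\<exists>(G::real^'n \<Rightarrow> real^'n) (H::real^'n \<Rightarrow> real^'n^'n).
      (\<forall>q. q \<noteq> 0 \<longrightarrow> (f has_derivative (\<lambda>v. G q \<bullet> v)) (at q) \<and>
                      (G has_derivative (\<lambda>v. H q *v v)) (at q)) \<and>
      continuous_on (- {0}) H)"

lemma C2_sphere_iff: "C2_sphere z \<longleftrightarrow> C2_off0 (hom0 z)"
  by (simp add: C2_sphere_def C2_off0_def)

lemma grad_eqI:
  assumes "(f has_derivative (\<lambda>v. g \<bullet> v)) (at q)"
  shows "grad f q = (g :: real^'n::finite)"
  unfolding grad_def frechet_derivative_at[OF assms, symmetric] by (simp add: inner_axis vec_eq_iff)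

text \<open>The transpose appears because \<open>hess\<close> carries the direction of
  differentiation in its row index, whereas the matrix H of a derivative \<open>H q *v v\<close>
  carries it in the column index.\<close>

lemma C2_off0_gradI:
  fixes f :: "real^'n::finite \<Rightarrow> real"
  assumes der: "\<And>q. q \<noteq> 0 \<Longrightarrow> (f has_derivative (\<lambda>v. G q \<bullet> v)) (at q)"
    "\<And>q. q \<noteq> 0 \<Longrightarrow> (G has_derivative (\<lambda>v. H q *v v)) (at q)"
  shows "q \<noteq> 0 \<Longrightarrow> grad f q = G q" "q \<noteq> 0 \<Longrightarrow> hess f q = transpose (H q)"
proof -
  show 1: "grad f q = G q" if "q \<noteq> 0" for q
    using der(1)[OF that] by (rule grad_eqI)
  assume q: "q \<noteq> 0"
  have "(grad f has_derivative (\<lambda>v. H q *v v)) (at q)"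
    by (rule has_derivative_transform_within_open[OF der(2)[OF q], of "- {0}"]) (use q 1 in auto)
  then have "((\<lambda>y. grad f y $ j) has_derivative (\<lambda>v. (H q *v v) $ j)) (at q)" for j
    by (rule bounded_linear.has_derivative[OF bounded_linear_vec_nth])
  then have "frechet_derivative (\<lambda>y. grad f y $ j) (at q) = (\<lambda>v. (H q *v v) $ j)" for j
    by (metis frechet_derivative_at)
  then show "hess f q = transpose (H q)"
    by (simp add: hess_def transpose_def vec_eq_iff matrix_vector_mul_component inner_axis)
qed

lemma continuous_on_transpose [continuous_intros]:
  fixes A :: "'a::topological_space \<Rightarrow> real^'n::finite^'m::finite"
  assumes "continuous_on S A" shows "continuous_on S (\<lambda>x. transpose (A x))"
  using assms unfolding continuous_on_matrix_entries by (simp add: transpose_def)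

lemma C2_off0D:
  fixes f :: "real^'n::finite \<Rightarrow> real"
  assumes "C2_off0 f"
  shows "q \<noteq> 0 \<Longrightarrow> (f has_derivative (\<lambda>v. grad f q \<bullet> v)) (at q)"
    "q \<noteq> 0 \<Longrightarrow> (grad f has_derivative (\<lambda>v. transpose (hess f q) *v v)) (at q)"
    "continuous_on (- {0}) f" "continuous_on (- {0}) (grad f)" "continuous_on (- {0}) (hess f)"
proof -
  obtain G H where GH: "\<And>q. q \<noteq> 0 \<Longrightarrow> (f has_derivative (\<lambda>v. G q \<bullet> v)) (at q)"
    "\<And>q. q \<noteq> 0 \<Longrightarrow> (G has_derivative (\<lambda>v. H q *v v)) (at q)" and H: "continuous_on (- {0}) H"
    using assms unfolding C2_off0_def by blast
  have eq: "grad f q = G q" "hess f q = transpose (H q)" if "q \<noteq> 0" for q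
    using C2_off0_gradI[of f G H q] GH that by blast+
  show 1: "(f has_derivative (\<lambda>v. grad f q \<bullet> v)) (at q)" if "q \<noteq> 0" for q
    using GH(1)[OF that] eq(1)[OF that] by simp
  show 2: "(grad f has_derivative (\<lambda>v. transpose (hess f q) *v v)) (at q)" if "q \<noteq> 0" for q
    by (rule has_derivative_transform_within_open[where f = G and s = "- {0}"])
      (use GH(2)[OF that] that eq in auto)
  show "continuous_on (- {0}) f" "continuous_on (- {0}) (grad f)"
    using 1 2 by (auto intro!: continuous_at_imp_continuous_on has_derivative_continuous)
  have "continuous_on (- {0}) (\<lambda>q. transpose (H q))"
    by (intro continuous_intros H)
  then show "continuous_on (- {0}) (hess f)"
    by (rule continuous_on_eq) (simp add: eq)
qed

lemma C2_off0I:
  fixes f :: "real^'n::finite \<Rightarrow> real"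
  assumes "\<And>q. q \<noteq> 0 \<Longrightarrow> (f has_derivative (\<lambda>v. G q \<bullet> v)) (at q)"
    "\<And>q. q \<noteq> 0 \<Longrightarrow> (G has_derivative (\<lambda>v. transpose (H q) *v v)) (at q)"
    "continuous_on (- {0}) H"
  shows "C2_off0 f" "q \<noteq> 0 \<Longrightarrow> grad f q = G q" "q \<noteq> 0 \<Longrightarrow> hess f q = H q"
proof -
  have "continuous_on (- {0}) (\<lambda>q. transpose (H q))"
    by (intro continuous_intros assms)
  then show "C2_off0 f" unfolding C2_off0_def using assms(1,2) by (intro exI[of _ G] exI[of _ "\<lambda>q. transpose (H q)"]) auto
  show "q \<noteq> 0 \<Longrightarrow> grad f q = G q" "q \<noteq> 0 \<Longrightarrow> hess f q = H q"
    using C2_off0_gradI[of f G "\<lambda>q. transpose (H q)" q] assms(1,2) by (simp_all add: transpose_transpose)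
qed

lemma transpose_add: "transpose (A + B) = transpose A + transpose (B :: real^'n::finite^'m::finite)"
  by (simp add: transpose_def vec_eq_iff)

lemma transpose_scaleR: "transpose (c *\<^sub>R A) = c *\<^sub>R transpose (A :: real^'n::finite^'m::finite)"
  by (simp add: transpose_def vec_eq_iff)

lemmas mult_vec_expand = transpose_add transpose_scaleR matrix_vector_mult_add_rdistrib
  scaleR_matrix_vector_assoc[symmetric] dyad_mult_vec transpose_dyad

lemma continuous_on_dyad [continuous_intros]:
  fixes a b :: "'a::topological_space \<Rightarrow> real^'n::finite"
  assumes "continuous_on S a" "continuous_on S b" shows "continuous_on S (\<lambda>x. dyad (a x) (b x))"
  unfolding continuous_on_matrix_entries using assms by (auto simp: dyad_def intro!: continuous_intros)

lemma C2_off0_add: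
  fixes f g :: "real^'n::finite \<Rightarrow> real"
  assumes "C2_off0 f" "C2_off0 g"
  shows "C2_off0 (\<lambda>x. f x + g x)"
    "q \<noteq> 0 \<Longrightarrow> grad (\<lambda>x. f x + g x) q = grad f q + grad g q"
    "q \<noteq> 0 \<Longrightarrow> hess (\<lambda>x. f x + g x) q = hess f q + hess g q"
proof -
  note D = assms[THEN C2_off0D(1)] assms[THEN C2_off0D(2)]
  have 1: "((\<lambda>x. f x + g x) has_derivative (\<lambda>v. (grad f q + grad g q) \<bullet> v)) (at q)" if "q \<noteq> 0" for q
    unfolding inner_add_left by (rule has_derivative_add[OF D(1,2)[OF that]])
  have 2: "((\<lambda>q. grad f q + grad g q) has_derivative (\<lambda>v. transpose (hess f q + hess g q) *v v)) (at q)" if "q \<noteq> 0" for q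
    unfolding transpose_add matrix_vector_mult_add_rdistrib by (rule has_derivative_add[OF D(3,4)[OF that]])
  have 3: "continuous_on (- {0}) (\<lambda>q. hess f q + hess g q)"
    by (intro continuous_intros assms[THEN C2_off0D(5)])
  show "C2_off0 (\<lambda>x. f x + g x)"
    "q \<noteq> 0 \<Longrightarrow> grad (\<lambda>x. f x + g x) q = grad f q + grad g q"
    "q \<noteq> 0 \<Longrightarrow> hess (\<lambda>x. f x + g x) q = hess f q + hess g q"
    using C2_off0I[OF 1 2 3] by blast+
qed

lemma C2_off0_cmul:
  fixes f :: "real^'n::finite \<Rightarrow> real"
  assumes "C2_off0 f"
  shows "C2_off0 (\<lambda>x. c * f x)"
    "q \<noteq> 0 \<Longrightarrow> grad (\<lambda>x. c * f x) q = c *\<^sub>R grad f q"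
    "q \<noteq> 0 \<Longrightarrow> hess (\<lambda>x. c * f x) q = c *\<^sub>R hess f q"
proof -
  have 1: "((\<lambda>x. c * f x) has_derivative (\<lambda>v. (c *\<^sub>R grad f q) \<bullet> v)) (at q)" if "q \<noteq> 0" for q
    by (rule has_derivative_eq_rhs, rule has_derivative_mult_right[OF C2_off0D(1)[OF assms that]]) simp
  have 2: "((\<lambda>x. c *\<^sub>R grad f x) has_derivative (\<lambda>v. transpose (c *\<^sub>R hess f q) *v v)) (at q)" if "q \<noteq> 0" for q
    by (rule has_derivative_eq_rhs, rule has_derivative_scaleR_right[OF C2_off0D(2)[OF assms that]])
      (simp add: mult_vec_expand)
  have 3: "continuous_on (- {0}) (\<lambda>q. c *\<^sub>R hess f q)"
    by (intro continuous_intros C2_off0D(5)[OF assms])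
  show "C2_off0 (\<lambda>x. c * f x)"
    "q \<noteq> 0 \<Longrightarrow> grad (\<lambda>x. c * f x) q = c *\<^sub>R grad f q"
    "q \<noteq> 0 \<Longrightarrow> hess (\<lambda>x. c * f x) q = c *\<^sub>R hess f q"
    using C2_off0I[OF 1 2 3] by blast+
qed

lemma C2_off0_mult:
  fixes f g :: "real^'n::finite \<Rightarrow> real"
  assumes "C2_off0 f" "C2_off0 g"
  shows "C2_off0 (\<lambda>x. f x * g x)"
    "q \<noteq> 0 \<Longrightarrow> grad (\<lambda>x. f x * g x) q = f q *\<^sub>R grad g q + g q *\<^sub>R grad f q"
    "q \<noteq> 0 \<Longrightarrow> hess (\<lambda>x. f x * g x) q = f q *\<^sub>R hess g q + g q *\<^sub>R hess f q +
        dyad (grad f q) (grad g q) + dyad (grad g q) (grad f q)"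
proof -
  let ?G = "\<lambda>q. f q *\<^sub>R grad g q + g q *\<^sub>R grad f q"
  let ?H = "\<lambda>q. f q *\<^sub>R hess g q + g q *\<^sub>R hess f q + dyad (grad f q) (grad g q) + dyad (grad g q) (grad f q)"
  note D = assms[THEN C2_off0D(1)] assms[THEN C2_off0D(2)]
  have 1: "((\<lambda>x. f x * g x) has_derivative (\<lambda>v. ?G q \<bullet> v)) (at q)" if "q \<noteq> 0" for q
    by (rule has_derivative_eq_rhs, rule has_derivative_mult[OF D(1,2)[OF that]])
      (simp add: inner_left_distrib mult.commute)
  have 2: "(?G has_derivative (\<lambda>v. transpose (?H q) *v v)) (at q)" if "q \<noteq> 0" for q
    by (rule has_derivative_eq_rhs, rule has_derivative_add[OF has_derivative_scaleR[OF D(1)[OF that] D(4)[OF that]]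
          has_derivative_scaleR[OF D(2)[OF that] D(3)[OF that]]])
      (simp add: mult_vec_expand algebra_simps)
  have 3: "continuous_on (- {0}) ?H"
    by (intro continuous_intros assms[THEN C2_off0D(3)] assms[THEN C2_off0D(4)] assms[THEN C2_off0D(5)])
  show "C2_off0 (\<lambda>x. f x * g x)" "q \<noteq> 0 \<Longrightarrow> grad (\<lambda>x. f x * g x) q = ?G q"
    "q \<noteq> 0 \<Longrightarrow> hess (\<lambda>x. f x * g x) q = ?H q"
    using C2_off0I[OF 1 2 3] by blast+
qed

lemma C2_off0_inverse:
  fixes f :: "real^'n::finite \<Rightarrow> real"
  assumes "C2_off0 f" and nz: "\<And>x. x \<noteq> 0 \<Longrightarrow> f x \<noteq> 0"
  shows "C2_off0 (\<lambda>x. inverse (f x))"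
proof -
  let ?G = "\<lambda>q. (- (inverse (f q) * inverse (f q))) *\<^sub>R grad f q"
  let ?H = "\<lambda>q. (2 * inverse (f q) ^ 3) *\<^sub>R dyad (grad f q) (grad f q) + (- (inverse (f q) * inverse (f q))) *\<^sub>R hess f q"
  note D = C2_off0D(1,2)[OF assms(1)]
  have inv: "((\<lambda>x. inverse (f x)) has_derivative (\<lambda>v. - (inverse (f q) * (grad f q \<bullet> v) * inverse (f q)))) (at q)"
    if "q \<noteq> 0" for q
    by (rule Deriv.has_derivative_inverse[OF nz[OF that] D(1)[OF that]])
  have 1: "((\<lambda>x. inverse (f x)) has_derivative (\<lambda>v. ?G q \<bullet> v)) (at q)" if "q \<noteq> 0" for q
    by (rule has_derivative_eq_rhs, rule inv[OF that]) (simp add: fun_eq_iff mult_ac)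
  have 2: "(?G has_derivative (\<lambda>v. transpose (?H q) *v v)) (at q)" if "q \<noteq> 0" for q
    by (rule has_derivative_eq_rhs,
        rule has_derivative_scaleR[OF has_derivative_minus[OF has_derivative_mult[OF inv[OF that] inv[OF that]]] D(2)[OF that]])
      (simp only: mult_vec_expand fun_eq_iff power3_eq_cube, simp add: scaleR_add_left[symmetric] algebra_simps)
  have 3: "continuous_on (- {0}) ?H"
    using nz by (intro continuous_intros C2_off0D(3,4,5)[OF assms(1)]) auto
  show ?thesis
    using C2_off0I(1)[OF 1 2 3] .
qed

lemma C2_off0_linear:
  fixes v :: "real^'n::finite"
  shows "C2_off0 (\<lambda>x. x \<bullet> v)" "q \<noteq> 0 \<Longrightarrow> grad (\<lambda>x. x \<bullet> v) q = v" "q \<noteq> 0 \<Longrightarrow> hess (\<lambda>x. x \<bullet> v) q = 0"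
proof -
  have 1: "((\<lambda>x. x \<bullet> v) has_derivative (\<lambda>w. v \<bullet> w)) (at q)" for q :: "real^'n"
    by (rule has_derivative_eq_rhs, rule bounded_linear_imp_has_derivative[OF bounded_linear_inner_left])
      (simp add: inner_commute)
  have 2: "((\<lambda>_. v) has_derivative (\<lambda>w. transpose (0 :: real^'n^'n) *v w)) (at q)" for q :: "real^'n"
    by (rule has_derivative_eq_rhs, rule has_derivative_const)
      (simp add: transpose_def matrix_vector_mult_def vec_eq_iff zero_vec_def)
  show "C2_off0 (\<lambda>x. x \<bullet> v)" "q \<noteq> 0 \<Longrightarrow> grad (\<lambda>x. x \<bullet> v) q = v" "q \<noteq> 0 \<Longrightarrow> hess (\<lambda>x. x \<bullet> v) q = 0"
    using C2_off0I[where H = "\<lambda>_. 0", OF 1 2] by auto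
qed

section \<open>One-homogeneous functions and their gradient fields\<close>

definition C2_hom1 :: "(real^'n::finite \<Rightarrow> real) \<Rightarrow> bool" where
  "C2_hom1 f \<longleftrightarrow> C2_off0 f \<and> (\<forall>c>0. \<forall>x. f (c *\<^sub>R x) = c * f x)"

lemma C2_hom1_add: "C2_hom1 f \<Longrightarrow> C2_hom1 g \<Longrightarrow> C2_hom1 (\<lambda>x. f x + g x)"
  by (auto simp: C2_hom1_def distrib_left intro: C2_off0_add)

lemma C2_hom1_cmul: "C2_hom1 f \<Longrightarrow> C2_hom1 (\<lambda>x. c * f x)"
  by (auto simp: C2_hom1_def intro: C2_off0_cmul)

lemma C2_hom1_linear: "C2_hom1 (\<lambda>x. x \<bullet> v)"
  by (auto simp: C2_hom1_def intro: C2_off0_linear)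

lemma hom0_scale: "c > 0 \<Longrightarrow> hom0 z (c *\<^sub>R x) = hom0 z x"
  by (simp add: hom0_def mult.commute[of _ c] mult.assoc[symmetric])

lemma C2_hom1_mult_hom0:
  assumes "C2_sphere z" "C2_hom1 f"
  shows "C2_hom1 (\<lambda>x. hom0 z x * f x)"
  using assms by (auto simp: C2_hom1_def hom0_scale C2_sphere_iff intro: C2_off0_mult)

context
  fixes f :: "real^'n::finite \<Rightarrow> real"
  assumes f: "C2_hom1 f"
begin

lemma C2_hom1_C2: "C2_off0 f"
  using f by (simp add: C2_hom1_def)

lemma C2_hom1_scale: "c > 0 \<Longrightarrow> f (c *\<^sub>R x) = c * f x"
  using f by (simp add: C2_hom1_def)

lemma has_derivative_scale_point: "((\<lambda>c. c *\<^sub>R x) has_derivative (\<lambda>t. t *\<^sub>R x)) (at c)"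
  for x :: "'b::real_normed_vector"
  by (rule has_derivative_scaleR_left[OF has_derivative_ident])

lemma C2_hom1_euler: 
  assumes "x \<noteq> 0" shows "grad f x \<bullet> x = f x"
proof -
  have "((\<lambda>c. f (c *\<^sub>R x)) has_derivative (\<lambda>t. grad f (1 *\<^sub>R x) \<bullet> (t *\<^sub>R x))) (at 1)"
    by (rule has_derivative_compose[OF has_derivative_scale_point])
      (use assms in \<open>auto intro: C2_off0D(1)[OF C2_hom1_C2]\<close>)
  then have 1: "((\<lambda>c. c * f x) has_derivative (\<lambda>t. grad f x \<bullet> (t *\<^sub>R x))) (at 1)"
    unfolding scaleR_one
    by (rule has_derivative_transform_within_open[where s = "{0<..}"]) (auto simp: C2_hom1_scale)
  have "((\<lambda>c. c * f x) has_derivative (\<lambda>t. t * f x)) (at (1::real))"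
    by (rule has_derivative_mult_left[OF has_derivative_ident])
  from fun_cong[OF has_derivative_unique[OF 1 this], of 1] show ?thesis by simp
qed

lemma grad_scale:
  assumes "c > 0" "x \<noteq> 0" shows "grad f (c *\<^sub>R x) = grad f x"
proof -
  have "((\<lambda>y. f (c *\<^sub>R y)) has_derivative (\<lambda>v. grad f (c *\<^sub>R x) \<bullet> (c *\<^sub>R v))) (at x)"
    by (rule has_derivative_compose[OF has_derivative_scaleR_right[OF has_derivative_ident]])
      (use assms in \<open>auto intro: C2_off0D(1)[OF C2_hom1_C2]\<close>)
  then have "((\<lambda>y. c * f y) has_derivative (\<lambda>v. (c *\<^sub>R grad f (c *\<^sub>R x)) \<bullet> v)) (at x)"
    using assms by (simp add: C2_hom1_scale)
  from grad_eqI[OF this] have "c *\<^sub>R grad f x = c *\<^sub>R grad f (c *\<^sub>R x)"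
    using C2_off0_cmul(2)[OF C2_hom1_C2 assms(2), of c] by simp
  then show ?thesis using assms by simp
qed

lemma hess_scale:
  assumes "c > 0" "x \<noteq> 0" shows "hess f (c *\<^sub>R x) = (1 / c) *\<^sub>R hess f x"
proof -
  have "((\<lambda>y. grad f (c *\<^sub>R y)) has_derivative (\<lambda>v. transpose (hess f (c *\<^sub>R x)) *v (c *\<^sub>R v))) (at x)"
    by (rule has_derivative_compose[OF has_derivative_scaleR_right[OF has_derivative_ident]])
      (use assms in \<open>auto intro: C2_off0D(2)[OF C2_hom1_C2]\<close>)
  then have "(grad f has_derivative (\<lambda>v. transpose (hess f (c *\<^sub>R x)) *v (c *\<^sub>R v))) (at x)"
    by (rule has_derivative_transform_within_open[where s = "- {0}"]) (use assms in \<open>auto simp: grad_scale\<close>)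
  from has_derivative_unique[OF this C2_off0D(2)[OF C2_hom1_C2 assms(2)]]
  have "transpose (c *\<^sub>R hess f (c *\<^sub>R x)) *v v = transpose (hess f x) *v v" for v
    by (auto simp: fun_eq_iff transpose_scaleR scaleR_matrix_vector_assoc matrix_vector_mult_scaleR simp del: transpose_matrix_vector)
  then have "transpose (c *\<^sub>R hess f (c *\<^sub>R x)) = transpose (hess f x)"
    by (simp add: matrix_eq del: transpose_matrix_vector)
  then have "c *\<^sub>R hess f (c *\<^sub>R x) = hess f x"
    by (metis transpose_transpose)
  then show ?thesis using assms by (metis less_irrefl divide_self_if scaleR_one scaleR_scaleR times_divide_eq_left mult_1)
qed

text \<open>Differentiating Euler's relation grad f(y) . y = f(y) in direction v leaves (hess^T v) .
  x = 0. This is the kernel on the side that \<open>det_plus_dyad_null\<close> asks for when M is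
  the transposed Hessian.\<close>

lemma hess_null:
  assumes "x \<noteq> 0" shows "hess f x *v x = 0"
proof -
  have "((\<lambda>y. grad f y \<bullet> y) has_derivative (\<lambda>v. grad f x \<bullet> v + (transpose (hess f x) *v v) \<bullet> x)) (at x)"
    by (rule has_derivative_inner[OF C2_off0D(2)[OF C2_hom1_C2 assms] has_derivative_ident])
  then have "(f has_derivative (\<lambda>v. grad f x \<bullet> v + (transpose (hess f x) *v v) \<bullet> x)) (at x)"
    by (rule has_derivative_transform_within_open[where s = "- {0}"]) (use assms in \<open>auto simp: C2_hom1_euler\<close>)
  from has_derivative_unique[OF this C2_off0D(1)[OF C2_hom1_C2 assms]]
  have "(transpose (hess f x) *v v) \<bullet> x = 0" for v
    by (auto simp: fun_eq_iff)
  then have "v \<bullet> (hess f x *v x) = 0" for v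
    by (metis dot_lmul_matrix transpose_matrix_vector)
  then show ?thesis by (metis inner_eq_zero_iff)
qed

lemma C2_hom1_continuous_sphere:
  "continuous_on (sphere 0 1) f" "continuous_on (sphere 0 1) (grad f)" "continuous_on (sphere 0 1) (hess f)"
  by (rule continuous_on_subset[OF C2_off0D(3)[OF C2_hom1_C2]] continuous_on_subset[OF C2_off0D(4)[OF C2_hom1_C2]]
      continuous_on_subset[OF C2_off0D(5)[OF C2_hom1_C2]], force)+

text \<open>The gradient is homogeneous of degree 0 and the Hessian of degree -1, so the derivative
  is |y|^k times a matrix that depends on the direction alone. The case k = 0 is the map that
  parametrises the body; k = n is the competitor in the first variation.\<close>

lemma has_derivative_radial_grad:
  assumes "y \<noteq> 0"
  shows "((\<lambda>y. norm y ^ Suc k *\<^sub>R grad f y) has_derivative (\<lambda>v. (norm y ^ k *\<^sub>R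
      (transpose (hess f (y /\<^sub>R norm y)) + (1 + real k) *\<^sub>R dyad (grad f (y /\<^sub>R norm y)) (y /\<^sub>R norm y))) *v v)) (at y)"
proof -
  have 1: "((\<lambda>y. norm y ^ Suc k) has_derivative (\<lambda>v. (1 + real k) * norm y ^ k * ((y /\<^sub>R norm y) \<bullet> v))) (at y)"
    by (rule has_derivative_eq_rhs, rule has_derivative_power[OF has_derivative_norm[OF assms]])
      (simp add: fun_eq_iff sgn_div_norm inner_commute mult_ac)
  have g: "grad f (y /\<^sub>R norm y) = grad f y" "hess f (y /\<^sub>R norm y) = norm y *\<^sub>R hess f y"
    using assms hess_scale[of "inverse (norm y)" y] by (simp_all add: grad_scale inverse_eq_divide)
  show ?thesis
    unfolding g
    by (rule has_derivative_eq_rhs, rule has_derivative_scaleR[OF 1 C2_off0D(2)[OF C2_hom1_C2 assms]])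
      (simp add: fun_eq_iff mult_vec_expand scaleR_add_right mult_ac)
qed

lemma grad_bounded: obtains C where "C \<ge> 0" "\<And>y. y \<noteq> 0 \<Longrightarrow> norm (grad f y) \<le> C"
proof -
  have "bounded (grad f ` sphere 0 1)"
    by (intro compact_imp_bounded compact_continuous_image C2_hom1_continuous_sphere compact_sphere)
  then obtain C where C: "\<And>x. norm x = 1 \<Longrightarrow> norm (grad f x) \<le> C"
    unfolding bounded_iff by (metis imageI mem_sphere_0)
  have "norm (grad f y) \<le> \<bar>C\<bar>" if "y \<noteq> 0" for y
    using C[of "y /\<^sub>R norm y"] grad_scale[of "inverse (norm y)" y] that by simp
  then show ?thesis using that[of "\<bar>C\<bar>"] by simp
qed

lemma hess_bounded: obtains C where "C \<ge> 0" "\<And>x. norm x = 1 \<Longrightarrow> norm (hess f x) \<le> C"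
proof -
  have "bounded (hess f ` sphere 0 1)"
    by (intro compact_imp_bounded compact_continuous_image C2_hom1_continuous_sphere compact_sphere)
  then obtain C where C: "\<And>x. norm x = 1 \<Longrightarrow> norm (hess f x) \<le> C"
    unfolding bounded_iff by (metis imageI mem_sphere_0)
  show ?thesis using that[of "\<bar>C\<bar>"] C by (meson abs_ge_self abs_ge_zero order_trans)
qed

end

section \<open>The first variation of volume\<close>

text \<open>The derivative is bounded off the origin but may not exist there. A segment avoiding 0
  is handled by the mean value inequality; on a segment through 0 the norms of the endpoints add up
  to |x - y|, and the bound on the gradient is enough.\<close>

lemma radial_grad_lipschitz:
  fixes f :: "real^'n::finite \<Rightarrow> real"
  assumes f: "C2_hom1 f"
  obtains B where "B \<ge> 0"
    "\<And>x y. norm (norm x *\<^sub>R grad f x - norm y *\<^sub>R grad f y) \<le> B * norm (x - y)"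
proof -
  obtain C1 where C1: "C1 \<ge> 0" "\<And>y. y \<noteq> 0 \<Longrightarrow> norm (grad f y) \<le> C1"
    using grad_bounded[OF f] by blast
  obtain C2 where C2: "C2 \<ge> 0" "\<And>x. norm x = 1 \<Longrightarrow> norm (hess f x) \<le> C2"
    using hess_bounded[OF f] by blast
  define D where "D y = transpose (hess f (y /\<^sub>R norm y)) + dyad (grad f (y /\<^sub>R norm y)) (y /\<^sub>R norm y)" for y
  have der: "((\<lambda>y. norm y *\<^sub>R grad f y) has_derivative (\<lambda>v. D y *v v)) (at y)" if "y \<noteq> 0" for y
    using has_derivative_radial_grad[OF f that, of 0] by (simp add: D_def)
  have ntr: "norm (transpose A) = norm A" for A :: "real^'n^'n"
    unfolding norm_eq_sqrt_inner inner_vec_def transpose_def by (simp, subst sum.swap) (rule refl)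
  have ndy: "norm (dyad a b) \<le> norm a * norm b" for a b :: "real^'n"
  proof -
    have "norm (dyad a b) = L2_set (\<lambda>i. \<bar>a $ i\<bar> * norm b) UNIV"
      unfolding norm_vec_def[of "dyad a b"] by (rule L2_set_cong) (auto simp: dyad_def norm_vec_def L2_set_def power_mult_distrib sum_distrib_left[symmetric] real_sqrt_mult)
    also have "\<dots> = norm a * norm b"
      by (simp add: L2_set_left_distrib[symmetric] norm_vec_def)
    finally show ?thesis by simp
  qed
  have bd: "onorm (\<lambda>v. D y *v v) \<le> C1 + C2" if "y \<noteq> 0" for y
  proof (rule onorm_le)
    fix v
    have "norm (D y) \<le> C2 + C1 * 1"
      unfolding D_def
      by (rule order_trans[OF norm_triangle_ineq add_mono])
        (use that C2 C1 ndy[of "grad f (y /\<^sub>R norm y)" "y /\<^sub>R norm y"] in \<open>auto simp: ntr intro: order_trans\<close>)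
    then show "norm (D y *v v) \<le> (C1 + C2) * norm v"
      by (intro order_trans[OF norm_matrix_vector_le mult_right_mono]) auto
  qed
  have "norm (norm x *\<^sub>R grad f x - norm y *\<^sub>R grad f y) \<le> (C1 + C2) * norm (x - y)" for x y
  proof (cases "0 \<in> closed_segment x y")
    case True
    have 1: "norm (norm z *\<^sub>R grad f z) \<le> C1 * norm z" for z
      using C1(2)[of z] mult_left_mono[of "norm (grad f z)" C1 "norm z"] by (cases "z = 0") (auto simp: mult.commute)
    have "norm (x - y) = norm x + norm y"
      using True by (simp add: between_mem_segment[symmetric] between dist_norm)
    then have "norm (norm x *\<^sub>R grad f x - norm y *\<^sub>R grad f y) \<le> C1 * norm (x - y)"
      using 1[of x] 1[of y] norm_triangle_ineq4[of "norm x *\<^sub>R grad f x" "norm y *\<^sub>R grad f y"] by (simp add: distrib_left)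
    also have "\<dots> \<le> (C1 + C2) * norm (x - y)" using C2 by (intro mult_right_mono) auto
    finally show ?thesis .
  next
    case False
    show ?thesis
    proof (rule differentiable_bound[where f = "\<lambda>y. norm y *\<^sub>R grad f y"])
      show "((\<lambda>y. norm y *\<^sub>R grad f y) has_derivative (\<lambda>v. D z *v v)) (at z within closed_segment x y)"
        if "z \<in> closed_segment x y" for z
        by (rule has_derivative_at_withinI, rule der) (use that False in auto)
      show "onorm (\<lambda>v. D z *v v) \<le> C1 + C2" if "z \<in> closed_segment x y" for z
        by (rule bd) (use that False in auto)
    qed auto
  qed
  then show ?thesis using that[of "C1 + C2"] C1 C2 by auto
qed

text \<open>The factor |y|^k is capped at 1 outside the ball, so that the field agrees there with
  |y| grad f and cannot grow too fast at infinity. For |x| <= |y| the difference is split so that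
  Phi x is multiplied by the difference of the two factors: Phi x is bounded when |x| <= 1, and
  otherwise the factors are equal.\<close>

lemma radial_grad_cutoff_lipschitz:
  fixes f :: "real^'n::finite \<Rightarrow> real"
  assumes f: "C2_hom1 f"
  obtains B where "B \<ge> 0"
    "\<And>x y. norm (min 1 (norm x) ^ k *\<^sub>R (norm x *\<^sub>R grad f x) - min 1 (norm y) ^ k *\<^sub>R (norm y *\<^sub>R grad f y)) \<le> B * norm (x - y)"
proof -
  obtain B where B: "B \<ge> 0"
    "\<And>x y. norm (norm x *\<^sub>R grad f x - norm y *\<^sub>R grad f y) \<le> B * norm (x - y)"
    using radial_grad_lipschitz[OF f] by blast
  define \<Phi> where "\<Phi> x = norm x *\<^sub>R grad f x" for x
  define \<mu> where "\<mu> x = min 1 (norm x) ^ k" for x :: "real^'n"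
  have mu: "\<bar>\<mu> x\<bar> \<le> 1" "\<bar>\<mu> x - \<mu> y\<bar> \<le> real k * norm (x - y)" for x y
  proof -
    show "\<bar>\<mu> x\<bar> \<le> 1" by (auto simp: \<mu>_def power_le_one)
    have "\<bar>\<mu> x - \<mu> y\<bar> \<le> real k * \<bar>min 1 (norm x) - min 1 (norm y)\<bar>"
      unfolding \<mu>_def using norm_power_diff[of "min 1 (norm x)" "min 1 (norm y)" k] by auto
    also have "\<bar>min 1 (norm x) - min 1 (norm y)\<bar> \<le> norm (x - y)"
      using norm_triangle_ineq3[of x y] by auto
    finally show "\<bar>\<mu> x - \<mu> y\<bar> \<le> real k * norm (x - y)" by (simp add: mult_left_mono)
  qed
  have P: "norm (\<Phi> x) \<le> B" if "norm x \<le> 1" for x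
    using B(2)[of x 0] B(1) that mult_left_mono[of "norm x" 1 B] by (simp add: \<Phi>_def)
  have "norm (\<mu> x *\<^sub>R \<Phi> x - \<mu> y *\<^sub>R \<Phi> y) \<le> (B + real k * B) * norm (x - y)"
    if xy: "norm x \<le> norm y" for x y
  proof -
    have "\<mu> x *\<^sub>R \<Phi> x - \<mu> y *\<^sub>R \<Phi> y = \<mu> y *\<^sub>R (\<Phi> x - \<Phi> y) + (\<mu> x - \<mu> y) *\<^sub>R \<Phi> x"
      by (simp add: algebra_simps)
    then have "norm (\<mu> x *\<^sub>R \<Phi> x - \<mu> y *\<^sub>R \<Phi> y) \<le> \<bar>\<mu> y\<bar> * norm (\<Phi> x - \<Phi> y) + \<bar>\<mu> x - \<mu> y\<bar> * norm (\<Phi> x)"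
      using norm_triangle_ineq[of "\<mu> y *\<^sub>R (\<Phi> x - \<Phi> y)" "(\<mu> x - \<mu> y) *\<^sub>R \<Phi> x"] by simp
    also have "\<bar>\<mu> y\<bar> * norm (\<Phi> x - \<Phi> y) \<le> 1 * (B * norm (x - y))"
      by (intro mult_mono mu) (use B in \<open>auto simp: \<Phi>_def\<close>)
    finally have 1: "norm (\<mu> x *\<^sub>R \<Phi> x - \<mu> y *\<^sub>R \<Phi> y) \<le> B * norm (x - y) + \<bar>\<mu> x - \<mu> y\<bar> * norm (\<Phi> x)" by simp
    show ?thesis
    proof (cases "norm x \<le> 1")
      case True
      then have "\<bar>\<mu> x - \<mu> y\<bar> * norm (\<Phi> x) \<le> (real k * norm (x - y)) * B"
        by (intro mult_mono mu P) auto
      then show ?thesis using 1 by (simp add: algebra_simps)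
    next
      case False
      then have "\<mu> x = \<mu> y" using xy by (simp add: \<mu>_def)
      then show ?thesis using 1 B(1) by (simp add: distrib_right add_increasing2)
    qed
  qed
  then have main: "norm (\<mu> x *\<^sub>R \<Phi> x - \<mu> y *\<^sub>R \<Phi> y) \<le> (B + real k * B) * norm (x - y)" for x y
    by (cases "norm x \<le> norm y") (simp, metis linear norm_minus_commute)
  show ?thesis
    using that[of "B + real k * B"] main B(1) by (auto simp: \<mu>_def \<Phi>_def)
qed

lemma detcoef_beyond: "k > CARD('n) \<Longrightarrow> detcoef k A (B :: real^'n::finite^'n) = 0"
proof -
  assume k: "k > CARD('n)"
  have "card S \<noteq> k" for S :: "'n set"
    using k card_mono[of UNIV S] by auto
  then have "{S :: 'n set. card S = k} = {}" by blast
  then show ?thesis unfolding detcoef_def by simp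
qed

text \<open>The convention d (n+1) = 0 lets one formula cover the top coefficient, where only the
  shifted term survives.\<close>

lemma poly_times_linear:
  fixes d :: "nat \<Rightarrow> real"
  assumes "d (Suc n) = 0"
  shows "(a + s * b) * (\<Sum>k\<le>n. d k * s ^ k) =
    (\<Sum>k\<le>Suc n. (a * d k + (case k of 0 \<Rightarrow> 0 | Suc j \<Rightarrow> b * d j)) * s ^ k)"
proof -
  have "(\<Sum>k\<le>Suc n. (a * d k + (case k of 0 \<Rightarrow> 0 | Suc j \<Rightarrow> b * d j)) * s ^ k) =
     (\<Sum>k\<le>Suc n. a * d k * s ^ k) + (\<Sum>k\<le>Suc n. (case k of 0 \<Rightarrow> 0 | Suc j \<Rightarrow> b * d j) * s ^ k)"
    by (simp only: distrib_right sum.distrib)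
  also have "(\<Sum>k\<le>Suc n. a * d k * s ^ k) = (\<Sum>k\<le>n. a * d k * s ^ k)"
    using assms by simp
  also have "(\<Sum>k\<le>Suc n. (case k of 0 \<Rightarrow> 0 | Suc j \<Rightarrow> b * d j) * s ^ k) = (\<Sum>k\<le>n. b * d k * s ^ Suc k)"
    by (subst sum.atMost_Suc_shift) simp
  also have "(\<Sum>k\<le>n. a * d k * s ^ k) + (\<Sum>k\<le>n. b * d k * s ^ Suc k) = (a + s * b) * (\<Sum>k\<le>n. d k * s ^ k)"
    unfolding sum.distrib[symmetric] sum_distrib_left by (rule sum.cong) (simp_all add: algebra_simps)
  finally show ?thesis by simp
qed

definition hess1 :: "(real^'n::finite \<Rightarrow> real) \<Rightarrow> real^'n \<Rightarrow> real^'n^'n" where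
  "hess1 f x = hess f x + outer x"

lemma detD2_hess1: "detD2 f x = det (hess1 f x)"
  by (simp add: detD2_def hess1_def)

lemma continuous_on_hess1 [continuous_intros]: "C2_hom1 f \<Longrightarrow> continuous_on (sphere 0 1) (hess1 f)"
  unfolding hess1_def outer_eq_dyad by (intro continuous_intros C2_hom1_continuous_sphere)

lemma hess1_add_cmul:
  assumes "C2_hom1 h" "C2_hom1 u" "x \<noteq> 0"
  shows "hess1 (\<lambda>x. h x + s * u x) x = hess1 h x + s *\<^sub>R hess u x"
  using assms by (simp add: hess1_def C2_off0_add C2_off0_cmul C2_hom1_C2 C2_off0_add(3))

text \<open>At a unit vector x this is the coefficient of \<open>s\<^sup>k\<close> in \<open>det D\<^sup>2(h + s u)\<close>, a binomial
  coefficient times a mixed discriminant.\<close>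

definition volform :: "(real^'n::finite \<Rightarrow> real) \<Rightarrow> (real^'n \<Rightarrow> real) \<Rightarrow> nat \<Rightarrow> real^'n \<Rightarrow> real" where
  "volform h u k x = detcoef k (hess1 h x) (hess u x)"

lemma volform_0: "volform h u 0 x = detD2 h x"
  by (simp add: volform_def detD2_hess1)

lemma continuous_on_volform [continuous_intros]:
  assumes "C2_hom1 h" "C2_hom1 u"
  shows "continuous_on (sphere 0 1) (volform h u k)"
  unfolding volform_def using assms by (intro continuous_intros C2_hom1_continuous_sphere)

text \<open>Compare \<open>r \<nabla>(h + s u)\<close> with \<open>r \<nabla>h + s r\<^bsup>n+1\<^esup> \<nabla>u\<close>, which agree on the unit sphere: their
  Jacobian determinants have the same integral for every s, and the coefficients of \<open>s\<^sup>k\<close> give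
  the claim.\<close>

theorem first_variation:
  fixes h u :: "real^'n::finite \<Rightarrow> real"
  assumes h: "C2_hom1 h" and u: "C2_hom1 u" and k: "k \<le> CARD('n)"
  shows "real (Suc k) * sphere_int (\<lambda>x. h x * volform h u (Suc k) x) =
     (real CARD('n) - real (Suc k)) * sphere_int (\<lambda>x. u x * volform h u k x)"
proof -
  let ?n = "CARD('n)"
  let ?p = "\<lambda>y :: real^'n. y /\<^sub>R norm y"
  define d where "d k x = volform h u k x" for k x
  have contd: "continuous_on (sphere 0 1) (d k)" for k
    unfolding d_def by (intro continuous_intros h u)
  have conth: "continuous_on (sphere 0 1) h" "continuous_on (sphere 0 1) u"
    using C2_hom1_continuous_sphere h u by auto
  define X where "X k = sphere_int (\<lambda>x. h x * d k x)" for k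
  \<comment> \<open>The shift by one: u comes with one more power of s than the coefficient of the
    determinant that it multiplies.\<close>
  define Y where "Y k = (case k of 0 \<Rightarrow> 0 | Suc j \<Rightarrow> sphere_int (\<lambda>x. u x * d j x))" for k
  define D where "D m f y = norm y ^ m *\<^sub>R (transpose (hess f (?p y)) + (1 + real m) *\<^sub>R dyad (grad f (?p y)) (?p y))"
    for m and f :: "real^'n \<Rightarrow> real" and y
  have der: "((\<lambda>y. norm y ^ Suc m *\<^sub>R grad f y) has_derivative (\<lambda>v. D m f y *v v)) (at y)"
    if "C2_hom1 f" "y \<noteq> 0" for m f y
    unfolding D_def by (rule has_derivative_radial_grad[OF that])
  have contD: "continuous_on punctured_ball (D m f)" if "C2_hom1 f" for m f
  proof -
    note [continuous_intros] = continuous_on_subset[OF continuous_on_sphere_proj[of "hess f"], of punctured_ball]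
      continuous_on_subset[OF continuous_on_sphere_proj[of "grad f"], of punctured_ball]
    show ?thesis unfolding D_def
      by (intro continuous_intros C2_hom1_continuous_sphere that) auto
  qed
  have boundD: "\<exists>C. \<forall>y\<in>punctured_ball. norm (D m f y) \<le> C" if f: "C2_hom1 f" for m f
  proof -
    define E where "E x = transpose (hess f x) + (1 + real m) *\<^sub>R dyad (grad f x) x" for x
    have "continuous_on (sphere 0 1) E"
      unfolding E_def by (intro continuous_intros C2_hom1_continuous_sphere f)
    then have "bounded (E ` sphere 0 1)"
      by (intro compact_imp_bounded compact_continuous_image) auto
    then obtain C where C: "\<And>x. norm x = 1 \<Longrightarrow> norm (E x) \<le> C"
      unfolding bounded_iff by (metis imageI mem_sphere_0)
    have "norm (D m f y) \<le> C" if "y \<in> punctured_ball" for y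
    proof -
      have "norm (D m f y) = norm y ^ m * norm (E (?p y))" by (simp add: D_def E_def)
      also have "\<dots> \<le> 1 * norm (E (?p y))"
        using that by (intro mult_right_mono power_le_one) auto
      also have "\<dots> \<le> C" using C[of "?p y"] that by simp
      finally show ?thesis .
    qed
    then show ?thesis by blast
  qed
  \<comment> \<open>With t = s |y|^m and x = y/|y| the determinant factors into the radial part h(x)
    + t (1+m) u(x) and det D^2(h + t u)(x). Apart from t, only the radial part feels the exponent
    m.\<close>
  have detD: "det (D 0 h y + s *\<^sub>R D m u y) =
      (\<Sum>k\<le>Suc ?n. (h (?p y) * d k (?p y) +
        (case k of 0 \<Rightarrow> 0 | Suc j \<Rightarrow> (1 + real m) * u (?p y) * d j (?p y))) * (s * norm y ^ m) ^ k)"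
    if "y \<in> punctured_ball" for y s m
  proof -
    define x where "x = ?p y"
    have x: "norm x = 1" "x \<noteq> 0" using that by (auto simp: x_def)
    define t where "t = s * norm y ^ m"
    define M where "M = hess h x + t *\<^sub>R hess u x"
    define g where "g = grad h x + (t * (1 + real m)) *\<^sub>R grad u x"
    have eq: "D 0 h y + s *\<^sub>R D m u y = transpose M + dyad g x"
      by (simp add: D_def x_def[symmetric] M_def g_def t_def transpose_add transpose_scaleR scaleR_add_right)
        (simp add: dyad_def vec_eq_iff algebra_simps)
    have "transpose (transpose M) *v x = 0"
      using x by (simp add: transpose_transpose M_def mult_vec_expand hess_null h u)
    then have "det (D 0 h y + s *\<^sub>R D m u y) = (g \<bullet> x) * det (transpose M + dyad x x)"
      unfolding eq by (rule det_plus_dyad_null[OF x(1)])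
    also have "transpose M + dyad x x = transpose (M + dyad x x)"
      by (simp add: transpose_add transpose_dyad)
    also have "M + dyad x x = hess1 h x + t *\<^sub>R hess u x"
      by (simp add: M_def hess1_def outer_eq_dyad)
    also have "g \<bullet> x = h x + t * ((1 + real m) * u x)"
      using x by (simp add: g_def inner_left_distrib C2_hom1_euler h u)
    finally have "det (D 0 h y + s *\<^sub>R D m u y) = (h x + t * ((1 + real m) * u x)) * (\<Sum>k\<le>?n. d k x * t ^ k)"
      by (simp add: det_add_scaleR d_def volform_def)
    also have "\<dots> = (\<Sum>k\<le>Suc ?n. (h x * d k x + (case k of 0 \<Rightarrow> 0 | Suc j \<Rightarrow> (1 + real m) * u x * d j x)) * t ^ k)"
      by (subst poly_times_linear) (auto simp: d_def volform_def detcoef_beyond)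
    finally show ?thesis unfolding t_def x_def .
  qed
  define c where "c m k x = h x * d k x + (case k of 0 \<Rightarrow> 0 | Suc j \<Rightarrow> (1 + real m) * u x * d j x)" for m k x
  have contc: "continuous_on (sphere 0 1) (c m k)" for m k
    unfolding c_def by (cases k) (auto intro!: continuous_intros conth contd)
  have intc: "sphere_int (c m k) = X k + (1 + real m) * Y k" for m k
  proof (cases k)
    case 0
    then have "c m k = (\<lambda>x. h x * d 0 x)" by (simp add: c_def fun_eq_iff)
    then show ?thesis using 0 by (simp add: X_def Y_def)
  next
    case (Suc j)
    have "sphere_int (c m k) = X k + sphere_int (\<lambda>x. (1 + real m) * (u x * d j x))"
      unfolding c_def Suc X_def by (subst sphere_int_add[symmetric]) (auto intro!: continuous_intros conth contd simp: mult.assoc)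
    then show ?thesis by (simp add: Suc Y_def sphere_int_mult)
  qed
  have int0: "integral (ball 0 1) (\<lambda>y. det (D 0 h y + s *\<^sub>R D 0 u y)) = (\<Sum>k\<le>Suc ?n. (X k + Y k) * s ^ k)" for s
  proof -
    have "integral (ball 0 1) (\<lambda>y. det (D 0 h y + s *\<^sub>R D 0 u y)) =
        integral (ball 0 1) (\<lambda>y. \<Sum>k\<le>Suc ?n. c 0 k (?p y) * s ^ k)"
      unfolding integral_punctured[symmetric]
      by (rule integral_cong) (simp only: detD c_def power_0 mult_1_right)
    also have "\<dots> = (\<Sum>k\<le>Suc ?n. sphere_int (c 0 k) * s ^ k)"
      unfolding sphere_int_def
      by (subst integral_sum) (auto intro!: integrable_on_mult_left[OF sphere_int_integrable[OF contc]])
    finally show ?thesis by (simp add: intc)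
  qed
  \<comment> \<open>The exponent n is chosen to meet \<open>sphere_int_radial_moment\<close>: the
    coefficient of s^k carries |y|^(n k), which yields the factor 1/(1+k).\<close>
  have intn: "integral (ball 0 1) (\<lambda>y. det (D 0 h y + s *\<^sub>R D ?n u y)) =
      (\<Sum>k\<le>Suc ?n. (X k + (1 + real ?n) * Y k) / (1 + real k) * s ^ k)" for s
  proof -
    have "integral (ball 0 1) (\<lambda>y. det (D 0 h y + s *\<^sub>R D ?n u y)) =
        integral (ball 0 1) (\<lambda>y. \<Sum>k\<le>Suc ?n. ((norm y ^ ?n) ^ k * c ?n k (?p y)) * s ^ k)"
      unfolding integral_punctured[symmetric]
      by (rule integral_cong) (simp only: detD c_def power_mult_distrib mult_ac)
    also have "\<dots> = (\<Sum>k\<le>Suc ?n. integral (ball 0 1) (\<lambda>y. (norm y ^ ?n) ^ k * c ?n k (?p y)) * s ^ k)"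
      by (subst integral_sum)
        (auto intro!: integrable_on_mult_left[OF sphere_fun_integrable(2)[OF contc, where g = "\<lambda>r. (r ^ ?n) ^ k" for k]] continuous_intros)
    finally show ?thesis by (simp only: sphere_int_radial_moment[OF contc] intc)
  qed
  have eq: "integral (ball 0 1) (\<lambda>y. det (D 0 h y + s *\<^sub>R D 0 u y)) = integral (ball 0 1) (\<lambda>y. det (D 0 h y + s *\<^sub>R D ?n u y))" for s
  proof -
    obtain B1 where B1: "B1 \<ge> 0"
      "\<And>x y. norm (norm x *\<^sub>R grad h x - norm y *\<^sub>R grad h y) \<le> B1 * norm (x - y)"
      using radial_grad_lipschitz[OF h] by blast
    have "\<exists>B\<ge>0. \<forall>x y. norm (min 1 (norm x) ^ m *\<^sub>R (norm x *\<^sub>R grad u x) - min 1 (norm y) ^ m *\<^sub>R (norm y *\<^sub>R grad u y)) \<le> B * norm (x - y)" for m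
      using radial_grad_cutoff_lipschitz[OF u, of m] by metis
    then obtain B2 where B2: "\<And>m. B2 m \<ge> 0"
      "\<And>m x y. norm (min 1 (norm x) ^ m *\<^sub>R (norm x *\<^sub>R grad u x) - min 1 (norm y) ^ m *\<^sub>R (norm y *\<^sub>R grad u y)) \<le> B2 m * norm (x - y)"
      by metis
    obtain C1 where C1: "\<And>y. y \<in> punctured_ball \<Longrightarrow> norm (D 0 h y) \<le> C1" using boundD[OF h] by blast
    obtain C2 where C2: "\<And>m y. y \<in> punctured_ball \<Longrightarrow> norm (D m u y) \<le> C2 m" using boundD[OF u] by metis
    \<comment> \<open>Inside the ball this is r grad h + s r^(m+1) grad u; the cap makes
      \<open>F 0\<close> and \<open>F CARD('n)\<close> coincide outside and keeps both
      Lipschitz.\<close>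
    define F where "F m y = norm y *\<^sub>R grad h y + s *\<^sub>R (min 1 (norm y) ^ m *\<^sub>R (norm y *\<^sub>R grad u y))" for m y
    define B where "B = B1 + \<bar>s\<bar> * (B2 0 + B2 ?n)"
    define C where "C = C1 + \<bar>s\<bar> * (\<bar>C2 0\<bar> + \<bar>C2 ?n\<bar>)"
    have lip: "norm (F m x - F m y) \<le> B * norm (x - y)" if "m \<in> {0, ?n}" for m x y
    proof -
      let ?a = "norm x *\<^sub>R grad h x - norm y *\<^sub>R grad h y"
      let ?b = "min 1 (norm x) ^ m *\<^sub>R (norm x *\<^sub>R grad u x) - min 1 (norm y) ^ m *\<^sub>R (norm y *\<^sub>R grad u y)"
      have "F m x - F m y = ?a + s *\<^sub>R ?b"
        by (simp add: F_def algebra_simps)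
      then have "norm (F m x - F m y) \<le> norm ?a + \<bar>s\<bar> * norm ?b"
        using norm_triangle_ineq[of ?a "s *\<^sub>R ?b"] by simp
      also have "\<dots> \<le> B1 * norm (x - y) + \<bar>s\<bar> * (B2 m * norm (x - y))"
        by (intro add_mono mult_left_mono B1 B2) auto
      also have "\<dots> \<le> B1 * norm (x - y) + \<bar>s\<bar> * ((B2 0 + B2 ?n) * norm (x - y))"
        using that B2(1)[of 0] B2(1)[of ?n] by (intro add_mono mult_left_mono mult_right_mono) auto
      finally show ?thesis by (simp add: B_def algebra_simps)
    qed
    have derF: "(F m has_derivative (\<lambda>v. (D 0 h y + s *\<^sub>R D m u y) *v v)) (at y)" if y: "y \<in> punctured_ball" for m y
    proof -
      have "((\<lambda>y. norm y ^ Suc 0 *\<^sub>R grad h y + s *\<^sub>R (norm y ^ Suc m *\<^sub>R grad u y)) has_derivative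
          (\<lambda>v. D 0 h y *v v + s *\<^sub>R (D m u y *v v))) (at y)"
        using y by (intro has_derivative_add has_derivative_scaleR_right der h u) auto
      then have "((\<lambda>y. norm y ^ Suc 0 *\<^sub>R grad h y + s *\<^sub>R (norm y ^ Suc m *\<^sub>R grad u y)) has_derivative
          (\<lambda>v. (D 0 h y + s *\<^sub>R D m u y) *v v)) (at y)"
        by (simp only: mult_vec_expand)
      then show ?thesis
        by (rule has_derivative_transform_within_open[where s = "punctured_ball"])
          (use y in \<open>auto simp: F_def mult.commute\<close>)
    qed
    have bd: "norm (D 0 h y + s *\<^sub>R D m u y) \<le> C" if "m \<in> {0, ?n}" "y \<in> punctured_ball" for m y
    proof -
      have "norm (D 0 h y + s *\<^sub>R D m u y) \<le> norm (D 0 h y) + \<bar>s\<bar> * norm (D m u y)"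
        using norm_triangle_ineq[of "D 0 h y" "s *\<^sub>R D m u y"] by simp
      also have "\<dots> \<le> C1 + \<bar>s\<bar> * (\<bar>C2 0\<bar> + \<bar>C2 ?n\<bar>)"
        using C1 C2[of y 0] C2[of y ?n] that by (intro add_mono mult_left_mono) auto
      finally show ?thesis by (simp add: C_def)
    qed
    show ?thesis
      by (rule integral_det_Jacobian_eq[of "F 0" B "F ?n" _ _ C])
        (auto intro!: lip derF bd continuous_intros contD h u, simp add: F_def)
  qed
  have "(\<Sum>k\<le>Suc ?n. (X k + Y k) * s ^ k) = (\<Sum>k\<le>Suc ?n. (X k + (1 + real ?n) * Y k) / (1 + real k) * s ^ k)" for s
    unfolding int0[symmetric] intn[symmetric] by (rule eq)
  then have "X (Suc k) + Y (Suc k) = (X (Suc k) + (1 + real ?n) * Y (Suc k)) / (1 + real (Suc k))"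
    by (rule poly_coeffs_eqI[where n = "Suc ?n" and e = 1]) (use k in auto)
  \<comment> \<open>Clearing the denominator in X + Y = (X + (n+1) Y) / (k+2) gives (k+1) X =
    (n-k-1) Y.\<close>
  then have "real (Suc k) * X (Suc k) = (real ?n - real (Suc k)) * Y (Suc k)"
    by (simp add: field_simps)
  then show ?thesis by (simp add: X_def Y_def d_def)
qed

text \<open>Apply the first variation with k = 0 to the base h + s w in direction u and compare the
  coefficients of s. The term with two derivatives of det is symmetric in u and w by
  \<open>detcoef2_sym\<close>, so subtracting the same identity with u and w exchanged leaves n
  times the difference of the two sides.\<close>

theorem volform_symmetric:
  fixes h u w :: "real^'n::finite \<Rightarrow> real"
  assumes h: "C2_hom1 h" and u: "C2_hom1 u" and w: "C2_hom1 w"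
  shows "sphere_int (\<lambda>x. u x * volform h w 1 x) = sphere_int (\<lambda>x. w x * volform h u 1 x)"
proof -
  let ?n = "CARD('n)"
  define E where "E u w k x = detcoef2 k (hess1 h x) (hess u x) (hess w x)" for u w k x
  have main: "sphere_int (\<lambda>x. h x * E u w 1 x) + sphere_int (\<lambda>x. w x * volform h u 1 x) =
      (real ?n - 1) * sphere_int (\<lambda>x. u x * volform h w 1 x)"
    if u: "C2_hom1 u" and w: "C2_hom1 w" for u w
  proof -
    have cont: "continuous_on (sphere 0 1) h" "continuous_on (sphere 0 1) u" "continuous_on (sphere 0 1) w"
      "\<And>k. continuous_on (sphere 0 1) (E u w k)" "\<And>k. continuous_on (sphere 0 1) (volform h w k)"
      unfolding E_def
      by (intro continuous_intros h u w C2_hom1_continuous_sphere(1)[OF h] C2_hom1_continuous_sphere(1,3)[OF u]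
          C2_hom1_continuous_sphere(1,3)[OF w])+
    define c where "c k x = h x * E u w k x + (case k of 0 \<Rightarrow> 0 | Suc j \<Rightarrow> w x * E u w j x)" for k x
    have contc: "continuous_on (sphere 0 1) (c k)" for k
      unfolding c_def by (cases k) (auto intro!: continuous_intros cont)
    have E_beyond: "E u w (Suc ?n) x = 0" for x
      by (simp add: E_def detcoef2_def detcoef_beyond)
    have "(\<Sum>k\<le>Suc ?n. sphere_int (c k) * s ^ k) =
        (\<Sum>k\<le>Suc ?n. ((real ?n - 1) * sphere_int (\<lambda>x. u x * volform h w k x)) * s ^ k)" for s
    proof -
      let ?f = "\<lambda>x. h x + s * w x"
      have f: "C2_hom1 ?f" by (intro C2_hom1_add C2_hom1_cmul h w)
      have "sphere_int (\<lambda>x. ?f x * volform ?f u 1 x) = (real ?n - 1) * sphere_int (\<lambda>x. u x * volform ?f u 0 x)"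
        using first_variation[OF f u, of 0] by simp
      also have "sphere_int (\<lambda>x. ?f x * volform ?f u 1 x) = sphere_int (\<lambda>x. \<Sum>k\<le>Suc ?n. c k x * s ^ k)"
      proof (rule sphere_int_cong)
        fix x :: "real^'n" assume "norm x = 1"
        then have "x \<noteq> 0" by auto
        have "volform ?f u 1 x = (\<Sum>k\<le>?n. E u w k x * s ^ k)"
          unfolding volform_def hess1_add_cmul[OF h w \<open>x \<noteq> 0\<close>] One_nat_def detcoef_1_expand E_def ..
        then show "?f x * volform ?f u 1 x = (\<Sum>k\<le>Suc ?n. c k x * s ^ k)"
          unfolding c_def using poly_times_linear[of "\<lambda>k. E u w k x" ?n "h x" s "w x"] E_beyond by simp
      qed
      also have "\<dots> = (\<Sum>k\<le>Suc ?n. sphere_int (c k) * s ^ k)"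
        by (subst sphere_int_sum) (auto intro!: continuous_intros contc sum.cong simp: sphere_int_mult[of "s ^ k" for k] mult.commute)
      also have "sphere_int (\<lambda>x. u x * volform ?f u 0 x) = sphere_int (\<lambda>x. \<Sum>k\<le>Suc ?n. (u x * volform h w k x) * s ^ k)"
      proof (rule sphere_int_cong)
        fix x :: "real^'n" assume "norm x = 1"
        then have "x \<noteq> 0" by auto
        have "volform ?f u 0 x = (\<Sum>k\<le>?n. volform h w k x * s ^ k)"
          unfolding volform_def hess1_add_cmul[OF h w \<open>x \<noteq> 0\<close>] detcoef_0 det_add_scaleR ..
        then show "u x * volform ?f u 0 x = (\<Sum>k\<le>Suc ?n. (u x * volform h w k x) * s ^ k)"
          by (simp add: sum_distrib_left mult.assoc volform_def detcoef_beyond)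
      qed
      also have "\<dots> = (\<Sum>k\<le>Suc ?n. sphere_int (\<lambda>x. u x * volform h w k x) * s ^ k)"
        by (subst sphere_int_sum) (auto intro!: continuous_intros cont sum.cong simp: sphere_int_mult[of "s ^ k" for k] mult.commute[of _ "s ^ k" for k])
      finally show ?thesis by (simp only: sum_distrib_left mult.assoc)
    qed
    then have "sphere_int (c 1) = (real ?n - 1) * sphere_int (\<lambda>x. u x * volform h w 1 x)"
      by (rule poly_coeffs_eqI[where n = "Suc ?n" and e = 1]) auto
    moreover have "sphere_int (c 1) = sphere_int (\<lambda>x. h x * E u w 1 x) + sphere_int (\<lambda>x. w x * volform h u 1 x)"
      unfolding c_def by (subst sphere_int_add[symmetric])
        (auto intro!: continuous_intros cont h C2_hom1_continuous_sphere(3)[OF u] C2_hom1_continuous_sphere(3)[OF w]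
          simp: E_def volform_def)
    ultimately show ?thesis by simp
  qed
  have "E u w 1 x = E w u 1 x" for x
    by (simp add: E_def detcoef2_sym[of _ "hess u x"])
  then have "real ?n * (sphere_int (\<lambda>x. u x * volform h w 1 x) - sphere_int (\<lambda>x. w x * volform h u 1 x)) = 0"
    using main[OF u w] main[OF w u] by (simp add: algebra_simps)
  then show ?thesis by simp
qed

section \<open>Volume in terms of the support function\<close>

definition convex_body0 :: "(real^'n::finite) set \<Rightarrow> bool" where
  "convex_body0 M \<longleftrightarrow> compact M \<and> convex M \<and> 0 \<in> interior M"

context
  fixes M :: "(real^'n::finite) set"
  assumes M: "convex_body0 M"
begin

lemma body_props: "compact M" "convex M" "0 \<in> interior M" "0 \<in> M" "M \<noteq> {}" "bounded M" "closed M"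
  using M interior_subset by (auto simp: convex_body0_def compact_imp_bounded compact_imp_closed)

lemma supp_bdd: "bdd_above ((\<lambda>y. x \<bullet> y) ` M)"
proof -
  have "compact ((\<lambda>y. x \<bullet> y) ` M)"
    by (intro compact_continuous_image body_props continuous_intros)
  then show ?thesis by (simp add: compact_imp_bounded bounded_imp_bdd_above)
qed

lemma supp_ge: "y \<in> M \<Longrightarrow> x \<bullet> y \<le> supp M x"
  unfolding supp_def by (intro cSUP_upper supp_bdd)

lemma supp_le: "(\<And>y. y \<in> M \<Longrightarrow> x \<bullet> y \<le> c) \<Longrightarrow> supp M x \<le> c"
  unfolding supp_def by (intro cSUP_least body_props)

lemma supp_attained: obtains y where "y \<in> M" "x \<bullet> y = supp M x"
proof -
  have "continuous_on M (\<lambda>y. x \<bullet> y)" by (intro continuous_intros)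
  then obtain y where y: "y \<in> M" "\<And>z. z \<in> M \<Longrightarrow> x \<bullet> z \<le> x \<bullet> y"
    using continuous_attains_sup[OF body_props(1,5)] by blast
  then have "x \<bullet> y = supp M x"
    using supp_ge[of y x] supp_le[of x "x \<bullet> y"] by force
  then show ?thesis using that y by blast
qed

lemma supp_scale: "c \<ge> 0 \<Longrightarrow> supp M (c *\<^sub>R x) = c * supp M x"
proof -
  assume c: "c \<ge> 0"
  obtain y where y: "y \<in> M" "x \<bullet> y = supp M x"
    using supp_attained[of x] .
  obtain z where z: "z \<in> M" "(c *\<^sub>R x) \<bullet> z = supp M (c *\<^sub>R x)"
    using supp_attained[of "c *\<^sub>R x"] .
  have "(c *\<^sub>R x) \<bullet> y \<le> supp M (c *\<^sub>R x)" by (rule supp_ge[OF y(1)])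
  moreover have "c * (x \<bullet> z) \<le> c * supp M x" using supp_ge[OF z(1)] c by (intro mult_left_mono) auto
  ultimately show ?thesis using y z by simp
qed

lemma supp_subadditive: "supp M (x + y) \<le> supp M x + supp M y"
  using supp_ge by (intro supp_le) (auto simp: inner_add_left intro!: add_mono)

lemma supp_pos: assumes "x \<noteq> 0" shows "supp M x > 0"
proof -
  obtain e where e: "e > 0" "cball 0 e \<subseteq> M"
    using body_props(3) mem_interior_cball by blast
  have "(e / norm x) *\<^sub>R x \<in> M" using e assms by (intro subsetD[OF e(2)]) auto
  then have "x \<bullet> ((e / norm x) *\<^sub>R x) \<le> supp M x" by (rule supp_ge)
  moreover have "x \<bullet> ((e / norm x) *\<^sub>R x) > 0" using e assms by simp
  ultimately show ?thesis by linarith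
qed

text \<open>The function y -> h(y) - y . p is nonnegative and vanishes at x, so its derivative g - p
  there is zero.\<close>

lemma support_point_eq:
  assumes "(supp M has_derivative (\<lambda>v. g \<bullet> v)) (at x)" "p \<in> M" "x \<bullet> p = supp M x"
  shows "p = g"
proof -
  have D: "((\<lambda>y. supp M y - y \<bullet> p) has_derivative (\<lambda>v. g \<bullet> v - v \<bullet> p)) (at x)"
    by (intro has_derivative_diff assms bounded_linear_imp_has_derivative bounded_linear_inner_left)
  have "(\<lambda>v. g \<bullet> v - v \<bullet> p) = (\<lambda>v. 0)"
    by (rule differential_zero_maxmin[OF UNIV_I open_UNIV D]) (use assms supp_ge in auto)
  then have "(g - p) \<bullet> (g - p) = 0"
    by (metis inner_commute inner_diff_left)
  then show ?thesis by simp
qed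

lemma exists_outer_normal:
  assumes "p \<in> frontier M"
  obtains x where "norm x = 1" "x \<bullet> p = supp M x"
proof -
  have "p \<in> M" "p \<notin> rel_interior M"
    using assms body_props rel_interior_interior[of M] rel_interior_nonempty_interior[of M]
    by (auto simp: frontier_def)
  then obtain a where a: "a \<noteq> 0" "\<And>y. y \<in> M \<Longrightarrow> a \<bullet> p \<le> a \<bullet> y"
    using supporting_hyperplane_rel_boundary[of M p] body_props by metis
  define x where "x = - a /\<^sub>R norm a"
  have "x \<bullet> y \<le> x \<bullet> p" if "y \<in> M" for y
    unfolding x_def using a(2)[OF that] by (simp add: mult_left_mono)
  then have "supp M x \<le> x \<bullet> p" by (rule supp_le)
  then have "x \<bullet> p = supp M x" using supp_ge[OF \<open>p \<in> M\<close>, of x] by simp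
  moreover have "norm x = 1" using a by (simp add: x_def)
  ultimately show ?thesis using that by blast
qed

lemma frontier_scaled_interior:
  assumes "q \<in> interior M" "q \<noteq> 0"
  obtains p r where "p \<in> frontier M" "0 < r" "r < 1" "q = r *\<^sub>R p"
proof -
  obtain d where d: "0 < d" "0 + d *\<^sub>R q \<in> frontier M"
    using ray_to_frontier[of M 0 q] body_props assms by metis
  have "d > 1"
  proof (rule ccontr)
    assume "\<not> d > 1"
    then have "(1 - d) *\<^sub>R 0 + d *\<^sub>R q \<in> interior M"
      using d(1) body_props assms by (intro convexD[OF convex_interior]) auto
    then show False using d(2) by (simp add: frontier_def)
  qed
  then show ?thesis
    using d by (intro that[of "d *\<^sub>R q" "inverse d"]) (auto simp: inverse_less_1_iff)
qed

end

text \<open>This is what the analysis takes from \<open>K2plus\<close>, in a form that passes to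
  Minkowski sums: support functions and Hessians add, whereas a sum has no evident local defining
  function. Multiples of x are excluded from \<open>posdef\<close> because the Hessian kills
  them.\<close>

locale smooth_body =
  fixes M :: "(real^'n::finite) set"
  assumes body: "convex_body0 M" and C2: "C2_hom1 (supp M)"
    and posdef: "\<And>x v. norm x = 1 \<Longrightarrow> (\<forall>c. v \<noteq> c *\<^sub>R x) \<Longrightarrow> v \<bullet> (hess (supp M) x *v v) > 0"
begin

abbreviation "h \<equiv> supp M"

lemma grad_supp_mem: 
  assumes "x \<noteq> 0" shows "grad h x \<in> M" "x \<bullet> grad h x = h x"
  using supp_attained[OF body, of x] support_point_eq[OF body C2_off0D(1)[OF C2_hom1_C2[OF C2] assms]] by metis+

lemma grad_supp_unique: "x \<noteq> 0 \<Longrightarrow> p \<in> M \<Longrightarrow> x \<bullet> p = h x \<Longrightarrow> p = grad h x"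
  using support_point_eq[OF body C2_off0D(1)[OF C2_hom1_C2[OF C2]]] by blast

lemma hess1_posdef:
  assumes "norm x = 1" "v \<noteq> 0" shows "v \<bullet> (hess1 h x *v v) > 0"
proof -
  have x: "x \<noteq> 0" "x \<bullet> x = 1" using assms by (auto simp: norm_eq_1)
  have eq: "v \<bullet> (hess1 h x *v v) = v \<bullet> (hess h x *v v) + (x \<bullet> v)\<^sup>2"
    by (simp add: hess1_def outer_eq_dyad mult_vec_expand inner_right_distrib power2_eq_square inner_commute)
  show ?thesis
  proof (cases "\<exists>c. v = c *\<^sub>R x")
    case True
    then obtain c where c: "v = c *\<^sub>R x" by blast
    then have "hess h x *v v = 0" using hess_null[OF C2 x(1)] by (simp add: matrix_vector_mult_scaleR)
    then show ?thesis using \<open>v \<noteq> 0\<close> c x unfolding eq by simp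
  next
    case False
    then have "v \<bullet> (hess h x *v v) > 0" using posdef assms(1) by blast
    then show ?thesis unfolding eq by (meson add_pos_nonneg zero_le_power2)
  qed
qed

lemma hess1_det_pos: "norm x = 1 \<Longrightarrow> det (hess1 h x) > 0"
  by (rule det_pos_of_quadratic_form) (rule hess1_posdef)

lemma supp_detD2_pos: "norm x = 1 \<Longrightarrow> detD2 h x > 0"
  by (simp add: detD2_hess1 hess1_det_pos)

text \<open>If two normals share the support point p, subadditivity of h makes p the support point
  for every normal on the segment between them. So grad h is constant along v = x' - x, against the
  positivity of the Hessian in direction v.\<close>

lemma grad_supp_inj:
  assumes x: "norm x = 1" "norm x' = 1" and eq: "grad h x = grad h x'"
  shows "x = x'"
proof (rule ccontr)
  assume ne: "x \<noteq> x'"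
  define p where "p = grad h x"
  have nz: "x \<noteq> 0" "x' \<noteq> 0" using x by auto
  have p: "p \<in> M" "x \<bullet> p = h x" "x' \<bullet> p = h x'"
    using grad_supp_mem[OF nz(1)] grad_supp_mem[OF nz(2)] eq by (auto simp: p_def)
  have nopar: "\<forall>c. x' \<noteq> c *\<^sub>R x"
  proof (intro allI notI)
    fix c assume c: "x' = c *\<^sub>R x"
    then have "\<bar>c\<bar> = 1" using x by simp
    then have "x' = - x" using c ne by (auto simp: abs_if split: if_splits)
    \<comment> \<open>Opposite normals cannot share a support point, since h is positive off the
      origin.\<close>
    then have "h x + h x' = 0" using p by simp
    then show False using supp_pos[OF body nz(1)] supp_pos[OF body nz(2)] by linarith
  qed
  define v where "v = x' - x"
  have v: "\<forall>c. v \<noteq> c *\<^sub>R x"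
  proof (intro allI notI)
    fix c assume "v = c *\<^sub>R x"
    then have "x' = (c + 1) *\<^sub>R x" by (simp add: v_def algebra_simps)
    then show False using nopar by blast
  qed
  have const: "grad h (x + s *\<^sub>R v) = p" if s: "s \<in> {0..1}" for s
  proof -
    have seq: "x + s *\<^sub>R v = (1 - s) *\<^sub>R x + s *\<^sub>R x'" by (simp add: v_def algebra_simps)
    have "x + s *\<^sub>R v \<noteq> 0"
    proof
      assume "x + s *\<^sub>R v = 0"
      then have "s *\<^sub>R x' = (s - 1) *\<^sub>R x" unfolding seq by (simp add: algebra_simps)
      moreover have "s \<noteq> 0" using \<open>x + s *\<^sub>R v = 0\<close> nz by auto
      ultimately have "x' = ((s - 1) / s) *\<^sub>R x"
        by (metis divide_inverse_commute scaleR_scaleR left_inverse scaleR_one)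
      then show False using nopar by blast
    qed
    moreover have "h (x + s *\<^sub>R v) \<le> (1 - s) * h x + s * h x'"
      unfolding seq using supp_subadditive[OF body, of "(1 - s) *\<^sub>R x" "s *\<^sub>R x'"] s by (simp add: supp_scale[OF body])
    then have "h (x + s *\<^sub>R v) \<le> (x + s *\<^sub>R v) \<bullet> p"
      unfolding seq using p by (simp add: inner_add_left)
    then have "(x + s *\<^sub>R v) \<bullet> p = h (x + s *\<^sub>R v)"
      using supp_ge[OF body p(1), of "x + s *\<^sub>R v"] by simp
    ultimately show ?thesis
      using grad_supp_unique p(1) by metis
  qed
  \<comment> \<open>Constancy is known on [0,1] only, so the derivative at s = 0 is compared
    one-sidedly.\<close>
  have "((\<lambda>s. grad h (x + s *\<^sub>R v)) has_derivative (\<lambda>t. transpose (hess h (x + 0 *\<^sub>R v)) *v (t *\<^sub>R v))) (at 0 within cbox 0 1)"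
    by (rule has_derivative_at_withinI, rule has_derivative_compose[where f = "\<lambda>s. x + s *\<^sub>R v"])
      (auto intro!: derivative_eq_intros C2_off0D(2)[OF C2_hom1_C2[OF C2] nz(1)])
  then have "((\<lambda>s. grad h (x + s *\<^sub>R v)) has_vector_derivative (transpose (hess h x) *v v)) (at 0 within cbox 0 1)"
    by (simp add: has_vector_derivative_def matrix_vector_mult_scaleR)
  moreover have "((\<lambda>s. grad h (x + s *\<^sub>R v)) has_vector_derivative 0) (at 0 within cbox 0 1)"
    by (rule has_vector_derivative_transform[where f = "\<lambda>_. p"]) (use const in auto)
  ultimately have "transpose (hess h x) *v v = 0"
    using vector_derivative_unique_within_closed_interval[of 0 "1::real" 0] by force
  then have "v \<bullet> (hess h x *v v) = 0"
    by (metis dot_lmul_matrix transpose_matrix_vector inner_zero_left)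
  then show False using posdef[OF x(1) v] by simp
qed

theorem volume_formula: "measure lebesgue M = sphere_int (\<lambda>x. h x * detD2 h x)"
proof -
  note B = body_props[OF body]
  define \<Phi> where "\<Phi> y = norm y ^ Suc 0 *\<^sub>R grad h y" for y
  define D where "D y = norm y ^ 0 *\<^sub>R (transpose (hess h (y /\<^sub>R norm y)) + (1 + real 0) *\<^sub>R dyad (grad h (y /\<^sub>R norm y)) (y /\<^sub>R norm y))" for y
  let ?p = "\<lambda>y :: real^'n. y /\<^sub>R norm y"
  have Phi: "\<Phi> y = norm y *\<^sub>R grad h (?p y)" if "y \<noteq> 0" for y
    using that by (simp add: \<Phi>_def grad_scale[OF C2])
  have der: "(\<Phi> has_derivative (\<lambda>v. D y *v v)) (at y)" if "y \<in> punctured_ball" for y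
    unfolding \<Phi>_def D_def using that by (intro has_derivative_radial_grad[OF C2]) auto
  have detD: "\<bar>det (matrix (\<lambda>v. D y *v v))\<bar> * 1 = h (?p y) * detD2 h (?p y)" if "y \<in> punctured_ball" for y
  proof -
    define x where "x = ?p y"
    have x: "norm x = 1" "x \<noteq> 0" using that by (auto simp: x_def)
    have "transpose (transpose (hess h x)) *v x = 0"
      using hess_null[OF C2 x(2)] by (simp add: transpose_transpose)
    from det_plus_dyad_null[OF x(1) this, of "grad h x"]
    have "det (D y) = (grad h x \<bullet> x) * det (transpose (hess h x) + dyad x x)"
      by (simp add: D_def x_def)
    also have "transpose (hess h x) + dyad x x = transpose (hess h x + dyad x x)"
      by (simp add: transpose_add transpose_dyad)
    finally have "det (D y) = h x * detD2 h x"
      using x by (simp add: C2_hom1_euler[OF C2] detD2_def outer_eq_dyad)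
    moreover have "h x * detD2 h x > 0"
      using supp_pos[OF body x(2)] supp_detD2_pos[OF x(1)] by simp
    ultimately show ?thesis by (simp add: x_def)
  qed
  have inj: "inj_on \<Phi> punctured_ball"
  proof (rule inj_onI)
    \<comment> \<open>Test Phi y = Phi y' against the direction of y: one side gives |y| h, the
      other at most |y'| h. By symmetry the norms agree, and then the unit normals agree by
      \<open>grad_supp_inj\<close>.\<close>
    have le: "norm y \<le> norm y'" if "y \<noteq> 0" "y' \<noteq> 0" "\<Phi> y = \<Phi> y'" for y y'
    proof -
      have nz: "?p y \<noteq> 0" "?p y' \<noteq> 0" using that by auto
      have "norm y * h (?p y) = ?p y \<bullet> \<Phi> y"
        unfolding Phi[OF that(1)] by (simp only: inner_scaleR_right grad_supp_mem(2)[OF nz(1)])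
      also have "\<dots> = norm y' * (?p y \<bullet> grad h (?p y'))"
        unfolding that(3) Phi[OF that(2)] by simp
      also have "\<dots> \<le> norm y' * h (?p y)"
        by (intro mult_left_mono supp_ge[OF body] grad_supp_mem(1)[OF nz(2)]) auto
      finally show ?thesis using supp_pos[OF body nz(1)] by simp
    qed
    fix y y' assume y: "y \<in> punctured_ball" "y' \<in> punctured_ball" "\<Phi> y = \<Phi> y'"
    then have n: "norm y = norm y'" using le[of y y'] le[of y' y] by auto
    have nz: "y \<noteq> 0" "y' \<noteq> 0" using y by auto
    have "norm y' *\<^sub>R grad h (?p y) = norm y' *\<^sub>R grad h (?p y')"
      using y(3) unfolding Phi[OF nz(1)] Phi[OF nz(2)] n .
    then have "grad h (?p y) = grad h (?p y')"
      using nz(2) by (metis norm_eq_zero scaleR_left_imp_eq)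
    then have "?p y = ?p y'"
      by (rule grad_supp_inj[rotated 2]) (use nz in simp_all)
    then have "norm y *\<^sub>R ?p y = norm y' *\<^sub>R ?p y'" by (simp only: n)
    then show "y = y'" using nz by simp
  qed
  \<comment> \<open>A point |y| grad h(y) is a point of the body pulled towards the interior point
    0. Conversely the ray from 0 through an interior point exits at a boundary point, whose outer
    normal supplies the direction of y.\<close>
  have img: "\<Phi> ` punctured_ball = interior M - {0}"
  proof (intro equalityI subsetI)
    fix q assume "q \<in> \<Phi> ` punctured_ball"
    then obtain y where y: "y \<in> punctured_ball" "q = \<Phi> y" by blast
    then have nz: "?p y \<noteq> 0" by auto
    have q: "q = norm y *\<^sub>R grad h (?p y)" using y by (simp add: Phi)
    have "grad h (?p y) - (1 - norm y) *\<^sub>R (grad h (?p y) - 0) \<in> interior M"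
      using y by (intro mem_interior_convex_shrink B grad_supp_mem[OF nz]) auto
    then have "q \<in> interior M" by (simp add: q algebra_simps)
    moreover have "q \<noteq> 0"
      using grad_supp_mem(2)[OF nz] supp_pos[OF body nz] y q by auto
    ultimately show "q \<in> interior M - {0}" by simp
  next
    fix q assume "q \<in> interior M - {0}"
    then obtain p r where p: "p \<in> frontier M" "0 < r" "r < 1" "q = r *\<^sub>R p"
      using frontier_scaled_interior[OF body, of q] by blast
    obtain x where x: "norm x = 1" "x \<bullet> p = h x" using exists_outer_normal[OF body p(1)] by blast
    have "p \<in> M" using p(1) B by (auto simp: frontier_def)
    then have "p = grad h x" using x by (intro grad_supp_unique) auto
    moreover have "r *\<^sub>R x \<noteq> 0" using p x by auto
    ultimately have "q = \<Phi> (r *\<^sub>R x)" using p x Phi[of "r *\<^sub>R x"] by simp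
    moreover have "r *\<^sub>R x \<in> punctured_ball" using p x by auto
    ultimately show "q \<in> \<Phi> ` punctured_ball" by blast
  qed
  have conts: "continuous_on (sphere 0 1) (\<lambda>x. h x * detD2 h x)"
    unfolding detD2_hess1 by (intro continuous_intros C2_hom1_continuous_sphere C2)
  have "(\<lambda>y. \<bar>det (matrix (\<lambda>v. D y *v v))\<bar> * 1) absolutely_integrable_on punctured_ball"
    using sphere_fun_integrable(1)[OF conts, of "\<lambda>_. 1"]
    by (subst set_integrable_cong[OF refl refl detD]) auto
  then have "((\<lambda>_. 1::real) has_integral integral punctured_ball (\<lambda>y. \<bar>det (matrix (\<lambda>v. D y *v v))\<bar> * 1)) (\<Phi> ` punctured_ball)"
    by (intro change_of_variables der inj) auto
  moreover have "integral punctured_ball (\<lambda>y. \<bar>det (matrix (\<lambda>v. D y *v v))\<bar> * 1) = sphere_int (\<lambda>x. h x * detD2 h x)"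
    unfolding sphere_int_def integral_punctured[symmetric] by (rule integral_cong) (rule detD)
  ultimately have I: "((\<lambda>_. 1::real) has_integral sphere_int (\<lambda>x. h x * detD2 h x)) (interior M - {0})"
    by (simp add: img)
  have neg: "negligible {x \<in> (interior M - {0}) - M. (1::real) \<noteq> 0}"
    "negligible {x \<in> M - (interior M - {0}). (1::real) \<noteq> 0}"
  proof -
    have "{x \<in> (interior M - {0}) - M. (1::real) \<noteq> 0} = {}" using interior_subset[of M] by blast
    then show "negligible {x \<in> (interior M - {0}) - M. (1::real) \<noteq> 0}" by (simp only: negligible_empty)
    have "negligible (frontier M \<union> {0})"
      using negligible_convex_frontier[OF B(2)] by simp
    then show "negligible {x \<in> M - (interior M - {0}). (1::real) \<noteq> 0}"
      by (rule negligible_subset) (use B in \<open>auto simp: frontier_def\<close>)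
  qed
  have "((\<lambda>_. 1::real) has_integral sphere_int (\<lambda>x. h x * detD2 h x)) M"
    using I has_integral_spike_set_eq[where f = "\<lambda>_. 1::real", OF neg] by blast
  then show ?thesis
    using lmeasure_integral[of M] lmeasurable_compact[OF B(1)] by (simp add: integral_unique)
qed

end

section \<open>Regularity of the support function\<close>

text \<open>A left inverse L of A gives the candidate derivative L o B. The error in linearising f
  is small relative to |X x - X x0|, so X is first shown to satisfy a Lipschitz bound at x0; the
  same estimate with smaller constants then gives differentiability.\<close>

lemma has_derivative_of_implicit:
  fixes X :: "'a::real_normed_vector \<Rightarrow> 'b::euclidean_space" and f :: "'b \<Rightarrow> 'c::euclidean_space"
  assumes cont: "continuous (at x0) X"
    and f: "(f has_derivative A) (at (X x0))" and inj: "inj A"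
    and \<phi>: "(\<phi> has_derivative B) (at x0)"
    and ev: "eventually (\<lambda>x. f (X x) = \<phi> x) (at x0)" and eq0: "f (X x0) = \<phi> x0"
  shows "\<exists>D. (X has_derivative D) (at x0)"
proof -
  have linA: "linear A" using f has_derivative_linear by blast
  then obtain L where L: "linear L" "L \<circ> A = id"
    using inj linear_injective_left_inverse by blast
  have blL: "bounded_linear L" using L linear_linear by blast
  obtain c where c: "c > 0" "\<And>u. norm (L u) \<le> norm u * c"
    using bounded_linear.pos_bounded[OF blL] by blast
  have blB: "bounded_linear B" using \<phi> has_derivative_bounded_linear by blast
  obtain b where b: "b > 0" "\<And>u. norm (B u) \<le> norm u * b"
    using bounded_linear.pos_bounded[OF blB] by blast
  have X: "\<exists>d>0. \<forall>x. norm (x - x0) < d \<longrightarrow> norm (X x - X x0) < e" if "e > 0" for e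
    using cont that by (auto simp: continuous_at_eps_delta dist_norm)
  have ev': "\<exists>d>0. \<forall>x. norm (x - x0) < d \<longrightarrow> f (X x) = \<phi> x"
    using ev eq0 unfolding eventually_at dist_norm by (metis UNIV_I)
  have est: "\<exists>d>0. \<forall>x. norm (x - x0) < d \<longrightarrow>
      norm (X x - X x0 - L (B (x - x0))) \<le> c * (e2 * norm (x - x0) + e1 * norm (X x - X x0))"
    if "e1 > 0" "e2 > 0" for e1 e2
  proof -
    obtain d1 where d1: "d1 > 0" "\<And>q. norm (q - X x0) < d1 \<Longrightarrow> norm (f q - f (X x0) - A (q - X x0)) \<le> e1 * norm (q - X x0)"
      using f \<open>e1 > 0\<close> unfolding has_derivative_at_alt by blast
    obtain d2 where d2: "d2 > 0" "\<And>x. norm (x - x0) < d2 \<Longrightarrow> norm (\<phi> x - \<phi> x0 - B (x - x0)) \<le> e2 * norm (x - x0)"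
      using \<phi> \<open>e2 > 0\<close> unfolding has_derivative_at_alt by blast
    obtain d3 where d3: "d3 > 0" "\<And>x. norm (x - x0) < d3 \<Longrightarrow> norm (X x - X x0) < d1"
      using X[OF d1(1)] by blast
    obtain d4 where d4: "d4 > 0" "\<And>x. norm (x - x0) < d4 \<Longrightarrow> f (X x) = \<phi> x"
      using ev' by blast
    have "norm (X x - X x0 - L (B (x - x0))) \<le> c * (e2 * norm (x - x0) + e1 * norm (X x - X x0))"
      if x: "norm (x - x0) < min d2 (min d3 d4)" for x
    proof -
      let ?v = "A (X x - X x0) - B (x - x0)"
      have "X x - X x0 = L (A (X x - X x0))"
        using L(2) by (metis comp_apply id_apply)
      then have "X x - X x0 - L (B (x - x0)) = L ?v"
        by (simp add: linear_diff[OF L(1)])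
      also have "norm (L ?v) \<le> norm ?v * c" by (rule c)
      also have "norm ?v \<le> e2 * norm (x - x0) + e1 * norm (X x - X x0)"
      proof -
        have "?v = (\<phi> x - \<phi> x0 - B (x - x0)) - (f (X x) - f (X x0) - A (X x - X x0))"
          using d4(2)[of x] x eq0 by simp
        then have "norm ?v \<le> norm (\<phi> x - \<phi> x0 - B (x - x0)) + norm (f (X x) - f (X x0) - A (X x - X x0))"
          using norm_triangle_ineq4 by metis
        also have "\<dots> \<le> e2 * norm (x - x0) + e1 * norm (X x - X x0)"
          using x by (intro add_mono d2(2) d1(2) d3(2)) auto
        finally show ?thesis .
      qed
      finally show ?thesis using c(1) by (simp add: mult.commute mult_left_mono)
    qed
    then show ?thesis using d2(1) d3(1) d4(1) by (intro exI[of _ "min d2 (min d3 d4)"]) auto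
  qed
  \<comment> \<open>Twice c (b + 1): half of |X x - X x0| is absorbed on the left by taking e1 =
    1/(2c), and L o B is bounded by b c.\<close>
  define C where "C = 2 * c * (b + 1)"
  have C: "C > 0" using c b by (simp add: C_def)
  obtain d where d: "d > 0" "\<And>x. norm (x - x0) < d \<Longrightarrow> norm (X x - X x0) \<le> C * norm (x - x0)"
  proof -
    obtain d where d: "d > 0" "\<And>x. norm (x - x0) < d \<Longrightarrow>
       norm (X x - X x0 - L (B (x - x0))) \<le> c * (1 * norm (x - x0) + (1 / (2 * c)) * norm (X x - X x0))"
      using est[of "1 / (2 * c)" 1] c(1) by auto
    have "norm (X x - X x0) \<le> C * norm (x - x0)" if "norm (x - x0) < d" for x
    proof -
      have "norm (X x - X x0) \<le> norm (X x - X x0 - L (B (x - x0))) + norm (L (B (x - x0)))"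
        using norm_triangle_ineq[of "X x - X x0 - L (B (x - x0))" "L (B (x - x0))"] by simp
      moreover have "norm (L (B (x - x0))) \<le> (norm (x - x0) * b) * c"
        using c b by (meson mult_right_mono order_trans less_imp_le)
      moreover have "c * (1 * norm (x - x0) + (1 / (2 * c)) * norm (X x - X x0)) = c * norm (x - x0) + norm (X x - X x0) / 2"
        using c(1) by (simp add: field_simps)
      ultimately have "norm (X x - X x0) / 2 \<le> c * norm (x - x0) + norm (x - x0) * b * c"
        using d(2)[OF that] by linarith
      then show ?thesis by (simp add: C_def algebra_simps)
    qed
    then show ?thesis using that d(1) by blast
  qed
  have "(X has_derivative (\<lambda>v. L (B v))) (at x0)"
    unfolding has_derivative_at_alt
  proof (intro conjI allI impI)
    show "bounded_linear (\<lambda>v. L (B v))" using bounded_linear_compose[OF blL blB] .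
    fix e :: real assume "e > 0"
    \<comment> \<open>With these values the two error terms contribute e/2 each, once |X x - X x0|
      is bounded by C |x - x0|.\<close>
    define e1 where "e1 = e / (2 * c * C)"
    define e2 where "e2 = e / (2 * c)"
    have e12: "e1 > 0" "e2 > 0" using \<open>e > 0\<close> c C by (auto simp: e1_def e2_def)
    obtain d' where d': "d' > 0" "\<And>x. norm (x - x0) < d' \<Longrightarrow>
       norm (X x - X x0 - L (B (x - x0))) \<le> c * (e2 * norm (x - x0) + e1 * norm (X x - X x0))"
      using est[OF e12] by blast
    have "norm (X x - X x0 - L (B (x - x0))) \<le> e * norm (x - x0)" if x: "norm (x - x0) < min d d'" for x
    proof -
      have "norm (X x - X x0 - L (B (x - x0))) \<le> c * (e2 * norm (x - x0) + e1 * norm (X x - X x0))"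
        using d'(2)[of x] x by simp
      also have "\<dots> \<le> c * (e2 * norm (x - x0) + e1 * (C * norm (x - x0)))"
        using d(2)[of x] x c e12 by (intro mult_left_mono add_mono) auto
      also have "\<dots> = e * norm (x - x0)"
        using c C by (simp add: e1_def e2_def field_simps)
      finally show ?thesis .
    qed
    then show "\<exists>d>0. \<forall>y. norm (y - x0) < d \<longrightarrow> norm (X y - X x0 - L (B (y - x0))) \<le> e * norm (y - x0)"
      using d(1) d'(1) by (intro exI[of _ "min d d'"]) auto
  qed
  then show ?thesis by blast
qed

section \<open>Boundary charts: outer normals, strict convexity and the polar map\<close>

locale local_boundary =
  fixes K U :: "(real^'n::finite) set" and g :: "real^'n \<Rightarrow> real"
    and G :: "real^'n \<Rightarrow> real^'n" and H :: "real^'n \<Rightarrow> real^'n^'n"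
  assumes body: "convex_body0 K" and op: "open U"
    and der_g: "\<And>q. q \<in> U \<Longrightarrow> (g has_derivative (\<lambda>v. G q \<bullet> v)) (at q)"
    and der_G: "\<And>q. q \<in> U \<Longrightarrow> (G has_derivative (\<lambda>v. H q *v v)) (at q)"
    and G_nz: "\<And>q. q \<in> U \<Longrightarrow> G q \<noteq> 0"
    and cont_H: "continuous_on U H"
    and KU: "K \<inter> U = {q \<in> U. g q \<le> 0}"
    and curv: "\<And>q v. q \<in> U \<Longrightarrow> q \<in> frontier K \<Longrightarrow> v \<noteq> 0 \<Longrightarrow> v \<bullet> G q = 0 \<Longrightarrow> v \<bullet> (H q *v v) > 0"
begin

lemma g_zero: assumes "q \<in> U" "q \<in> frontier K" shows "g q = 0"
proof (rule ccontr)
  assume "g q \<noteq> 0"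
  have "q \<in> K" using assms body_props[OF body] by (auto simp: frontier_def)
  then have "g q < 0" using KU assms \<open>g q \<noteq> 0\<close> by force
  have "continuous_on U g"
    using der_g by (intro continuous_at_imp_continuous_on) (auto intro: has_derivative_continuous)
  then have "open (U \<inter> g -` {..<0})"
    by (intro continuous_open_preimage op) auto
  moreover have "U \<inter> g -` {..<0} \<subseteq> K" using KU by force
  ultimately have "q \<in> interior K"
    using \<open>g q < 0\<close> assms(1) by (meson IntI interior_maximal lessThan_iff subsetD vimageI)
  then show False using assms(2) by (simp add: frontier_def)
qed

lemma segment_in_U:
  assumes "q \<in> U" obtains e where "e > 0" "\<And>t. \<bar>t\<bar> < e \<Longrightarrow> q + t *\<^sub>R v \<in> U"
proof -
  obtain r where r: "r > 0" "ball q r \<subseteq> U" using op assms open_contains_ball by blast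
  have "q + t *\<^sub>R v \<in> U" if "\<bar>t\<bar> < r / (norm v + 1)" for t
  proof -
    have "\<bar>t\<bar> * norm v \<le> \<bar>t\<bar> * (norm v + 1)" by (simp add: mult_left_mono)
    also have "\<dots> < r" using that by (simp add: pos_less_divide_eq add_nonneg_pos)
    finally have "q + t *\<^sub>R v \<in> ball q r" by (simp add: dist_norm)
    then show ?thesis using r by blast
  qed
  then show ?thesis using that[of "r / (norm v + 1)"] r by (simp add: add_nonneg_pos)
qed

lemma deriv_along:
  assumes "q + t *\<^sub>R v \<in> U"
  shows "((\<lambda>t. g (q + t *\<^sub>R v)) has_real_derivative G (q + t *\<^sub>R v) \<bullet> v) (at t)"
    "((\<lambda>t. G (q + t *\<^sub>R v) \<bullet> v) has_real_derivative v \<bullet> (H (q + t *\<^sub>R v) *v v)) (at t)"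
proof -
  have 0: "((\<lambda>t. q + t *\<^sub>R v) has_derivative (\<lambda>s. s *\<^sub>R v)) (at t)"
    by (auto intro!: derivative_eq_intros)
  have "((\<lambda>t. g (q + t *\<^sub>R v)) has_derivative (\<lambda>s. G (q + t *\<^sub>R v) \<bullet> (s *\<^sub>R v))) (at t)"
    by (rule has_derivative_compose[OF 0 der_g[OF assms]])
  then show "((\<lambda>t. g (q + t *\<^sub>R v)) has_real_derivative G (q + t *\<^sub>R v) \<bullet> v) (at t)"
    by (simp add: has_field_derivative_def mult.commute[of _ "G (q + t *\<^sub>R v) \<bullet> v"])
  have "((\<lambda>t. G (q + t *\<^sub>R v)) has_derivative (\<lambda>s. H (q + t *\<^sub>R v) *v (s *\<^sub>R v))) (at t)"
    by (rule has_derivative_compose[OF 0 der_G[OF assms]])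
  then have "((\<lambda>t. G (q + t *\<^sub>R v) \<bullet> v) has_derivative (\<lambda>s. (H (q + t *\<^sub>R v) *v (s *\<^sub>R v)) \<bullet> v)) (at t)"
    by (rule has_derivative_inner_left)
  then show "((\<lambda>t. G (q + t *\<^sub>R v) \<bullet> v) has_real_derivative v \<bullet> (H (q + t *\<^sub>R v) *v v)) (at t)"
    by (simp add: has_field_derivative_def matrix_vector_mult_scaleR inner_commute[of v] mult.commute[of _ "_ \<bullet> v"])
qed

text \<open>Directions v with G . v < 0 lead into K, hence satisfy x . v <= 0. Testing with v = w -
  e G, where w is the part of x orthogonal to G, gives w . w <= e (x . G) for every e > 0, so w =
  0.\<close>

lemma normal_parallel:
  assumes q: "q \<in> U" "q \<in> frontier K" and x: "x \<noteq> 0" "x \<bullet> q = supp K x"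
  obtains l where "l > 0" "G q = l *\<^sub>R x"
proof -
  have tangent: "x \<bullet> v \<le> 0" if v: "G q \<bullet> v < 0" for v
  proof -
    obtain e where e: "e > 0" "\<And>t. \<bar>t\<bar> < e \<Longrightarrow> q + t *\<^sub>R v \<in> U" using segment_in_U[OF q(1)] by blast
    have "((\<lambda>t. g (q + t *\<^sub>R v)) has_real_derivative G (q + 0 *\<^sub>R v) \<bullet> v) (at 0)"
      using q by (intro deriv_along) simp
    then obtain d where d: "d > 0" "\<And>t. 0 < t \<Longrightarrow> t < d \<Longrightarrow> g (q + t *\<^sub>R v) < g q"
      using DERIV_neg_dec_right[of "\<lambda>t. g (q + t *\<^sub>R v)" _ 0] v by auto
    define t where "t = min d e / 2"
    have t: "0 < t" "t < d" "t < e" using d e by (auto simp: t_def)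
    have "q + t *\<^sub>R v \<in> U" "g (q + t *\<^sub>R v) \<le> 0"
      using d(2)[OF t(1,2)] e(2)[of t] t g_zero[OF q] by simp_all
    then have "q + t *\<^sub>R v \<in> K"
      using KU by blast
    then have "x \<bullet> (q + t *\<^sub>R v) \<le> x \<bullet> q" unfolding x(2) by (rule supp_ge[OF body])
    then show ?thesis using t(1) by (simp add: inner_right_distrib mult_le_0_iff)
  qed
  define c where "c = (x \<bullet> G q) / (G q \<bullet> G q)"
  define w where "w = x - c *\<^sub>R G q"
  have GG: "G q \<bullet> G q > 0" using G_nz[OF q(1)] by simp
  have wG: "G q \<bullet> w = 0" using GG by (simp add: w_def c_def inner_diff_right inner_commute)
  have xw: "x \<bullet> w = w \<bullet> w"
    using wG by (simp add: w_def inner_diff_left inner_diff_right inner_commute)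
  have pos: "x \<bullet> G q \<ge> 0" using tangent[of "- G q"] GG by simp
  have small: "w \<bullet> w \<le> e * (x \<bullet> G q)" if "e > 0" for e
  proof -
    have "G q \<bullet> (w - e *\<^sub>R G q) < 0" using wG GG that by (simp add: inner_diff_right)
    from tangent[OF this] show ?thesis using xw by (simp add: inner_diff_right)
  qed
  have "w \<bullet> w \<le> 0 + e" if "e > 0" for e
  proof -
    have "w \<bullet> w \<le> e / (x \<bullet> G q + 1) * (x \<bullet> G q)"
      using that pos by (intro small divide_pos_pos) auto
    also have "\<dots> \<le> e" using pos that by (simp add: field_simps)
    finally show ?thesis by simp
  qed
  then have "w \<bullet> w \<le> 0" by (rule field_le_epsilon)
  then have "w = 0" by (metis inner_ge_zero inner_eq_zero_iff order_antisym)
  then have xc: "x = c *\<^sub>R G q" by (simp add: w_def)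
  then have "c \<noteq> 0" using x by auto
  moreover have "c \<ge> 0" using pos GG by (simp add: c_def)
  ultimately show ?thesis
    using that[of "inverse c"] xc by simp
qed

text \<open>A second support point p' would make v = p' - p tangent at p. The curvature condition
  makes g strictly increase from 0 along v, while convexity keeps the segment inside K, where g <=
  0.\<close>

lemma support_point_unique:
  assumes p: "p \<in> U" "p \<in> frontier K" and x: "x \<noteq> 0" "x \<bullet> p = supp K x"
    and p': "p' \<in> K" "x \<bullet> p' = supp K x"
  shows "p' = p"
proof (rule ccontr)
  assume "p' \<noteq> p"
  define v where "v = p' - p"
  have v: "v \<noteq> 0" "x \<bullet> v = 0" using \<open>p' \<noteq> p\<close> x p' by (auto simp: v_def inner_diff_right)
  obtain l where l: "l > 0" "G p = l *\<^sub>R x" using normal_parallel[OF p x] by blast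
  then have "v \<bullet> G p = 0" using v by (simp add: inner_commute)
  then have curvp: "v \<bullet> (H p *v v) > 0" using curv[OF p v(1)] by simp
  have "((\<lambda>t. G (p + t *\<^sub>R v) \<bullet> v) has_real_derivative v \<bullet> (H (p + 0 *\<^sub>R v) *v v)) (at 0)"
    using p by (intro deriv_along) simp
  then obtain d where d: "d > 0" "\<And>t. 0 < t \<Longrightarrow> t < d \<Longrightarrow> 0 < G (p + t *\<^sub>R v) \<bullet> v"
    using DERIV_pos_inc_right[of "\<lambda>t. G (p + t *\<^sub>R v) \<bullet> v" _ 0] curvp \<open>v \<bullet> G p = 0\<close> by (auto simp: inner_commute)
  obtain e where e: "e > 0" "\<And>t. \<bar>t\<bar> < e \<Longrightarrow> p + t *\<^sub>R v \<in> U" using segment_in_U[OF p(1)] by blast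
  define t where "t = min 1 (min d e) / 2"
  have t: "0 < t" "t < d" "t < e" "t < 1" using d e by (auto simp: t_def)
  have "g (p + 0 *\<^sub>R v) < g (p + t *\<^sub>R v)"
  proof (rule DERIV_pos_imp_increasing_open[OF t(1)])
    fix s assume s: "0 < s" "s < t"
    then show "\<exists>y. ((\<lambda>t. g (p + t *\<^sub>R v)) has_real_derivative y) (at s) \<and> 0 < y"
      using deriv_along(1)[OF e(2), of s] d(2)[of s] t by auto
  next
    have "\<forall>s\<in>{0..t}. isCont (\<lambda>t. g (p + t *\<^sub>R v)) s"
    proof
      fix s assume "s \<in> {0..t}"
      then have "\<bar>s\<bar> < e" using t by auto
      then show "isCont (\<lambda>t. g (p + t *\<^sub>R v)) s"
        by (intro DERIV_isCont[OF deriv_along(1)[OF e(2)]])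
    qed
    then show "continuous_on {0..t} (\<lambda>t. g (p + t *\<^sub>R v))"
      by (simp add: continuous_at_imp_continuous_on)
  qed
  then have pos: "g (p + t *\<^sub>R v) > 0" using g_zero[OF p] by simp
  have "p \<in> K" using p body_props[OF body] by (auto simp: frontier_def)
  then have "(1 - t) *\<^sub>R p + t *\<^sub>R p' \<in> K"
    using t p' body_props[OF body] by (intro convexD) auto
  moreover have "(1 - t) *\<^sub>R p + t *\<^sub>R p' = p + t *\<^sub>R v" by (simp add: v_def algebra_simps)
  ultimately have "g (p + t *\<^sub>R v) \<le> 0" using e(2)[of t] t KU by auto
  then show False using pos by simp
qed

text \<open>The quotient cancels the unknown factor between G q and the outer normal, which depends
  on the choice of g. At a boundary point the value is the dual point on the boundary of the polar
  body.\<close>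

definition T :: "real^'n \<Rightarrow> real^'n" where "T q = inverse (q \<bullet> G q) *\<^sub>R G q"

definition DT :: "real^'n \<Rightarrow> real^'n^'n" where
  "DT q = inverse (q \<bullet> G q) *\<^sub>R H q - (inverse (q \<bullet> G q))\<^sup>2 *\<^sub>R dyad (G q) (G q + transpose (H q) *v q)"

lemma T_has_derivative:
  assumes "q \<in> U" "q \<bullet> G q \<noteq> 0"
  shows "(T has_derivative (\<lambda>v. DT q *v v)) (at q)"
proof -
  have 1: "((\<lambda>q. q \<bullet> G q) has_derivative (\<lambda>v. q \<bullet> (H q *v v) + v \<bullet> G q)) (at q)"
    by (rule has_derivative_inner[OF has_derivative_ident der_G[OF assms(1)]])
  have tr: "(transpose (H q) *v q) \<bullet> v = q \<bullet> (H q *v v)" for v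
    by (metis dot_lmul_matrix transpose_matrix_vector)
  have minus: "(A - B) *v v = A *v v - B *v v" for A B :: "real^'n^'n" and v
    by (metis matrix_vector_mult_diff_rdistrib)
  show ?thesis
    unfolding T_def[abs_def]
    by (rule has_derivative_eq_rhs, rule has_derivative_scaleR[OF Deriv.has_derivative_inverse[OF assms(2) 1] der_G[OF assms(1)]])
      (simp add: DT_def fun_eq_iff minus mult_vec_expand inner_left_distrib tr power2_eq_square algebra_simps inner_commute[of _ "G q"])
qed

text \<open>The first identity is the derivative of T q . q = 1. It forces kernel vectors of DT to
  be tangent, and on tangent vectors the second identifies the quadratic form with that of H up to
  the factor 1 / (q . G q). Together they make DT injective where the curvature is positive.\<close>

lemma DT_quadratic:
  assumes "q \<bullet> G q \<noteq> 0"
  shows "(DT q *v v) \<bullet> q = - (v \<bullet> G q) / (q \<bullet> G q)"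
    "v \<bullet> G q = 0 \<Longrightarrow> v \<bullet> (DT q *v v) = (v \<bullet> (H q *v v)) / (q \<bullet> G q)"
proof -
  have tr: "(transpose (H q) *v q) \<bullet> v = q \<bullet> (H q *v v)" for v
    by (metis dot_lmul_matrix transpose_matrix_vector)
  have "DT q *v v = inverse (q \<bullet> G q) *\<^sub>R (H q *v v) - ((inverse (q \<bullet> G q))\<^sup>2 * (v \<bullet> G q + q \<bullet> (H q *v v))) *\<^sub>R G q"
    by (simp add: DT_def matrix_vector_mult_diff_rdistrib mult_vec_expand inner_left_distrib tr inner_commute[of "G q"])
  note eq = this
  show "(DT q *v v) \<bullet> q = - (v \<bullet> G q) / (q \<bullet> G q)"
    unfolding eq using assms
    by (simp add: inner_diff_left inner_commute[of "G q" q] inner_commute[of "H q *v v" q] power2_eq_square field_simps)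
  show "v \<bullet> G q = 0 \<Longrightarrow> v \<bullet> (DT q *v v) = (v \<bullet> (H q *v v)) / (q \<bullet> G q)"
    unfolding eq by (simp add: inner_diff_right divide_inverse mult.commute)
qed

lemma continuous_on_DT: "continuous_on (U \<inter> {q. q \<bullet> G q \<noteq> 0}) DT"
proof -
  have "continuous_on U G"
    using der_G by (intro continuous_at_imp_continuous_on) (auto intro: has_derivative_continuous)
  then have c: "continuous_on (U \<inter> {q. q \<bullet> G q \<noteq> 0}) G" "continuous_on (U \<inter> {q. q \<bullet> G q \<noteq> 0}) H"
    using cont_H by (auto intro: continuous_on_subset)
  have mv: "continuous_on S (\<lambda>q. A q *v b q)" if "continuous_on S A" "continuous_on S b"
    for A :: "real^'n \<Rightarrow> real^'n^'n" and b and S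
    unfolding matrix_vector_mult_def by (intro continuous_intros that)
  show ?thesis
    unfolding DT_def[abs_def] by (intro continuous_intros c mv) auto
qed

end

section \<open>Differentiability of the support point map\<close>

lemma support_point_frontier:
  assumes K: "convex_body0 K" and p: "p \<in> K" "x \<noteq> 0" "x \<bullet> p = supp K x"
  shows "p \<in> frontier K"
proof (rule ccontr)
  assume "p \<notin> frontier K"
  then have "p \<in> interior K" using p closure_subset by (auto simp: frontier_def)
  then obtain e where e: "e > 0" "cball p e \<subseteq> K" using mem_interior_cball by blast
  have "p + (e / norm x) *\<^sub>R x \<in> K" using e p by (intro subsetD[OF e(2)]) (auto simp: dist_norm)
  then have "x \<bullet> (p + (e / norm x) *\<^sub>R x) \<le> supp K x" by (rule supp_ge[OF K])
  moreover have "x \<bullet> ((e / norm x) *\<^sub>R x) > 0" using e p by simp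
  ultimately show False using p by (simp add: inner_right_distrib)
qed

locale K2plus_body =
  fixes K :: "(real^'n::finite) set"
  assumes K2: "K2plus K"
begin

lemma body: "convex_body0 K"
  using K2 by (simp add: K2plus_def convex_body0_def)

lemma local_boundary_exists:
  assumes "p \<in> frontier K"
  obtains U g G H where "p \<in> U" "local_boundary K U g G H"
proof -
  obtain U g G H where *: "open U" "p \<in> U"
        "(\<forall>q\<in>U. (g has_derivative (\<lambda>v. G q \<bullet> v)) (at q) \<and>
                (G has_derivative (\<lambda>v. H q *v v)) (at q) \<and> G q \<noteq> 0)"
        "continuous_on U H"
        "K \<inter> U = {q\<in>U. g q \<le> 0}"
        "(\<forall>q\<in>U \<inter> frontier K. \<forall>v. v \<noteq> 0 \<and> v \<bullet> G q = 0 \<longrightarrow> v \<bullet> (H q *v v) > 0)"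
    using K2[unfolded K2plus_def, THEN conjunct2, THEN conjunct2, THEN conjunct2, THEN bspec, OF assms]
    by (elim exE conjE) (rule that)
  have "local_boundary K U g G H"
    by (rule local_boundary.intro[OF body *(1) _ _ _ *(4,5)]) (simp_all add: *(3,6))
  then show ?thesis by (rule that[OF *(2)])
qed

definition X :: "real^'n \<Rightarrow> real^'n" where "X x = (SOME p. p \<in> K \<and> x \<bullet> p = supp K x)"

lemma X: "X x \<in> K" "x \<bullet> X x = supp K x"
proof -
  have "\<exists>p. p \<in> K \<and> x \<bullet> p = supp K x" using supp_attained[OF body] by metis
  from someI_ex[OF this] show "X x \<in> K" "x \<bullet> X x = supp K x" by (auto simp: X_def)
qed

lemma X_frontier: "x \<noteq> 0 \<Longrightarrow> X x \<in> frontier K"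
  using support_point_frontier[OF body X(1) _ X(2)] .

lemma X_unique:
  assumes "x \<noteq> 0" "p \<in> K" "x \<bullet> p = supp K x"
  shows "p = X x"
proof -
  obtain U g G H where "X x \<in> U" "local_boundary K U g G H"
    using local_boundary_exists[OF X_frontier[OF assms(1)]] .
  then show ?thesis
    using local_boundary.support_point_unique[of K U g G H "X x" x p] X_frontier X assms by blast
qed

text \<open>Off a ball around X x the functional x stays below h(x) by a fixed gap, by compactness
  and uniqueness of the support point; a small change of x cannot bridge the gap.\<close>

lemma X_continuous:
  assumes "x \<noteq> 0" shows "continuous (at x) X"
  unfolding continuous_at_eps_delta
proof (intro allI impI)
  fix e :: real assume "e > 0"
  obtain R where R: "R > 0" "\<And>y. y \<in> K \<Longrightarrow> norm y \<le> R"
    using body_props(6)[OF body] bounded_pos by blast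
  have "\<exists>m < supp K x. \<forall>y\<in>K - ball (X x) e. x \<bullet> y \<le> m"
  proof (cases "K - ball (X x) e = {}")
    case True
    then show ?thesis by (intro exI[of _ "supp K x - 1"]) auto
  next
    case False
    have c1: "compact (K - ball (X x) e)"
      using body_props(1)[OF body] by (simp add: compact_diff)
    have c2: "continuous_on (K - ball (X x) e) (\<lambda>y. x \<bullet> y)"
      by (intro continuous_intros)
    obtain y where y: "y \<in> K - ball (X x) e" "\<And>z. z \<in> K - ball (X x) e \<Longrightarrow> x \<bullet> z \<le> x \<bullet> y"
      using continuous_attains_sup[OF c1 False c2] by blast
    have "x \<bullet> y \<noteq> supp K x"
      using X_unique[OF assms, of y] y(1) \<open>e > 0\<close> by auto
    then have "x \<bullet> y < supp K x" using supp_ge[OF body, of y x] y(1) by force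
    then show ?thesis using y(2) by blast
  qed
  then obtain m where m: "m < supp K x" "\<And>y. y \<in> K - ball (X x) e \<Longrightarrow> x \<bullet> y \<le> m" by blast
  \<comment> \<open>R bounds K, so moving x by less than d changes each inner product with a point
    of K by less than half the gap.\<close>
  define d where "d = (supp K x - m) / (2 * R)"
  have d: "d > 0" using m R by (simp add: d_def)
  have "dist (X x') (X x) < e" if x': "dist x' x < d" for x'
  proof (rule ccontr)
    assume "\<not> dist (X x') (X x) < e"
    then have "X x' \<in> K - ball (X x) e" using X by (auto simp: dist_commute)
    then have 1: "x \<bullet> X x' \<le> m" by (rule m)
    have cs: "\<bar>(x' - x) \<bullet> y\<bar> < (supp K x - m) / 2" if "y \<in> K" for y
    proof -
      have "\<bar>(x' - x) \<bullet> y\<bar> \<le> norm (x' - x) * R"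
        using Cauchy_Schwarz_ineq2[of "x' - x" y] R(2)[OF that] by (meson mult_left_mono norm_ge_zero order_trans)
      also have "\<dots> < d * R" using x' R by (simp add: dist_norm)
      also have "\<dots> = (supp K x - m) / 2" using R by (simp add: d_def)
      finally show ?thesis .
    qed
    have "x' \<bullet> X x \<le> x' \<bullet> X x'" using supp_ge[OF body X(1), of x'] X(2)[of x'] by simp
    moreover have "x' \<bullet> y = x \<bullet> y + (x' - x) \<bullet> y" for y by (simp add: inner_diff_left)
    ultimately have "supp K x + (x' - x) \<bullet> X x \<le> m + (x' - x) \<bullet> X x'"
      using 1 X(2)[of x] by (metis add_le_cancel_right order_trans)
    then show False
      using cs[OF X(1)[of x]] cs[OF X(1)[of x']] unfolding abs_less_iff by argo
  qed
  then show "\<exists>d>0. \<forall>x'. dist x' x < d \<longrightarrow> dist (X x') (X x) < e"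
    using d by blast
qed

text \<open>The support inequalities at x and at y squeeze the remainder between 0 and (y - x) . (X
  y - X x), so continuity of X already gives differentiability of h.\<close>

lemma supp_has_derivative:
  assumes "x \<noteq> 0"
  shows "(supp K has_derivative (\<lambda>v. X x \<bullet> v)) (at x)"
  unfolding has_derivative_at_alt
proof (intro conjI allI impI)
  show "bounded_linear (\<lambda>v. X x \<bullet> v)" by (rule bounded_linear_inner_right)
  fix e :: real assume "e > 0"
  then obtain d where d: "d > 0" "\<And>x'. dist x' x < d \<Longrightarrow> dist (X x') (X x) < e"
    using X_continuous[OF assms] unfolding continuous_at_eps_delta by blast
  have "norm (supp K y - supp K x - X x \<bullet> (y - x)) \<le> e * norm (y - x)" if y: "norm (y - x) < d" for y
  proof -
    have eq: "supp K y - supp K x - X x \<bullet> (y - x) = y \<bullet> X y - y \<bullet> X x"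
      unfolding X(2)[symmetric] inner_diff_right inner_commute[of "X x"] by simp
    have "y \<bullet> X x \<le> y \<bullet> X y" using supp_ge[OF body X(1), of y] X(2)[of y] by simp
    moreover have "x \<bullet> X y \<le> x \<bullet> X x" using supp_ge[OF body X(1), of x] X(2)[of x] by simp
    ultimately have "norm (y \<bullet> X y - y \<bullet> X x) \<le> (y - x) \<bullet> (X y - X x)"
      by (simp add: inner_diff_left inner_diff_right)
    also have "\<dots> \<le> norm (y - x) * norm (X y - X x)" by (rule norm_cauchy_schwarz)
    also have "\<dots> \<le> norm (y - x) * e"
      using d(2)[of y] y by (intro mult_left_mono) (auto simp: dist_norm)
    finally show ?thesis by (simp add: eq mult.commute)
  qed
  then show "\<exists>d>0. \<forall>y. norm (y - x) < d \<longrightarrow> norm (supp K y - supp K x - X x \<bullet> (y - x)) \<le> e * norm (y - x)"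
    using d(1) by blast
qed

definition B :: "real^'n \<Rightarrow> real^'n^'n" where
  "B x = inverse (supp K x) *\<^sub>R mat 1 - (inverse (supp K x))\<^sup>2 *\<^sub>R dyad x (X x)"

lemma normalized_has_derivative:
  assumes "x \<noteq> 0"
  shows "((\<lambda>x. inverse (supp K x) *\<^sub>R x) has_derivative (\<lambda>v. B x *v v)) (at x)"
proof -
  have "supp K x \<noteq> 0" using supp_pos[OF body assms] by simp
  show ?thesis
    by (rule has_derivative_eq_rhs, rule has_derivative_scaleR[OF Deriv.has_derivative_inverse[OF \<open>supp K x \<noteq> 0\<close>
          supp_has_derivative[OF assms]] has_derivative_ident])
      (simp add: B_def fun_eq_iff matrix_vector_mult_diff_rdistrib mult_vec_expand power2_eq_square algebra_simps)
qed

text \<open>Near a given point, \<open>T q = G q / \<langle>q, G q\<rangle>\<close> sends the support point in direction x to \<open>x / h x\<close>.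
  Its derivative is injective by the curvature assumption, so X inherits differentiability.\<close>

lemma X_local:
  assumes x0: "x0 \<noteq> 0"
  obtains V A where "open V" "x0 \<in> V" "0 \<notin> V" "continuous_on V A"
    "\<And>x. x \<in> V \<Longrightarrow> inj ((*v) (A x))"
    "\<And>x. x \<in> V \<Longrightarrow> \<exists>D. (X has_derivative D) (at x)"
    "\<And>x D w. x \<in> V \<Longrightarrow> (X has_derivative D) (at x) \<Longrightarrow> A x *v D w = B x *v w"
    "\<And>x D w. x \<in> V \<Longrightarrow> norm x = 1 \<Longrightarrow> (\<forall>c. w \<noteq> c *\<^sub>R x) \<Longrightarrow> (X has_derivative D) (at x) \<Longrightarrow> w \<bullet> D w > 0"
proof -
  obtain U g G H where U: "X x0 \<in> U" "local_boundary K U g G H"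
    using local_boundary_exists[OF X_frontier[OF x0]] .
  interpret local_boundary K U g G H by (rule U)
  have contX: "continuous_on (- {0}) X"
    using X_continuous by (simp add: continuous_at_imp_continuous_on)
  define V where "V = - {0} \<inter> X -` U"
  have V: "open V" "x0 \<in> V" "0 \<notin> V"
    unfolding V_def using x0 U(1) by (auto intro!: continuous_open_preimage[OF contX _ op])
  have XU: "X x \<in> U" "X x \<in> frontier K" "x \<noteq> 0" if "x \<in> V" for x
    using that X_frontier by (auto simp: V_def)
  have nrm: "\<exists>l>0. G (X x) = l *\<^sub>R x \<and> X x \<bullet> G (X x) = l * supp K x \<and> X x \<bullet> G (X x) > 0" if x: "x \<in> V" for x
  proof -
    obtain l where l: "l > 0" "G (X x) = l *\<^sub>R x"
      using normal_parallel[OF XU(1,2)[OF x] XU(3)[OF x] X(2)] .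
    then have "X x \<bullet> G (X x) = l * supp K x" by (simp add: inner_commute X(2)[symmetric])
    moreover have "supp K x > 0" using supp_pos[OF body XU(3)[OF x]] .
    ultimately show ?thesis using l by auto
  qed
  have Gnz: "X x \<bullet> G (X x) \<noteq> 0" if "x \<in> V" for x using nrm[OF that] by auto
  have TX: "T (X x) = inverse (supp K x) *\<^sub>R x" if x: "x \<in> V" for x
  proof -
    obtain l where l: "l > 0" "G (X x) = l *\<^sub>R x" "X x \<bullet> G (X x) = l * supp K x" using nrm[OF x] by blast
    then have "T (X x) = (inverse (l * supp K x) * l) *\<^sub>R x" unfolding T_def l(3) by (simp add: l(2))
    also have "inverse (l * supp K x) * l = inverse (supp K x)" using l(1) by (simp add: field_simps)
    finally show ?thesis .
  qed
  define A where "A x = DT (X x)" for x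
  have contA: "continuous_on V A"
    unfolding A_def
    by (rule continuous_on_compose2[OF continuous_on_DT continuous_on_subset[OF contX]])
      (use XU Gnz in \<open>auto simp: V_def\<close>)
  have ker: "v = 0" if x: "x \<in> V" and v: "A x *v v = 0" for x v
  proof (rule ccontr)
    assume "v \<noteq> 0"
    have "v \<bullet> G (X x) = 0"
      using DT_quadratic(1)[OF Gnz[OF x], of v] v Gnz[OF x] by (simp add: A_def)
    moreover have "v \<bullet> (H (X x) *v v) = 0"
      using DT_quadratic(2)[OF Gnz[OF x] calculation] v Gnz[OF x] by (simp add: A_def)
    ultimately show False using curv[OF XU(1,2)[OF x] \<open>v \<noteq> 0\<close>] by simp
  qed
  have injA: "inj ((*v) (A x))" if "x \<in> V" for x
    using ker[OF that] by (simp add: linear_injective_0)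
  have derT: "(T has_derivative (\<lambda>v. A x *v v)) (at (X x))" if "x \<in> V" for x
    unfolding A_def by (rule T_has_derivative[OF XU(1)[OF that] Gnz[OF that]])
  have ex: "\<exists>D. (X has_derivative D) (at x)" if x: "x \<in> V" for x
  proof (rule has_derivative_of_implicit[OF X_continuous[OF XU(3)[OF x]] derT[OF x] injA[OF x] normalized_has_derivative[OF XU(3)[OF x]]])
    show "eventually (\<lambda>x. T (X x) = inverse (supp K x) *\<^sub>R x) (at x)"
      unfolding eventually_at_topological using V x TX by (intro exI[of _ V]) auto
  qed (rule TX[OF x])
  have eq: "A x *v D w = B x *v w" if x: "x \<in> V" and D: "(X has_derivative D) (at x)" for x D w
  proof -
    have "((\<lambda>x. T (X x)) has_derivative (\<lambda>v. A x *v D v)) (at x)"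
      by (rule has_derivative_compose[OF D derT[OF x]])
    then have "((\<lambda>x. inverse (supp K x) *\<^sub>R x) has_derivative (\<lambda>v. A x *v D v)) (at x)"
      by (rule has_derivative_transform_within_open[where s = V]) (use V x TX in auto)
    from fun_cong[OF has_derivative_unique[OF this normalized_has_derivative[OF XU(3)[OF x]]]] show ?thesis .
  qed
  \<comment> \<open>Put v = D w, so that A v = B w. This vector is orthogonal to X x, so v is
    tangent, that is, orthogonal to x. Then v . A v reduces to (v . w) / h(x), and it is positive by
    the curvature condition.\<close>
  have pos: "w \<bullet> D w > 0" if x: "x \<in> V" "norm x = 1" and w: "\<forall>c. w \<noteq> c *\<^sub>R x" and D: "(X has_derivative D) (at x)" for x D w
  proof -
    define v where "v = D w"
    define s where "s = inverse (supp K x)"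
    have s: "s > 0" using supp_pos[OF body XU(3)[OF x(1)]] by (simp add: s_def)
    have sX: "s * (x \<bullet> X x) = 1" using s by (simp add: s_def X(2))
    have Av: "A x *v v = s *\<^sub>R w - (s\<^sup>2 * (X x \<bullet> w)) *\<^sub>R x"
      unfolding v_def eq[OF x(1) D] B_def s_def[symmetric]
      by (simp add: matrix_vector_mult_diff_rdistrib mult_vec_expand)
    obtain l where l: "l > 0" "G (X x) = l *\<^sub>R x" "X x \<bullet> G (X x) > 0" using nrm[OF x(1)] by blast
    have "(A x *v v) \<bullet> X x = s * (w \<bullet> X x) - s * (s * (x \<bullet> X x)) * (X x \<bullet> w)"
      unfolding Av by (simp add: inner_diff_left power2_eq_square)
    also have "\<dots> = 0" by (simp only: sX) (simp add: inner_commute)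
    finally have "(A x *v v) \<bullet> X x = 0" .
    then have vG: "v \<bullet> G (X x) = 0"
      using DT_quadratic(1)[OF Gnz[OF x(1)], of v] Gnz[OF x(1)] by (simp add: A_def)
    then have vx: "v \<bullet> x = 0" using l by simp
    have "v \<noteq> 0"
    proof
      assume "v = 0"
      then have "s *\<^sub>R w = (s\<^sup>2 * (X x \<bullet> w)) *\<^sub>R x" using Av by simp
      then have "inverse s *\<^sub>R s *\<^sub>R w = inverse s *\<^sub>R (s\<^sup>2 * (X x \<bullet> w)) *\<^sub>R x" by simp
      then have "w = (inverse s * (s\<^sup>2 * (X x \<bullet> w))) *\<^sub>R x" using s by simp
      then show False using w by blast
    qed
    then have "v \<bullet> (H (X x) *v v) > 0" using curv[OF XU(1,2)[OF x(1)] _ vG] by blast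
    then have "v \<bullet> (A x *v v) > 0"
      unfolding A_def DT_quadratic(2)[OF Gnz[OF x(1)] vG] using l(3) by simp
    then have "s * (v \<bullet> w) > 0" unfolding Av using vx by (simp add: inner_diff_right)
    then show ?thesis using s by (simp add: v_def inner_commute zero_less_mult_iff)
  qed
  show ?thesis
    by (rule that[of V A, OF V contA]) (fact injA ex eq pos)+
qed

definition M :: "real^'n \<Rightarrow> real^'n^'n" where "M x = matrix (frechet_derivative X (at x))"

lemma X_has_derivative:
  assumes "x \<noteq> 0" shows "(X has_derivative (\<lambda>v. M x *v v)) (at x)"
proof -
  obtain D where D: "(X has_derivative D) (at x)" using X_local[OF assms] by metis
  then have "M x = matrix D" unfolding M_def by (metis frechet_derivative_at)
  moreover have "linear D" using D has_derivative_linear by blast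
  ultimately have "(\<lambda>v. M x *v v) = D" by (simp add: matrix_works fun_eq_iff)
  then show ?thesis using D by simp
qed

text \<open>Locally M solves a linear system with matrix A and right-hand side B. Cramer's rule
  writes its entries as quotients of determinants in A and B, which are continuous.\<close>

lemma continuous_on_M: "continuous_on (- {0}) M"
proof (rule continuous_at_imp_continuous_on, rule ballI)
  fix x0 :: "real^'n" assume "x0 \<in> - {0}"
  then have x0: "x0 \<noteq> 0" by simp
  obtain V A where V: "open V" "x0 \<in> V" "0 \<notin> V" "continuous_on V A"
    "\<And>x. x \<in> V \<Longrightarrow> inj ((*v) (A x))"
    "\<And>x D w. x \<in> V \<Longrightarrow> (X has_derivative D) (at x) \<Longrightarrow> A x *v D w = B x *v w"
    using X_local[OF x0] by metis
  have det: "det (A x) \<noteq> 0" if "x \<in> V" for x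
    using V(5)[OF that] by (metis invertible_det_nz invertible_left_inverse matrix_left_invertible_injective)
  have AM: "A x *v (M x *v w) = B x *v w" if "x \<in> V" for x w
    using V(6)[OF that X_has_derivative, of w] that V(3) by metis
  have entry: "M x $ k $ j = det (\<chi> i l. if l = k then B x $ i $ j else A x $ i $ l) / det (A x)" if "x \<in> V" for x k j
  proof -
    have col: "(N *v axis j 1) $ i = N $ i $ j" for N :: "real^'n^'n" and i
      by (simp add: matrix_vector_mul_component inner_axis)
    have "M x *v axis j 1 = (\<chi> k. det (\<chi> i l. if l = k then (B x *v axis j 1) $ i else A x $ i $ l) / det (A x))"
      using AM[OF that, of "axis j 1"] cramer[OF det[OF that]] by blast
    then have "(M x *v axis j 1) $ k = det (\<chi> i l. if l = k then (B x *v axis j 1) $ i else A x $ i $ l) / det (A x)"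
      by simp
    then show ?thesis unfolding col .
  qed
  have cX: "continuous_on V X" "continuous_on V (supp K)"
  proof -
    have "x \<noteq> 0" if "x \<in> V" for x using that V(3) by auto
    then show "continuous_on V X" "continuous_on V (supp K)"
      using X_continuous has_derivative_continuous[OF supp_has_derivative]
      by (auto intro!: continuous_at_imp_continuous_on)
  qed
  have nz: "supp K x \<noteq> 0" if "x \<in> V" for x using supp_pos[OF body, of x] V(3) that by force
  have cB: "continuous_on V B"
    unfolding B_def[abs_def] using nz by (intro continuous_intros cX) auto
  have "continuous_on V (\<lambda>x. M x $ k $ j)" for k j
  proof -
    have "continuous_on V (\<lambda>x. (\<chi> i l. if l = k then B x $ i $ j else A x $ i $ l))"
      unfolding continuous_on_matrix_entries
    proof (intro allI)
      fix i l
      show "continuous_on V (\<lambda>x. (\<chi> i l. if l = k then B x $ i $ j else A x $ i $ l) $ i $ l)"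
        by (cases "l = k") (auto intro!: continuous_intros cB V(4))
    qed
    then have "continuous_on V (\<lambda>x. det (\<chi> i l. if l = k then B x $ i $ j else A x $ i $ l) / det (A x))"
      using det by (intro continuous_on_divide continuous_on_det V(4)) auto
    then show ?thesis by (rule continuous_on_eq) (simp add: entry)
  qed
  then have "continuous_on V M" unfolding continuous_on_matrix_entries by blast
  then show "continuous (at x0) M" using V(1,2) continuous_on_eq_continuous_at by blast
qed

lemma C2_hom1_supp: "C2_hom1 (supp K)"
  unfolding C2_hom1_def C2_off0_def
  using supp_has_derivative X_has_derivative continuous_on_M supp_scale[OF body] by (metis less_imp_le)

sublocale smooth_body K
proof
  fix x w :: "real^'n" assume x: "norm x = 1" and w: "\<forall>c. w \<noteq> c *\<^sub>R x"
  have x0: "x \<noteq> 0" using x by auto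
  have "hess (supp K) x = transpose (M x)"
    using C2_off0_gradI(2)[of "supp K" X M x] supp_has_derivative X_has_derivative x0 by blast
  then have "w \<bullet> (hess (supp K) x *v w) = w \<bullet> (M x *v w)"
    by (metis dot_lmul_matrix inner_commute transpose_matrix_vector)
  also have "\<dots> > 0"
    using X_local[OF x0] X_has_derivative[OF x0] x w by metis
  finally show "w \<bullet> (hess (supp K) x *v w) > 0" .
qed (rule body C2_hom1_supp)+

end

section \<open>The operator \<open>L\<^sub>K\<close>\<close>

lemma sphere_int_inner:
  fixes f :: "real^'n::finite \<Rightarrow> real^'n"
  assumes "continuous_on (sphere 0 1) f"
  shows "sphere_int f \<bullet> u = sphere_int (\<lambda>x. f x \<bullet> u)"
proof -
  have "(\<lambda>y. f (y /\<^sub>R norm y)) integrable_on ball 0 1"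
    unfolding integrable_componentwise_iff[where f = "\<lambda>y. f (y /\<^sub>R norm y)"]
    by (intro ballI sphere_int_integrable[where f = "\<lambda>x. f x \<bullet> b" for b] continuous_intros assms)
  then show ?thesis
    unfolding sphere_int_def by (rule integral_component_eq[symmetric])
qed

lemma int_dV_eq:
  fixes f :: "real^'n::finite \<Rightarrow> 'b::euclidean_space"
  shows "int_dV K f = sphere_int (\<lambda>x. (supp K x * detD2 (supp K) x) *\<^sub>R f x)"
proof -
  have "int_dV K f = real CARD('n) *\<^sub>R sphere_int (\<lambda>x. (1 / real CARD('n)) *\<^sub>R ((supp K x * detD2 (supp K) x) *\<^sub>R f x))"
    unfolding int_dV_def sph_int_eq by (simp add: mult.assoc)
  also have "\<dots> = sphere_int (\<lambda>x. (supp K x * detD2 (supp K) x) *\<^sub>R f x)"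
    unfolding sphere_int_def integral_cmul by simp
  finally show ?thesis .
qed

lemma continuous_on_detD2 [continuous_intros]: "C2_hom1 f \<Longrightarrow> continuous_on (sphere 0 1) (detD2 f)"
  unfolding detD2_hess1 by (intro continuous_intros)

lemma hom0_sphere: "norm x = 1 \<Longrightarrow> hom0 z x = z x"
  by (simp add: hom0_def)

lemma C2_sphere_continuous:
  assumes "C2_sphere z" shows "continuous_on (sphere 0 1) z"
proof -
  have "continuous_on (sphere 0 1) (hom0 z)"
    by (rule continuous_on_subset[OF C2_off0D(3)]) (use assms C2_sphere_iff in auto)
  then show ?thesis by (rule continuous_on_eq) (simp add: hom0_sphere)
qed

lemma volform_1_add:
  assumes "C2_hom1 u" "C2_hom1 w" "x \<noteq> 0"
  shows "volform h (\<lambda>x. u x + w x) (Suc 0) x = volform h u (Suc 0) x + volform h w (Suc 0) x"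
  using assms by (simp add: volform_def C2_off0_add(3) C2_hom1_C2 detcoef_1_add)

lemma volform_1_cmul:
  assumes "C2_hom1 u" "x \<noteq> 0"
  shows "volform h (\<lambda>x. c * u x) (Suc 0) x = c * volform h u (Suc 0) x"
  using assms by (simp add: volform_def C2_off0_cmul(3) C2_hom1_C2 detcoef_1_scaleR)

lemma volform_1_linear: "x \<noteq> 0 \<Longrightarrow> volform h (\<lambda>x. x \<bullet> v) (Suc 0) x = 0"
  using detcoef_1_scaleR[of "hess1 h x" 0 0] by (simp add: volform_def C2_off0_linear)

context smooth_body
begin

lemma detcoef_1_hess1:
  "norm x = 1 \<Longrightarrow> detcoef (Suc 0) (hess1 h x) N = det (hess1 h x) * trace (matrix_inv (hess1 h x) ** N)"
  using hess1_det_pos[of x] by (intro detcoef_1_trace) auto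

text \<open>With P = D^2 h + x x^T and b = P^(-1) a, the value is det P times b . P b.\<close>

lemma detcoef_1_dyad_nonneg:
  assumes "norm x = 1" shows "detcoef (Suc 0) (hess1 h x) (dyad a a) \<ge> 0"
proof -
  let ?P = "hess1 h x"
  have inv: "?P ** matrix_inv ?P = mat 1"
    using matrix_inv_mult_left[of ?P] hess1_det_pos[OF assms] matrix_left_right_inverse by force
  define b where "b = matrix_inv ?P *v a"
  have a: "?P *v b = a" unfolding b_def matrix_vector_mul_assoc inv by simp
  have "b \<bullet> (?P *v b) \<ge> 0" using hess1_posdef[OF assms, of b] by (cases "b = 0") auto
  then have "b \<bullet> a \<ge> 0" by (simp only: a)
  then show ?thesis
    using hess1_det_pos[OF assms] by (simp add: detcoef_1_hess1[OF assms] matrix_mult_dyad b_def[symmetric] trace_dyad)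
qed

text \<open>The identity has trace n, and the rank-one part x x^T, with x fixed by P, accounts for 1
  of it.\<close>

lemma volform_1_self:
  assumes "norm x = 1" shows "volform h h (Suc 0) x = (real CARD('n) - 1) * detD2 h x"
proof -
  let ?P = "hess1 h x"
  have x: "x \<noteq> 0" "x \<bullet> x = 1" using assms by (auto simp: norm_eq_1)
  have inv: "matrix_inv ?P ** ?P = mat 1"
    using matrix_inv_mult_left[of ?P] hess1_det_pos[OF assms] by simp
  have "?P *v x = x"
    using hess_null[OF C2 x(1)] x by (simp add: hess1_def outer_eq_dyad mult_vec_expand)
  then have Px: "matrix_inv ?P *v x = x"
    using inv by (metis matrix_vector_mul_assoc matrix_vector_mul_lid)
  have "?P = hess h x + dyad x x" by (simp add: hess1_def outer_eq_dyad)
  then have "detcoef (Suc 0) ?P ?P = volform h h (Suc 0) x + detcoef (Suc 0) ?P (dyad x x)"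
    unfolding volform_def One_nat_def by (metis detcoef_1_add)
  moreover have "detcoef (Suc 0) ?P ?P = det ?P * real CARD('n)"
    by (simp add: detcoef_1_hess1[OF assms] inv trace_I)
  moreover have "detcoef (Suc 0) ?P (dyad x x) = det ?P"
    by (simp add: detcoef_1_hess1[OF assms] matrix_mult_dyad Px trace_dyad x)
  ultimately show ?thesis by (simp add: detD2_hess1 algebra_simps)
qed

text \<open>Multiplying by det D^2 h clears the matrix inverse in \<open>LK\<close>, by Jacobi's
  formula; what remains is a derivative of det D^2 h, to which \<open>volform_symmetric\<close>
  applies.\<close>

lemma detD2_mult_LK:
  assumes "norm x = 1"
  shows "detD2 h x * LK M z x = volform h (\<lambda>y. hom0 z y * h y) (Suc 0) x / (real CARD('n) - 1) - z x * detD2 h x"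
  unfolding LK_def hess1_def[symmetric]
  by (simp add: volform_def detcoef_1_hess1[OF assms] detD2_hess1 algebra_simps)

lemma int_LK:
  assumes z: "C2_sphere z"
  shows "int_dV M (\<lambda>x. z x * (- LK M z x)) = int_dV M (\<lambda>x. (z x)\<^sup>2) -
    sphere_int (\<lambda>x. (hom0 z x * h x) * volform h (\<lambda>y. hom0 z y * h y) (Suc 0) x) / (real CARD('n) - 1)"
proof -
  let ?u = "\<lambda>y. hom0 z y * h y"
  have u: "C2_hom1 ?u" by (rule C2_hom1_mult_hom0[OF z C2])
  note cont = C2_sphere_continuous[OF z] C2_hom1_continuous_sphere[OF C2] C2_hom1_continuous_sphere[OF u]
  have "int_dV M (\<lambda>x. z x * (- LK M z x)) =
     sphere_int (\<lambda>x. (h x * detD2 h x) * (z x)\<^sup>2 - (1 / (real CARD('n) - 1)) * (?u x * volform h ?u (Suc 0) x))"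
    unfolding int_dV_eq
  proof (rule sphere_int_cong)
    fix x :: "real^'n" assume x: "norm x = 1"
    have "(h x * detD2 h x) *\<^sub>R (z x * (- LK M z x)) = - (h x * z x * (detD2 h x * LK M z x))" by simp
    also have "\<dots> = (h x * detD2 h x) * (z x)\<^sup>2 - (1 / (real CARD('n) - 1)) * (?u x * volform h ?u (Suc 0) x)"
      unfolding detD2_mult_LK[OF x] by (simp add: hom0_sphere[OF x] power2_eq_square algebra_simps)
    finally show "(h x * detD2 h x) *\<^sub>R (z x * (- LK M z x)) =
      (h x * detD2 h x) * (z x)\<^sup>2 - (1 / (real CARD('n) - 1)) * (?u x * volform h ?u (Suc 0) x)" .
  qed
  also have "\<dots> = sphere_int (\<lambda>x. (h x * detD2 h x) * (z x)\<^sup>2) -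
      sphere_int (\<lambda>x. (1 / (real CARD('n) - 1)) * (?u x * volform h ?u (Suc 0) x))"
    by (intro sphere_int_diff continuous_on_mult[OF continuous_on_const]) (auto intro!: continuous_intros cont C2 u)
  finally show ?thesis
    by (simp only: sphere_int_mult int_dV_eq real_scaleR_def) simp
qed

text \<open>Symmetry of the form, applied to h and \<open>z\<^sup>2 h\<close>, together with the pointwise identity
  \<open>D\<^sup>2(z\<^sup>2 h) - 2 z D\<^sup>2(z h) + z\<^sup>2 D\<^sup>2 h = 2 h \<nabla>z \<otimes> \<nabla>z\<close>. The bound is what makes \<open>lambda2\<close> a genuine
  infimum: \<open>Inf\<close> of a set of reals that is unbounded below is a junk value.\<close>

lemma int_LK_nonneg:
  assumes z: "C2_sphere z" and n: "CARD('n) \<ge> 2"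
  shows "int_dV M (\<lambda>x. z x * (- LK M z x)) \<ge> 0"
proof -
  let ?n = "real CARD('n)"
  define u where "u y = hom0 z y * h y" for y
  define w where "w y = hom0 z y * u y" for y
  have u: "C2_hom1 u" unfolding u_def by (rule C2_hom1_mult_hom0[OF z C2])
  have w: "C2_hom1 w" unfolding w_def by (rule C2_hom1_mult_hom0[OF z u])
  have Z: "C2_off0 (hom0 z)" using z by (simp add: C2_sphere_iff)
  note cont = C2_sphere_continuous[OF z] C2_hom1_continuous_sphere[OF C2] C2_hom1_continuous_sphere[OF u]
    C2_hom1_continuous_sphere[OF w]
  have pt: "volform h w (Suc 0) x - 2 * z x * volform h u (Suc 0) x + (z x)\<^sup>2 * volform h h (Suc 0) x \<ge> 0" if x: "norm x = 1" for x
  proof -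
    have x0: "x \<noteq> 0" using x by auto
    let ?P = "hess1 h x" and ?a = "grad (hom0 z) x"
    have gu: "grad u x = hom0 z x *\<^sub>R grad h x + h x *\<^sub>R ?a"
      and hu: "hess u x = hom0 z x *\<^sub>R hess h x + h x *\<^sub>R hess (hom0 z) x + dyad ?a (grad h x) + dyad (grad h x) ?a"
      unfolding u_def[abs_def] using C2_off0_mult(2,3)[OF Z C2_hom1_C2[OF C2] x0] by auto
    have hw: "hess w x = hom0 z x *\<^sub>R hess u x + u x *\<^sub>R hess (hom0 z) x + dyad ?a (grad u x) + dyad (grad u x) ?a"
      unfolding w_def[abs_def] using C2_off0_mult(3)[OF Z C2_hom1_C2[OF u] x0] by auto
    have "hess w x + (- 2 * z x) *\<^sub>R hess u x + (z x)\<^sup>2 *\<^sub>R hess h x = (2 * h x) *\<^sub>R dyad ?a ?a"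
      unfolding hw gu hu u_def hom0_sphere[OF x]
      by (simp add: vec_eq_iff dyad_def algebra_simps power2_eq_square)
    then have "detcoef (Suc 0) ?P (hess w x + (- 2 * z x) *\<^sub>R hess u x + (z x)\<^sup>2 *\<^sub>R hess h x) =
        2 * h x * detcoef (Suc 0) ?P (dyad ?a ?a)"
      by (simp only: detcoef_1_scaleR)
    also have "\<dots> \<ge> 0"
      using detcoef_1_dyad_nonneg[OF x, of ?a] supp_pos[OF body x0] by simp
    finally show ?thesis
      by (simp only: volform_def detcoef_1_add detcoef_1_scaleR)
  qed
  define I where "I = int_dV M (\<lambda>x. (z x)\<^sup>2)"
  define A where "A = sphere_int (\<lambda>x. u x * volform h u (Suc 0) x)"
  have hD: "sphere_int (\<lambda>x. w x * volform h h (Suc 0) x) = (?n - 1) * I"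
  proof -
    have "sphere_int (\<lambda>x. w x * volform h h (Suc 0) x) = sphere_int (\<lambda>x. (?n - 1) * ((h x * detD2 h x) * (z x)\<^sup>2))"
      by (rule sphere_int_cong) (simp add: volform_1_self w_def u_def hom0_sphere power2_eq_square mult_ac)
    then show ?thesis by (simp only: sphere_int_mult I_def int_dV_eq real_scaleR_def)
  qed
  \<comment> \<open>Symmetry exchanges the roles of h and w = z^2 h, so the variation in direction
    w, tested with h, has the value just computed.\<close>
  then have hw: "sphere_int (\<lambda>x. h x * volform h w (Suc 0) x) = (?n - 1) * I"
    using volform_symmetric[OF C2 C2 w] by (simp only: One_nat_def)
  \<comment> \<open>Weighting the pointwise inequality with h > 0 and integrating gives 0 <= 2 (n-1)
    I - 2 A.\<close>
  have "0 \<le> sphere_int (\<lambda>x. h x * (volform h w (Suc 0) x - 2 * z x * volform h u (Suc 0) x + (z x)\<^sup>2 * volform h h (Suc 0) x))"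
    by (rule sphere_int_nonneg)
      (auto intro!: continuous_intros cont C2 u w mult_nonneg_nonneg pt less_imp_le[OF supp_pos[OF body]])
  also have "\<dots> = sphere_int (\<lambda>x. (h x * volform h w (Suc 0) x + (- 2) * (u x * volform h u (Suc 0) x)) + w x * volform h h (Suc 0) x)"
    by (rule sphere_int_cong) (simp add: w_def u_def hom0_sphere power2_eq_square algebra_simps)
  also have "\<dots> = ((?n - 1) * I + (- 2) * A) + (?n - 1) * I"
  proof -
    have c: "continuous_on (sphere 0 1) (\<lambda>x. h x * volform h w (Suc 0) x)"
      "continuous_on (sphere 0 1) (\<lambda>x. (- 2) * (u x * volform h u (Suc 0) x))"
      "continuous_on (sphere 0 1) (\<lambda>x. w x * volform h h (Suc 0) x)"
      by (intro continuous_intros cont C2 u w)+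
    show ?thesis
      using sphere_int_add[OF continuous_on_add[OF c(1,2)] c(3)] sphere_int_add[OF c(1,2)]
        sphere_int_mult[of "- 2" "\<lambda>x. u x * volform h u (Suc 0) x"] hw hD A_def by linarith
  qed
  finally have "A \<le> (?n - 1) * I" by linarith
  then have "A / (?n - 1) \<le> I" using n by (simp add: divide_le_eq mult.commute)
  then show ?thesis
    unfolding int_LK[OF z] I_def A_def u_def by simp
qed

lemma int_dV_square_nonneg:
  fixes z :: "real^'n \<Rightarrow> real"
  assumes "continuous_on (sphere 0 1) z"
  shows "int_dV M (\<lambda>x. (z x)\<^sup>2) \<ge> 0"
  unfolding int_dV_eq real_scaleR_def
  by (rule sphere_int_nonneg)
    (auto intro!: continuous_intros assms C2_hom1_continuous_sphere[OF C2] C2 mult_nonneg_nonneg less_imp_le[OF supp_detD2_pos] less_imp_le[OF supp_pos[OF body]])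

lemma int_dV_square_pos:
  fixes z :: "real^'n \<Rightarrow> real"
  assumes "continuous_on (sphere 0 1) z" "norm x0 = 1" "z x0 \<noteq> 0"
  shows "int_dV M (\<lambda>x. (z x)\<^sup>2) > 0"
  unfolding int_dV_eq real_scaleR_def
proof (rule sphere_int_pos)
  have "x0 \<noteq> 0" using assms(2) by auto
  then show "0 < h x0 * detD2 h x0 * (z x0)\<^sup>2"
    using supp_pos[OF body] supp_detD2_pos[OF assms(2)] assms(3) by simp
qed (use assms in \<open>auto intro!: continuous_intros C2_hom1_continuous_sphere[OF C2] C2 mult_nonneg_nonneg less_imp_le[OF supp_detD2_pos] less_imp_le[OF supp_pos[OF body]]\<close>)

lemma lambda2_le:
  assumes n: "CARD('n) \<ge> 2" and z: "C2_sphere z" "int_dV M z = 0" "\<And>v. int_dV M (\<lambda>x. z x * ellv M v x) = 0"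
  shows "lambda2 M * int_dV M (\<lambda>x. (z x)\<^sup>2) \<le> int_dV M (\<lambda>x. z x * (- LK M z x))"
proof (cases "\<exists>x\<in>sphere 0 1. z x \<noteq> 0")
  case False
  then have "int_dV M (\<lambda>x. (z x)\<^sup>2) = 0"
    using sphere_int_cong[of "\<lambda>x. (h x * detD2 h x) *\<^sub>R (z x)\<^sup>2" "\<lambda>x. 0"] sphere_int_mult[of 0 "\<lambda>x. 0"]
    by (simp add: int_dV_eq)
  then show ?thesis using int_LK_nonneg[OF z(1) n] by simp
next
  case True
  let ?S = "{int_dV M (\<lambda>x. z x * (- LK M z x)) / int_dV M (\<lambda>x. (z x)^2) | z.
      C2_sphere z \<and> (\<exists>x\<in>sphere 0 1. z x \<noteq> 0) \<and>
      int_dV M z = 0 \<and> (\<forall>v. int_dV M (\<lambda>x. z x * ellv M v x) = 0)}"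
  have "bdd_below ?S"
  proof (rule bdd_belowI)
    fix r assume "r \<in> ?S"
    then obtain z where z: "C2_sphere z" "r = int_dV M (\<lambda>x. z x * (- LK M z x)) / int_dV M (\<lambda>x. (z x)^2)" by blast
    show "0 \<le> r"
      unfolding z(2) by (intro divide_nonneg_nonneg int_LK_nonneg int_dV_square_nonneg z(1) C2_sphere_continuous n)
  qed
  moreover have "int_dV M (\<lambda>x. z x * (- LK M z x)) / int_dV M (\<lambda>x. (z x)^2) \<in> ?S"
    using z True by blast
  ultimately have "lambda2 M \<le> int_dV M (\<lambda>x. z x * (- LK M z x)) / int_dV M (\<lambda>x. (z x)^2)"
    unfolding lambda2_def by (intro cInf_lower)
  moreover have "int_dV M (\<lambda>x. (z x)\<^sup>2) > 0"
    using True int_dV_square_pos[OF C2_sphere_continuous[OF z(1)]] by auto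
  ultimately show ?thesis by (simp add: pos_le_divide_eq)
qed

end

section \<open>Mixed volumes and stability\<close>

definition mink_sum :: "(real^'n::finite) set \<Rightarrow> real \<Rightarrow> (real^'n) set \<Rightarrow> (real^'n) set" where
  "mink_sum K t L = {x + t *\<^sub>R y |x y. x \<in> K \<and> y \<in> L}"

lemma convex_body0_mink_sum:
  assumes K: "convex_body0 K" and L: "convex_body0 L" and t: "t \<ge> 0"
  shows "convex_body0 (mink_sum K t L)"
    "supp (mink_sum K t L) = (\<lambda>x. supp K x + t * supp L x)"
proof -
  have eq: "mink_sum K t L = (\<Union>x\<in>K. \<Union>y\<in>(\<lambda>y. t *\<^sub>R y) ` L. {x + y})"
    by (auto simp: mink_sum_def)
  have eq2: "mink_sum K t L = {x + y |x y. x \<in> K \<and> y \<in> (\<lambda>y. t *\<^sub>R y) ` L}"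
    by (auto simp: mink_sum_def)
  have c: "compact (mink_sum K t L)"
    unfolding eq2 by (intro compact_sums compact_scaling body_props[OF K] body_props[OF L])
  have cv: "convex (mink_sum K t L)"
    unfolding eq by (intro convex_sums convex_scaling body_props[OF K] body_props[OF L])
  have "K \<subseteq> mink_sum K t L"
    using body_props(4)[OF L] by (force simp: mink_sum_def)
  then have "0 \<in> interior (mink_sum K t L)"
    using body_props(3)[OF K] interior_mono by blast
  then show S: "convex_body0 (mink_sum K t L)" using c cv by (simp add: convex_body0_def)
  show "supp (mink_sum K t L) = (\<lambda>x. supp K x + t * supp L x)"
  proof
    fix x
    obtain a where a: "a \<in> K" "x \<bullet> a = supp K x" using supp_attained[OF K, of x] .
    obtain b where b: "b \<in> L" "x \<bullet> b = supp L x" using supp_attained[OF L, of x] .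
    have "a + t *\<^sub>R b \<in> mink_sum K t L" using a b by (auto simp: mink_sum_def)
    from supp_ge[OF S this, of x] have "supp K x + t * supp L x \<le> supp (mink_sum K t L) x"
      using a b by (simp add: inner_right_distrib)
    moreover have "supp (mink_sum K t L) x \<le> supp K x + t * supp L x"
    proof (rule supp_le[OF S])
      fix y assume "y \<in> mink_sum K t L"
      then obtain p q where "p \<in> K" "q \<in> L" "y = p + t *\<^sub>R q" by (auto simp: mink_sum_def)
      then show "x \<bullet> y \<le> supp K x + t * supp L x"
        using supp_ge[OF K, of p x] supp_ge[OF L, of q x] t
        by (simp add: inner_right_distrib add_mono mult_left_mono)
    qed
    ultimately show "supp (mink_sum K t L) x = supp K x + t * supp L x" by simp
  qed
qed

lemma smooth_body_mink_sum:
  assumes K: "smooth_body K" and L: "smooth_body L" and t: "t \<ge> 0"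
  shows "smooth_body (mink_sum K t L)"
proof -
  interpret K: smooth_body K by (rule K)
  interpret L: smooth_body L by (rule L)
  note S = convex_body0_mink_sum[OF K.body L.body t]
  show ?thesis
  proof
    show "convex_body0 (mink_sum K t L)" by (rule S)
    show "C2_hom1 (supp (mink_sum K t L))"
      unfolding S(2) by (intro C2_hom1_add C2_hom1_cmul K.C2 L.C2)
    fix x v :: "real^'a" assume x: "norm x = 1" and v: "\<forall>c. v \<noteq> c *\<^sub>R x"
    have x0: "x \<noteq> 0" using x by auto
    have "hess (supp (mink_sum K t L)) x = hess (supp K) x + t *\<^sub>R hess (supp L) x"
      unfolding S(2) using x0 K.C2 L.C2
      by (simp add: C2_off0_add(3) C2_off0_cmul C2_hom1_C2)
    then have "v \<bullet> (hess (supp (mink_sum K t L)) x *v v) = v \<bullet> (hess (supp K) x *v v) + t * (v \<bullet> (hess (supp L) x *v v))"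
      by (simp add: mult_vec_expand inner_right_distrib)
    also have "\<dots> > 0"
      using K.posdef[OF x v] L.posdef[OF x v] t by (simp add: add_pos_nonneg)
    finally show "v \<bullet> (hess (supp (mink_sum K t L)) x *v v) > 0" .
  qed
qed

lemma volume_mink_sum:
  fixes K L :: "(real^'n::finite) set"
  assumes K: "smooth_body K" and L: "smooth_body L" and t: "t \<ge> 0"
  defines "a \<equiv> \<lambda>k. sphere_int (\<lambda>x. supp K x * volform (supp K) (supp L) k x)
       + (case k of 0 \<Rightarrow> 0 | Suc j \<Rightarrow> sphere_int (\<lambda>x. supp L x * volform (supp K) (supp L) j x))"
  shows "measure lebesgue (mink_sum K t L) = (\<Sum>k\<le>CARD('n). a k * t ^ k)"
proof -
  interpret K: smooth_body K by (rule K)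
  interpret L: smooth_body L by (rule L)
  interpret S: smooth_body "mink_sum K t L" by (rule smooth_body_mink_sum[OF K L t])
  let ?n = "CARD('n)" and ?h = "supp K" and ?g = "supp L"
  note cont = C2_hom1_continuous_sphere[OF K.C2] C2_hom1_continuous_sphere[OF L.C2] continuous_on_volform[OF K.C2 L.C2]
  define c where "c k x = ?h x * volform ?h ?g k x + (case k of 0 \<Rightarrow> 0 | Suc j \<Rightarrow> ?g x * volform ?h ?g j x)" for k x
  have contc: "continuous_on (sphere 0 1) (c k)" for k
    unfolding c_def by (cases k) (auto intro!: continuous_intros cont)
  have ac: "sphere_int (c k) = a k" for k
  proof (cases k)
    case 0
    then show ?thesis by (simp add: c_def[abs_def] a_def)
  next
    case (Suc j)
    then show ?thesis
      unfolding c_def[abs_def] a_def by simp (rule sphere_int_add; intro continuous_intros cont)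
  qed
  have "measure lebesgue (mink_sum K t L) = sphere_int (\<lambda>x. (?h x + t * ?g x) * detD2 (\<lambda>x. ?h x + t * ?g x) x)"
    using S.volume_formula unfolding convex_body0_mink_sum(2)[OF K.body L.body t] .
  also have "\<dots> = sphere_int (\<lambda>x. \<Sum>k\<le>?n. c k x * t ^ k)"
  proof (rule sphere_int_cong)
    fix x :: "real^'n" assume x: "norm x = 1"
    then have x0: "x \<noteq> 0" by auto
    have "detD2 (\<lambda>x. ?h x + t * ?g x) x = (\<Sum>k\<le>?n. volform ?h ?g k x * t ^ k)"
      unfolding detD2_hess1 hess1_add_cmul[OF K.C2 L.C2 x0] det_add_scaleR volform_def ..
    then have "(?h x + t * ?g x) * detD2 (\<lambda>x. ?h x + t * ?g x) x = (\<Sum>k\<le>Suc ?n. c k x * t ^ k)"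
      unfolding c_def
      using poly_times_linear[of "\<lambda>k. volform ?h ?g k x" ?n "?h x" t "?g x"] by (simp add: volform_def detcoef_beyond)
    \<comment> \<open>The Hessian of the support function of L annihilates x, so its full
      determinant is 0: the formal degree n + 1 drops to n, as \<open>mixvol\<close>
      requires.\<close>
    also have "c (Suc ?n) x = 0"
    proof -
      have "det (hess ?g x) = 0"
        using hess_null[OF L.C2 x0] x0 by (metis invertible_det_nz matrix_left_invertible_ker invertible_left_inverse)
      then show ?thesis by (simp add: c_def volform_def detcoef_beyond)
    qed
    then have "(\<Sum>k\<le>Suc ?n. c k x * t ^ k) = (\<Sum>k\<le>?n. c k x * t ^ k)" by simp
    finally show "(?h x + t * ?g x) * detD2 (\<lambda>x. ?h x + t * ?g x) x = (\<Sum>k\<le>?n. c k x * t ^ k)" .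
  qed
  also have "\<dots> = sphere_int (\<lambda>x. \<Sum>k\<le>?n. t ^ k * c k x)"
    by (simp only: mult.commute)
  also have "\<dots> = (\<Sum>k\<le>?n. sphere_int (\<lambda>x. t ^ k * c k x))"
    by (rule sphere_int_sum) (auto intro!: continuous_intros contc)
  also have "\<dots> = (\<Sum>k\<le>?n. a k * t ^ k)"
    unfolding sphere_int_mult ac by (simp only: mult.commute)
  finally show ?thesis .
qed

text \<open>The description in \<open>mixvol\<close> has exactly one solution: the values at t > 0
  determine the coefficients up to degree n, and the remaining ones are prescribed to be 0.\<close>

lemma mixvol_eqI:
  fixes K L :: "(real^'n::finite) set"
  assumes vol: "\<And>t. t \<ge> 0 \<Longrightarrow> measure lebesgue (mink_sum K t L) = (\<Sum>k\<le>CARD('n). a k * t ^ k)"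
    and "m \<le> CARD('n)"
  shows "mixvol K L m = a m / real (CARD('n) choose m)"
proof -
  let ?n = "CARD('n)"
  define P where "P c \<longleftrightarrow> (\<forall>k>?n. c k = 0) \<and>
      (\<forall>t\<ge>0. measure lebesgue {x + t *\<^sub>R y |x y. x \<in> K \<and> y \<in> L} =
              (\<Sum>k\<le>?n. real (?n choose k) * c k * t ^ k))" for c :: "nat \<Rightarrow> real"
  define c0 where "c0 k = (if k \<le> ?n then a k / real (?n choose k) else 0)" for k
  have "P c0"
  proof -
    have "(\<Sum>k\<le>?n. real (?n choose k) * c0 k * t ^ k) = (\<Sum>k\<le>?n. a k * t ^ k)" for t
      by (rule sum.cong) (auto simp: c0_def)
    then show ?thesis using vol by (simp add: P_def c0_def mink_sum_def)
  qed
  moreover have "c = c0" if "P c" for c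
  proof
    fix k
    show "c k = c0 k"
    proof (cases "k \<le> ?n")
      case True
      have "(\<Sum>k\<le>?n. (real (?n choose k) * c k) * t ^ k) = (\<Sum>k\<le>?n. (real (?n choose k) * c0 k) * t ^ k)" if "0 < t" for t
        using conjunct2[OF \<open>P c\<close>[unfolded P_def], rule_format, of t]
          conjunct2[OF \<open>P c0\<close>[unfolded P_def], rule_format, of t] that by simp
      then have "real (?n choose k) * c k = real (?n choose k) * c0 k"
        by (rule poly_coeffs_eqI[where e = 1 and n = ?n]) (use True in auto)
      then show ?thesis using True by simp
    next
      case False
      then show ?thesis using \<open>P c\<close> \<open>P c0\<close> by (simp add: P_def)
    qed
  qed
  ultimately have "(THE c. P c) = c0" by (rule the_equality)
  then show ?thesis
    unfolding mixvol_def P_def[symmetric] using assms(2) by (simp add: c0_def)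
qed

text \<open>The coefficient of t^(j+1) in the volume of K + t L is the sum of an integral of h_K and
  one of h_L; by the first variation it equals n / (j+1) times the latter. Division by the binomial
  coefficient gives the factors 1 for j = 0 and 1 / (n-1) for j = 1.\<close>

theorem mixvol_formulas:
  fixes K L :: "(real^'n::finite) set"
  assumes K: "smooth_body K" and L: "smooth_body L" and n: "CARD('n) \<ge> 2"
  shows "mixvol K L 1 = sphere_int (\<lambda>x. supp L x * detD2 (supp K) x)"
    "mixvol K L 2 = sphere_int (\<lambda>x. supp L x * volform (supp K) (supp L) (Suc 0) x) / (real CARD('n) - 1)"
proof -
  interpret K: smooth_body K by (rule K)
  interpret L: smooth_body L by (rule L)
  let ?n = "CARD('n)" and ?h = "supp K" and ?g = "supp L"
  define X where "X k = sphere_int (\<lambda>x. ?h x * volform ?h ?g k x)" for k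
  define Y where "Y k = sphere_int (\<lambda>x. ?g x * volform ?h ?g k x)" for k
  have fv: "real (Suc k) * X (Suc k) = (real ?n - real (Suc k)) * Y k" if "k \<le> ?n" for k
    unfolding X_def Y_def by (rule first_variation[OF K.C2 L.C2 that])
  have mv: "mixvol K L (Suc j) = (X (Suc j) + Y j) / real (?n choose Suc j)" if "Suc j \<le> ?n" for j
    unfolding X_def Y_def using mixvol_eqI[OF volume_mink_sum[OF K L] that] by simp
  have "mixvol K L 1 = Y 0"
    using fv[of 0] mv[of 0] n by (simp add: field_simps)
  then show "mixvol K L 1 = sphere_int (\<lambda>x. ?g x * detD2 ?h x)"
    by (simp add: Y_def volform_0)
  have "real (?n choose 2) = real ?n * (real ?n - 1) / 2"
    using n by (simp add: choose_two real_of_nat_div of_nat_diff)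
  moreover have "X 2 + Y 1 = real ?n / 2 * Y 1"
    using fv[of 1] n by (simp add: numeral_2_eq_2 field_simps)
  moreover have "mixvol K L 2 = (X 2 + Y 1) / real (?n choose 2)"
    using mv[of 1] n by (simp add: numeral_2_eq_2)
  ultimately have "mixvol K L 2 = (real ?n / 2 * Y 1) / (real ?n * (real ?n - 1) / 2)"
    by (simp only:)
  also have "\<dots> = Y 1 / (real ?n - 1)" using n by simp
  finally have "mixvol K L 2 = Y 1 / (real ?n - 1)" .
  then show "mixvol K L 2 = sphere_int (\<lambda>x. ?g x * volform ?h ?g (Suc 0) x) / (real ?n - 1)"
    by (simp add: Y_def)
qed

section \<open>The extended homothetic transform\<close>

lemma supp_affine_image:
  assumes "convex_body0 K" "c \<ge> 0"
  shows "supp {c *\<^sub>R y + v |y. y \<in> K} x = c * supp K x + x \<bullet> v"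
proof -
  obtain p where p: "p \<in> K" "x \<bullet> p = supp K x" using supp_attained[OF assms(1), of x] .
  have "Sup ((\<lambda>y. x \<bullet> y) ` {c *\<^sub>R y + v |y. y \<in> K}) = c * supp K x + x \<bullet> v"
  proof (rule cSup_eq_maximum)
    show "c * supp K x + x \<bullet> v \<in> (\<lambda>y. x \<bullet> y) ` {c *\<^sub>R y + v |y. y \<in> K}"
      using p by (intro image_eqI[of _ _ "c *\<^sub>R p + v"]) (auto simp: inner_right_distrib)
    show "y \<le> c * supp K x + x \<bullet> v" if "y \<in> (\<lambda>y. x \<bullet> y) ` {c *\<^sub>R y + v |y. y \<in> K}" for y
      using that supp_ge[OF assms(1)] assms(2) by (auto simp: inner_right_distrib mult_left_mono)
  qed
  then show ?thesis by (simp add: supp_def)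
qed

text \<open>The quadratic form \<open>\<integral> \<langle>x, v\<rangle>\<^sup>2 h\<^bsup>-1\<^esup> det (D\<^sup>2 h) d\<mu>\<close> is positive definite, so the linear equation
  defining v has exactly one solution.\<close>

lemma translation_vector:
  fixes K L :: "(real^'n::finite) set"
  assumes K: "smooth_body K" and L: "smooth_body L"
  defines "v \<equiv> THE v. int_dV K (\<lambda>x. ((x \<bullet> (Xmap L x - v)) / (supp K x)^2) *\<^sub>R x) = 0"
  shows "sphere_int (\<lambda>x. detD2 (supp K) x * ((supp L x - x \<bullet> v) / supp K x * (x \<bullet> u))) = 0"
proof -
  interpret K: smooth_body K by (rule K)
  interpret L: smooth_body L by (rule L)
  let ?h = "supp K" and ?g = "supp L"
  \<comment> \<open>The density of S_2 K with respect to mu.\<close>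
  define \<rho> where "\<rho> x = detD2 ?h x / ?h x" for x
  have hpos: "?h x > 0" if "norm x = 1" for x using supp_pos[OF K.body, of x] that by force
  have conth: "continuous_on (sphere 0 1) ?h" "continuous_on (sphere 0 1) ?g"
    by (rule C2_hom1_continuous_sphere K.C2 L.C2)+
  have cont\<rho>: "continuous_on (sphere 0 1) \<rho>"
    unfolding \<rho>_def[abs_def] by (intro continuous_intros K.C2 conth) (use hpos in force)
  have \<rho>pos: "\<rho> x > 0" if "norm x = 1" for x
    using hpos[OF that] K.supp_detD2_pos[OF that] by (simp add: \<rho>_def)
  define \<beta> where "\<beta> = sphere_int (\<lambda>x. (\<rho> x * ?g x) *\<^sub>R x)"
  define B where "B v = sphere_int (\<lambda>x. (\<rho> x * (x \<bullet> v)) *\<^sub>R x)" for v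
  have \<beta>_inner: "\<beta> \<bullet> u = sphere_int (\<lambda>x. \<rho> x * ?g x * (x \<bullet> u))" for u
    unfolding \<beta>_def by (subst sphere_int_inner) (auto intro!: continuous_intros cont\<rho> conth)
  have B_inner: "B v \<bullet> u = sphere_int (\<lambda>x. \<rho> x * (x \<bullet> v) * (x \<bullet> u))" for u v
    unfolding B_def by (subst sphere_int_inner) (auto intro!: continuous_intros cont\<rho> conth)
  have linB: "linear B"
  proof (rule linearI)
    fix v w :: "real^'n" and c :: real
    have "B (v + w) \<bullet> u = (B v + B w) \<bullet> u" for u
      unfolding inner_add_left B_inner
      by (subst sphere_int_add[symmetric])
        (auto intro!: continuous_intros cont\<rho> sphere_int_cong simp: inner_right_distrib algebra_simps)
    then show "B (v + w) = B v + B w" by (rule iffD1[OF vector_eq_rdot, OF allI])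
    have "B (c *\<^sub>R v) \<bullet> u = (c *\<^sub>R B v) \<bullet> u" for u
      unfolding inner_scaleR_left B_inner sphere_int_mult[symmetric]
      by (auto intro!: sphere_int_cong)
    then show "B (c *\<^sub>R v) = c *\<^sub>R B v" by (rule iffD1[OF vector_eq_rdot, OF allI])
  qed
  have "v = 0" if "B v = 0" for v
  proof (rule ccontr)
    assume "v \<noteq> 0"
    have "sphere_int (\<lambda>x. \<rho> x * (x \<bullet> v) * (x \<bullet> v)) > 0"
    proof (rule sphere_int_pos)
      show "continuous_on (sphere 0 1) (\<lambda>x. \<rho> x * (x \<bullet> v) * (x \<bullet> v))" by (intro continuous_intros cont\<rho>)
      show "norm (v /\<^sub>R norm v) = 1" using \<open>v \<noteq> 0\<close> by simp
      then show "0 < \<rho> (v /\<^sub>R norm v) * ((v /\<^sub>R norm v) \<bullet> v) * ((v /\<^sub>R norm v) \<bullet> v)"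
        using \<open>v \<noteq> 0\<close> \<rho>pos by (intro mult_pos_pos) auto
      show "0 \<le> \<rho> x * (x \<bullet> v) * (x \<bullet> v)" if "norm x = 1" for x
        using \<rho>pos[OF that] by (simp add: mult.assoc)
    qed
    then show False using B_inner[of v v] that by simp
  qed
  then have "inj B" using linB by (simp add: linear_injective_0)
  then have "surj B" using linB linear_injective_imp_surjective by blast
  \<comment> \<open>The condition defining v is the linear equation B v = beta, because x . X_L(x) =
    h_L(x) by Euler's relation.\<close>
  have eq: "int_dV K (\<lambda>x. ((x \<bullet> (Xmap L x - v)) / (?h x)^2) *\<^sub>R x) = \<beta> - B v" for v
  proof -
    have "int_dV K (\<lambda>x. ((x \<bullet> (Xmap L x - v)) / (?h x)^2) *\<^sub>R x) = sphere_int (\<lambda>x. (\<rho> x * (?g x - x \<bullet> v)) *\<^sub>R x)"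
      unfolding int_dV_eq
    proof (rule sphere_int_cong)
      fix x :: "real^'n" assume x: "norm x = 1"
      then have x0: "x \<noteq> 0" by auto
      have "x \<bullet> Xmap L x = ?g x" using C2_hom1_euler[OF L.C2 x0] by (simp add: Xmap_def inner_commute)
      then show "(?h x * detD2 ?h x) *\<^sub>R ((x \<bullet> (Xmap L x - v)) / (?h x)^2) *\<^sub>R x = (\<rho> x * (?g x - x \<bullet> v)) *\<^sub>R x"
        using hpos[OF x] by (simp add: inner_diff_right \<rho>_def power2_eq_square field_simps)
    qed
    also have "\<dots> = \<beta> - B v"
    proof -
      have "sphere_int (\<lambda>x. (\<rho> x * (?g x - x \<bullet> v)) *\<^sub>R x) \<bullet> u = (\<beta> - B v) \<bullet> u" for u
        unfolding inner_diff_left \<beta>_inner B_inner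
        by (subst sphere_int_inner, intro continuous_intros cont\<rho> conth, subst sphere_int_diff[symmetric])
          (auto intro!: continuous_intros cont\<rho> conth sphere_int_cong simp: algebra_simps)
      then show ?thesis by (rule iffD1[OF vector_eq_rdot, OF allI])
    qed
    finally show ?thesis .
  qed
  obtain v0 where "\<beta> = B v0" using surjD[OF \<open>surj B\<close>, of \<beta>] by blast
  then have v0: "B v0 = \<beta>" by (rule sym)
  have v: "v = v0"
    unfolding v_def eq
  proof (rule the_equality)
    show "\<beta> - B v0 = 0" using v0 by simp
    show "w = v0" if "\<beta> - B w = 0" for w
    proof (rule injD[OF \<open>inj B\<close>])
      show "B w = B v0" using that unfolding v0 right_minus_eq by (rule sym)
    qed
  qed
  have "(\<beta> - B v) \<bullet> u = 0" unfolding v v0 by simp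
  then have "sphere_int (\<lambda>x. \<rho> x * ?g x * (x \<bullet> u)) - sphere_int (\<lambda>x. \<rho> x * (x \<bullet> v) * (x \<bullet> u)) = 0"
    by (simp only: inner_diff_left \<beta>_inner B_inner)
  moreover have "sphere_int (\<lambda>x. \<rho> x * ?g x * (x \<bullet> u)) - sphere_int (\<lambda>x. \<rho> x * (x \<bullet> v) * (x \<bullet> u)) =
      sphere_int (\<lambda>x. detD2 ?h x * ((?g x - x \<bullet> v) / ?h x * (x \<bullet> u)))"
  proof -
    have "sphere_int (\<lambda>x. \<rho> x * ?g x * (x \<bullet> u)) - sphere_int (\<lambda>x. \<rho> x * (x \<bullet> v) * (x \<bullet> u)) =
        sphere_int (\<lambda>x. \<rho> x * ?g x * (x \<bullet> u) - \<rho> x * (x \<bullet> v) * (x \<bullet> u))"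
      by (rule sphere_int_diff[symmetric]; intro continuous_intros cont\<rho> conth)
    also have "\<dots> = sphere_int (\<lambda>x. detD2 ?h x * ((?g x - x \<bullet> v) / ?h x * (x \<bullet> u)))"
      by (rule sphere_int_cong) (simp add: \<rho>_def algebra_simps diff_divide_distrib)
    finally show ?thesis .
  qed
  ultimately show ?thesis by simp
qed

section \<open>The stability inequality\<close>

theorem theorem1p6:
  fixes K L :: "(real^'n::finite) set"
  assumes "CARD('n) \<ge> 2"
    and "K2plus K" and "K2plus L"
  shows "(mixvol K L 1)^2 / vol K - mixvol K L 2
           \<ge> (1 / real CARD('n)) * (lambda2 K - 1) * (delta2_S2 K L (ext_homothetic K L))^2"
proof -
  interpret K: K2plus_body K by unfold_locales (rule assms)
  interpret L: K2plus_body L by unfold_locales (rule assms)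
  note n = assms(1)
  have KL: "smooth_body K" "smooth_body L" by unfold_locales
  let ?n = "real CARD('n)"
  define h where "h = supp K"
  define g where "g = supp L"
  define D where "D = detD2 h"
  have h: "C2_hom1 h" and g: "C2_hom1 g" unfolding h_def g_def by (rule K.C2 L.C2)+
  have hpos: "h x > 0" if "x \<noteq> 0" for x unfolding h_def by (rule supp_pos[OF K.body that])
  have gpos: "g x > 0" if "x \<noteq> 0" for x unfolding g_def by (rule supp_pos[OF L.body that])
  have Dpos: "D x > 0" if "norm x = 1" for x unfolding D_def h_def by (rule K.supp_detD2_pos[OF that])
  have zero: "h 0 = 0" "g 0 = 0"
    using supp_scale[OF K.body, of 0 0] supp_scale[OF L.body, of 0 0] by (auto simp: h_def g_def)
  have contD: "continuous_on (sphere 0 1) D" unfolding D_def by (intro continuous_intros h)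
  note cont = C2_hom1_continuous_sphere(1)[OF h] C2_hom1_continuous_sphere(1)[OF g] contD
  define V where "V = vol K"
  define V1 where "V1 = mixvol K L 1"
  define V2 where "V2 = mixvol K L 2"
  have V: "V = sphere_int (\<lambda>x. h x * D x)"
    using K.volume_formula by (simp add: V_def vol_def h_def D_def)
  have V1: "V1 = sphere_int (\<lambda>x. g x * D x)" and
    V2: "sphere_int (\<lambda>x. g x * volform h g (Suc 0) x) = (?n - 1) * V2"
    using mixvol_formulas[OF KL n] n by (auto simp: V1_def V2_def h_def g_def D_def)
  have Vpos: "V > 0"
    unfolding V
  proof (rule sphere_int_pos)
    \<comment> \<open>Any unit vector serves as the point of positivity.\<close>
    show "norm (axis undefined 1 :: real^'n) = 1" by simp
    show "continuous_on (sphere 0 1) (\<lambda>x. h x * D x)" by (intro continuous_intros cont)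
    have p: "h x * D x > 0" if "norm x = 1" for x using that hpos[of x] Dpos[of x] by force
    then show "0 < h (axis undefined 1) * D (axis undefined 1)" by simp
    show "0 \<le> h x * D x" if "norm x = 1" for x using p[OF that] by simp
  qed
  have V1nn: "V1 \<ge> 0"
    unfolding V1
  proof (rule sphere_int_nonneg)
    show "continuous_on (sphere 0 1) (\<lambda>x. g x * D x)" by (intro continuous_intros cont)
    show "0 \<le> g x * D x" if "norm x = 1" for x using that gpos[of x] Dpos[of x] by (force intro: mult_nonneg_nonneg less_imp_le)
  qed
  define c where "c = V1 / V"
  have c: "c \<ge> 0" "c * V = V1" using Vpos V1nn by (auto simp: c_def)
  define v where "v = (THE v. int_dV K (\<lambda>x. ((x \<bullet> (Xmap L x - v)) / (supp K x)^2) *\<^sub>R x) = 0)"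
  define l where "l x = x \<bullet> v" for x
  have l: "C2_hom1 l" unfolding l_def[abs_def] by (rule C2_hom1_linear)
  have "ext_homothetic K L = {c *\<^sub>R y + v |y. y \<in> K}"
    by (simp add: ext_homothetic_def v_def c_def V1_def V_def)
  then have supp_ext: "supp (ext_homothetic K L) x = c * h x + l x" for x
    by (simp add: supp_affine_image[OF K.body c(1)] h_def l_def)
  \<comment> \<open>The difference of the support functions of L and of its transform, spelled with
    sums and multiples so that the closure and linearity lemmas apply directly.\<close>
  define u where "u x = (g x + (- c) * h x) + (- 1) * l x" for x
  have u: "C2_hom1 u" unfolding u_def[abs_def] by (intro C2_hom1_add C2_hom1_cmul h g l)
  define \<omega> where "\<omega> x = u x * inverse (h x)" for x
  have hom0: "hom0 \<omega> x * h x = u x" for x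
  proof (cases "x = 0")
    case True then show ?thesis by (simp add: zero u_def l_def)
  next
    case False
    then have "hom0 \<omega> x = u x * inverse (h x)"
      using C2_hom1_scale[OF u, of "inverse (norm x)" x] C2_hom1_scale[OF h, of "inverse (norm x)" x]
      by (simp add: hom0_def \<omega>_def)
    then show ?thesis using hpos[OF False] by simp
  qed
  have om: "\<omega> x * h x = u x" if "norm x = 1" for x
    using hom0[of x] hom0_sphere[OF that, of \<omega>] by simp
  \<comment> \<open>As a quotient of 1-homogeneous functions, omega is its own 0-homogeneous
    extension; at 0 this holds because \<open>hom0\<close> evaluates at 0 again.\<close>
  have hom0_eq: "hom0 \<omega> = \<omega>"
  proof
    fix x
    show "hom0 \<omega> x = \<omega> x"
    proof (cases "x = 0")
      case False
      then show ?thesis using hom0[of x] hpos[OF False] by (simp add: \<omega>_def field_simps)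
    qed (simp add: hom0_def)
  qed
  have \<omega>: "C2_sphere \<omega>"
    unfolding C2_sphere_iff hom0_eq unfolding \<omega>_def[abs_def]
    by (intro C2_off0_mult(1) C2_off0_inverse C2_hom1_C2 u h) (use hpos in force)
  note contu = C2_hom1_continuous_sphere(1)[OF u] C2_hom1_continuous_sphere(1)[OF l]
  define A where "A w z = sphere_int (\<lambda>x. w x * volform h z (Suc 0) x)" for w z
  have A_sym: "A w z = A z w" if "C2_hom1 w" "C2_hom1 z" for w z
    using volform_symmetric[OF h that] by (simp add: A_def)
  have A_h: "A w h = (?n - 1) * sphere_int (\<lambda>x. w x * D x)" for w
  proof -
    have "A w h = sphere_int (\<lambda>x. (?n - 1) * (w x * D x))"
      unfolding A_def by (rule sphere_int_cong) (simp add: K.volform_1_self[folded h_def] D_def)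
    then show ?thesis by (simp only: sphere_int_mult)
  qed
  have nz: "x \<noteq> 0" if "norm x = 1" for x :: "real^'n" using that by auto
  have A_add: "A w (\<lambda>x. y x + z x) = A w y + A w z" if w: "C2_hom1 w" and y: "C2_hom1 y" and z: "C2_hom1 z" for w y z
  proof -
    have "A w (\<lambda>x. y x + z x) = sphere_int (\<lambda>x. w x * volform h y (Suc 0) x + w x * volform h z (Suc 0) x)"
      unfolding A_def
      by (rule sphere_int_cong) (simp add: volform_1_add[OF y z nz] distrib_left)
    also have "\<dots> = A w y + A w z"
      unfolding A_def by (rule sphere_int_add; intro continuous_intros C2_hom1_continuous_sphere(1)[OF w] h y z)
    finally show ?thesis .
  qed
  have A_cmul: "A w (\<lambda>x. b * y x) = b * A w y" if "C2_hom1 y" for w y b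
    unfolding A_def sphere_int_mult[symmetric]
    by (rule sphere_int_cong) (simp add: volform_1_cmul[OF that nz])
  have A_l: "A w (\<lambda>x. x \<bullet> b) = 0" for w b
  proof -
    have "A w (\<lambda>x. x \<bullet> b) = sphere_int (\<lambda>x :: real^'n. 0 * (0::real))"
      unfolding A_def by (rule sphere_int_cong) (simp add: volform_1_linear[OF nz])
    also have "\<dots> = 0 * sphere_int (\<lambda>x :: real^'n. 0 :: real)" by (rule sphere_int_mult)
    finally show ?thesis by simp
  qed
  have n1: "?n - 1 > 0" using n by simp
  \<comment> \<open>The surface area measure of K has its barycentre at 0: by symmetry of A, n - 1
    times this integral is A of h against a linear function, whose Hessian is zero.\<close>
  have intlin: "sphere_int (\<lambda>x. (x \<bullet> b) * D x) = 0" for b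
    using A_h[of "\<lambda>x. x \<bullet> b"] A_sym[OF C2_hom1_linear h, of b] A_l n1 by simp
  have Agh: "A g h = (?n - 1) * V1" "A h h = (?n - 1) * V" "A g g = (?n - 1) * V2"
    by (simp_all add: A_h V1 V) (simp add: A_def V2)
  have Au: "A w u = A w g + (- c) * A w h" if "C2_hom1 w" for w
    unfolding u_def[abs_def] l_def
    by (simp only: A_add[OF that] A_cmul C2_hom1_add C2_hom1_cmul C2_hom1_linear h g A_l)
  \<comment> \<open>Linear terms drop out, leaving A g g - 2 c A g h + c^2 A h h, which c V = V1
    simplifies.\<close>
  have Auu: "A u u = (?n - 1) * (V2 - V1\<^sup>2 / V)"
  proof -
    have "A u u = A g u + (- c) * A h u"
      using Au[OF u] A_sym[OF u g] A_sym[OF u h] by simp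
    also have "\<dots> = (?n - 1) * (V2 - c * V1 - c * (V1 - c * V))"
      unfolding Au[OF g] Au[OF h] A_sym[OF h g] Agh by (simp add: algebra_simps)
    also have "\<dots> = (?n - 1) * (V2 - V1\<^sup>2 / V)"
      unfolding c(2) by (simp add: c_def power2_eq_square)
    finally show ?thesis .
  qed
  define N where "N = int_dV K (\<lambda>x. (\<omega> x)\<^sup>2)"
  have E: "int_dV K (\<lambda>x. \<omega> x * (- LK K \<omega> x)) = N - (V2 - V1\<^sup>2 / V)"
  proof -
    have "sphere_int (\<lambda>x. (hom0 \<omega> x * h x) * volform h (\<lambda>y. hom0 \<omega> y * h y) 1 x) = A u u"
      by (simp add: hom0 A_def)
    then show ?thesis
      using K.int_LK[OF \<omega>] n1 Auu by (simp add: N_def h_def)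
  qed
  \<comment> \<open>The value c = V1 / V is the one that makes this integral vanish; the translation
    part contributes zero.\<close>
  have mean: "int_dV K \<omega> = 0"
  proof -
    have "int_dV K \<omega> = sphere_int (\<lambda>x. u x * D x)"
      unfolding int_dV_eq by (rule sphere_int_cong) (simp add: om[symmetric] h_def D_def)
    moreover have "(?n - 1) * sphere_int (\<lambda>x. u x * D x) = (?n - 1) * (V1 - c * V)"
      unfolding A_h[symmetric] A_sym[OF u h] Au[OF h] A_sym[OF h g] Agh by (simp add: algebra_simps)
    ultimately show ?thesis using n1 c by simp
  qed
  have hs: "h x \<noteq> 0" if "x \<in> sphere 0 1" for x using hpos[of x] nz[of x] that by force
  \<comment> \<open>The equation defining v removes the term in h_L(x) - x . v, and the barycentre
    identity removes the multiple of h.\<close>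
  have orth: "int_dV K (\<lambda>x. \<omega> x * ellv K b x) = 0" for b
  proof -
    have "int_dV K (\<lambda>x. \<omega> x * ellv K b x) =
        sphere_int (\<lambda>x. D x * ((g x - x \<bullet> v) / h x * (x \<bullet> b)) + (- c) * ((x \<bullet> b) * D x))"
      unfolding int_dV_eq
    proof (rule sphere_int_cong)
      fix x :: "real^'n" assume x: "norm x = 1"
      have "h x > 0" using hpos[OF nz[OF x]] .
      then show "(supp K x * detD2 (supp K) x) *\<^sub>R (\<omega> x * ellv K b x) =
          D x * ((g x - x \<bullet> v) / h x * (x \<bullet> b)) + (- c) * ((x \<bullet> b) * D x)"
        unfolding h_def[symmetric] D_def[symmetric] ellv_def \<omega>_def u_def l_def
        by (simp add: field_simps)
    qed
    also have "\<dots> = sphere_int (\<lambda>x. D x * ((g x - x \<bullet> v) / h x * (x \<bullet> b))) + (- c) * sphere_int (\<lambda>x. (x \<bullet> b) * D x)"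
      unfolding sphere_int_mult[symmetric]
      by (rule sphere_int_add; use hs in \<open>intro continuous_intros cont; blast\<close>)
    also have "\<dots> = 0"
      using translation_vector[OF KL, folded v_def h_def g_def, folded D_def, of b] intlin by simp
    finally show ?thesis .
  qed
  have "lambda2 K * N \<le> N - (V2 - V1\<^sup>2 / V)"
    using K.lambda2_le[OF n \<omega> mean orth] unfolding E N_def .
  then have main: "(lambda2 K - 1) * N \<le> V1\<^sup>2 / V - V2" by (simp add: algebra_simps)
  \<comment> \<open>Since omega h is the difference of the support functions, omega^2 dV_K and the
    integrand against dS_2 K agree up to the factor 1/n in dV_K.\<close>
  have "int_dS2 K (\<lambda>x. (supp L x - supp (ext_homothetic K L) x)^2) = ?n * N"
  proof -
    have "sphere_int (\<lambda>x. detD2 (supp K) x / supp K x * (supp L x - supp (ext_homothetic K L) x)\<^sup>2) = N"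
      unfolding N_def int_dV_eq
    proof (rule sphere_int_cong)
      fix x :: "real^'n" assume x: "norm x = 1"
      have "h x > 0" using hpos[OF nz[OF x]] .
      then show "detD2 (supp K) x / supp K x * (supp L x - supp (ext_homothetic K L) x)\<^sup>2 =
          (supp K x * detD2 (supp K) x) *\<^sub>R (\<omega> x)\<^sup>2"
        unfolding supp_ext h_def[symmetric] g_def[symmetric] D_def[symmetric] \<omega>_def u_def
        by (simp add: field_simps power2_eq_square)
    qed
    then show ?thesis by (simp add: int_dS2_def sph_int_eq)
  qed
  \<comment> \<open>Nonnegativity lets the square undo the square root in
    \<open>delta2_S2\<close>.\<close>
  moreover have "N \<ge> 0"
    unfolding N_def by (rule K.int_dV_square_nonneg[OF C2_sphere_continuous[OF \<omega>]])
  ultimately have "(delta2_S2 K L (ext_homothetic K L))\<^sup>2 = ?n * N"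
    by (simp add: delta2_S2_def)
  then have "(1 / ?n) * (lambda2 K - 1) * (delta2_S2 K L (ext_homothetic K L))\<^sup>2 = (lambda2 K - 1) * N"
    by simp
  then show ?thesis using main by (simp add: V_def V1_def V2_def)
qed

end
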